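(* Let $h_1,h_2,h_3\in\mathbb C$ satisfy $h_1+h_2+h_3=0$. For $u\in\mathbb C$, let ${}^aF(u)$ be a $\mathbb C$-vector space with the basis $\{|\lambda\rangle\}$ labeled by all Young diagrams $\lambda$. The following formulas define a $\ddot Y_{h_1,h_2,h_3}(\mathfrak{gl}_1)$-action on ${}^aF(u)$: $$e(z)|\lambda\rangle=\frac1{h_1z}\sum_{i\ge1}\prod_{j=1}^{i-1}\frac{((\lambda_i-\lambda_j)h_1+(i-j-1)h_2)((\lambda_i-\lambda_j+1)h_1+(i-j+1)h_2)}{((\lambda_i-\lambda_j)h_1+(i-j)h_2)((\lambda_i-\lambda_j+1)h_1+(i-j)h_2)}\,\delta^+\Big(\frac{\lambda_ih_1+(i-1)h_2+u}{z}\Big)\cdot|\lambda+i\rangle,$$ $$f(z)|\lambda\rangle=-\frac1{h_1z}\sum_{i\ge1}\prod_{j=i+1}^\infty\frac{((\lambda_j-\lambda_i+1)h_1+(j-i+1)h_2)((\lambda_{j+1}-\lambda_i)h_1+(j-i)h_2)}{((\lambda_{j+1}-\lambda_i+1)h_1+(j-i+1)h_2)((\lambda_j-\lambda_i)h_1+(j-i)h_2)}\times\frac{(\lambda_{i+1}-\lambda_i)h_1}{(\lambda_{i+1}-\lambda_i+1)h_1+h_2}\,\delta^+\Big(\frac{(\lambda_i-1)h_1+(i-1)h_2+u}{z}\Big)\cdot|\lambda-i\rangle,$$ $$\psi(z)|\lambda\rangle=\left(\prod_{i=1}^\infty\frac{(z-(\lambda_ih_1+ih_2+u))(z-((\lam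bda_{i+1}-1)h_1+(i-1)h_2+u))}{(z-(\lambda_{i+1}h_1+ih_2+u))(z-((\lambda_i-1)h_1+(i-1)h_2+u))}\right)^+\left(\frac{z-((\lambda_1-1)h_1-h_2+u)}{z-(\lambda_1h_1+u)}\right)^+\cdot|\lambda\rangle.$$
   Context: $\mathbb Z_+=\{0,1,2,\dots\}$, $\{a,b\}=ab+ba$, $\sigma_2=h_1h_2+h_1h_3+h_2h_3$, $\sigma_3=h_1h_2h_3$, and $\mathrm{Sym}_{\mathfrak S_3}$ is the sum over permutations of $i_1,i_2,i_3$. For $h_1,h_2,h_3\in\mathbb C$ with $h_1+h_2+h_3=0$, the affine Yangian $\ddot Y_{h_1,h_2,h_3}(\mathfrak{gl}_1)$ is the unital associative $\mathbb C$-algebra generated by $e_j,f_j,\psi_j$ ($j\in\mathbb Z_+$) with the relations ($i,j,i_1,i_2,i_3\in\mathbb Z_+$): - $[\psi_i,\psi_j]=0$, $[e_i,f_j]=\psi_{i+j}$; - $[e_{i+3},e_j]-3[e_{i+2},e_{j+1}]+3[e_{i+1},e_{j+2}]-[e_i,e_{j+3}]+\sigma_2([e_{i+1},e_j]-[e_i,e_{j+1}])=\sigma_3\{e_i,e_j\}$; - $[f_{i+3},f_j]-3[f_{i+2},f_{j+1}]+3[f_{i+1},f_{j+2}]-[f_i,f_{j+3}]+\sigma_2([f_{i+1},f_j]-[f_i,f_{j+1}])=-\sigma_3\{f_i,f_j\}$; - $[\psi_{i+3},e_j]-3[\psi_{i+2},e_{j+1}]+3[\psi_{i+1},e_{j+2}]-[\psi_i,e_{j+3}]+\sigma_2([\psi_{i+1},e_j]-[\psi_i,e_{j+1}])=\sigma_3\{\psi_i,e_j\}$;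 - $[\psi_{i+3},f_j]-3[\psi_{i+2},f_{j+1}]+3[\psi_{i+1},f_{j+2}]-[\psi_i,f_{j+3}]+\sigma_2([\psi_{i+1},f_j]-[\psi_i,f_{j+1}])=-\sigma_3\{\psi_i,f_j\}$; - $[\psi_0,e_j]=[\psi_1,e_j]=0$, $[\psi_2,e_j]=2e_j$; $[\psi_0,f_j]=[\psi_1,f_j]=0$, $[\psi_2,f_j]=-2f_j$; - $\mathrm{Sym}_{\mathfrak S_3}[e_{i_1},[e_{i_2},e_{i_3+1}]]=0$, $\mathrm{Sym}_{\mathfrak S_3}[f_{i_1},[f_{i_2},f_{i_3+1}]]=0$. Generating series: $e(z)=\sum_{j\ge0}e_jz^{-j-1}$, $f(z)=\sum_{j\ge0}f_jz^{-j-1}$, $\psi(z)=1+\sigma_3\sum_{j\ge0}\psi_jz^{-j-1}$. $\delta^+(w)=1+w+w^2+\cdots$; $\gamma(z)^+$ denotes the expansion of a rational function $\gamma(z)$ in $z^{-1}$. A Young diagram is $\lambda=(\lambda_1\ge\lambda_2\ge\cdots)$ with almost all $\lambda_i=0$; $\lambda+i$ and $\lambda-i$ denote the diagrams obtained from $\lambda$ by adding, respectively removing, a box in the $i$th row (terms for which the result is not a Young diagram do not occur).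
   Formalization: The formulas are undefined for some parameters (e.g. h1 = 0), so it is assumed that no denominator vanishes in an occurring term of e(z)|λ⟩ or f(z)|λ⟩: h1 ≠ 0 and n·h2 ≠ m·h1 for all integers n ≥ 1, m ≥ 0. *)

theory Defs
  imports
    "HOL-Algebra.QuotRing"
    "HOL-Algebra.Module"
    "HOL-Library.Poly_Mapping"
    "HOL-Computational_Algebra.Formal_Laurent_Series"
begin

subsection \<open>The affine Yangian\<close>

datatype yangian_gen = E nat | F nat | Psi nat

datatype 'g word = Word "'g list"

instantiation word :: (type) monoid_add
begin

definition zero_word :: "'a word" where "zero_word = Word []"

fun plus_word :: "'a word \<Rightarrow> 'a word \<Rightarrow> 'a word" where
  "plus_word (Word xs) (Word ys) = Word (xs @ ys)"

instance
proof
  fix a b c :: "'a word"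
  show "a + b + c = a + (b + c)" by (cases a; cases b; cases c) simp
  show "0 + a = a" by (cases a) (simp add: zero_word_def)
  show "a + 0 = a" by (cases a) (simp add: zero_word_def)
qed

end

text \<open>
  Words under concatenation, written additively, form the free monoid, so its monoid algebra
  (finitely supported functions with the convolution product) is the free unital associative
  algebra.
\<close>

type_synonym yangian_free = "yangian_gen word \<Rightarrow>\<^sub>0 complex"

definition free_gen :: "yangian_gen \<Rightarrow> yangian_free" where
  "free_gen g = Poly_Mapping.single (Word [g]) 1"

definition free_const :: "complex \<Rightarrow> yangian_free" where
  "free_const c = Poly_Mapping.single 0 c"

definition comm :: "'a::ring_1 \<Rightarrow> 'a \<Rightarrow> 'a" where
  "comm a b = a * b - b * a"

definition anticomm :: "'a::ring_1 \<Rightarrow> 'a \<Rightarrow> 'a" where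
  "anticomm a b = a * b + b * a"

definition sigma2 :: "complex \<Rightarrow> complex \<Rightarrow> complex \<Rightarrow> complex" where
  "sigma2 h1 h2 h3 = h1 * h2 + h1 * h3 + h2 * h3"

definition sigma3 :: "complex \<Rightarrow> complex \<Rightarrow> complex \<Rightarrow> complex" where
  "sigma3 h1 h2 h3 = h1 * h2 * h3"

definition cubic ::
  "complex \<Rightarrow> (nat \<Rightarrow> yangian_free) \<Rightarrow> (nat \<Rightarrow> yangian_free) \<Rightarrow> nat \<Rightarrow> nat \<Rightarrow> yangian_free" where
  "cubic s2 a b i j =
     comm (a (i + 3)) (b j) - 3 * comm (a (i + 2)) (b (j + 1))
     + 3 * comm (a (i + 1)) (b (j + 2)) - comm (a i) (b (j + 3))
     + free_const s2 * (comm (a (i + 1)) (b j) - comm (a i) (b (j + 1)))"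

definition serre :: "(nat \<Rightarrow> yangian_free) \<Rightarrow> nat \<Rightarrow> nat \<Rightarrow> nat \<Rightarrow> yangian_free" where
  "serre a i1 i2 i3 =
     (let t = (\<lambda>i j k. comm (a i) (comm (a j) (a (k + 1))))
      in t i1 i2 i3 + t i1 i3 i2 + t i2 i1 i3 + t i2 i3 i1 + t i3 i1 i2 + t i3 i2 i1)"

text \<open>An equation \<open>x = y\<close> of the presentation is recorded as the element \<open>x - y\<close>.\<close>

definition yangian_relations :: "complex \<Rightarrow> complex \<Rightarrow> complex \<Rightarrow> yangian_free set" where
  "yangian_relations h1 h2 h3 =
     (let e = (\<lambda>j. free_gen (E j)); f = (\<lambda>j. free_gen (F j)); \<psi> = (\<lambda>j. free_gen (Psi j));
          s2 = sigma2 h1 h2 h3; s3 = free_const (sigma3 h1 h2 h3)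
      in {comm (\<psi> i) (\<psi> j) | i j. True}
       \<union> {comm (e i) (f j) - \<psi> (i + j) | i j. True}
       \<union> {cubic s2 e e i j - s3 * anticomm (e i) (e j) | i j. True}
       \<union> {cubic s2 f f i j + s3 * anticomm (f i) (f j) | i j. True}
       \<union> {cubic s2 \<psi> e i j - s3 * anticomm (\<psi> i) (e j) | i j. True}
       \<union> {cubic s2 \<psi> f i j + s3 * anticomm (\<psi> i) (f j) | i j. True}
       \<union> {comm (\<psi> 0) (e j) | j. True} \<union> {comm (\<psi> 1) (e j) | j. True}
       \<union> {comm (\<psi> 2) (e j) - 2 * e j | j. True}
       \<union> {comm (\<psi> 0) (f j) | j. True} \<union> {comm (\<psi> 1) (f j) | j. True}
       \<union> {comm (\<psi> 2) (f j) + 2 * f j | j. True}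
       \<union> {serre e i1 i2 i3 | i1 i2 i3. True}
       \<union> {serre f i1 i2 i3 | i1 i2 i3. True})"

definition free_ring :: "yangian_free ring" where
  "free_ring = \<lparr>carrier = UNIV, monoid.mult = (*), one = 1, zero = 0, add = (+)\<rparr>"

definition yangian_ideal :: "complex \<Rightarrow> complex \<Rightarrow> complex \<Rightarrow> yangian_free set" where
  "yangian_ideal h1 h2 h3 = genideal free_ring (yangian_relations h1 h2 h3)"

definition yangian_class :: "complex \<Rightarrow> complex \<Rightarrow> complex \<Rightarrow> yangian_free \<Rightarrow> yangian_free set" where
  "yangian_class h1 h2 h3 x = yangian_ideal h1 h2 h3 +>\<^bsub>free_ring\<^esub> x"

text \<open>
  \<open>Algebra\<close> has no locale of noncommutative algebras; the record type \<open>module\<close> is used here, and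
  in \<open>endo_algebra\<close> below, for a ring together with a scalar multiplication.
\<close>

definition affine_yangian ::
  "complex \<Rightarrow> complex \<Rightarrow> complex \<Rightarrow> (complex, yangian_free set) module" where
  "affine_yangian h1 h2 h3 =
     (let Q = free_ring Quot yangian_ideal h1 h2 h3
      in \<lparr>carrier = carrier Q, monoid.mult = monoid.mult Q, one = one Q, zero = zero Q, add = add Q,
          module.smult = (\<lambda>c A. monoid.mult Q (yangian_class h1 h2 h3 (free_const c)) A)\<rparr>)"

definition yangian_e :: "complex \<Rightarrow> complex \<Rightarrow> complex \<Rightarrow> nat \<Rightarrow> yangian_free set" where
  "yangian_e h1 h2 h3 j = yangian_class h1 h2 h3 (free_gen (E j))"

definition yangian_f :: "complex \<Rightarrow> complex \<Rightarrow> complex \<Rightarrow> nat \<Rightarrow> yangian_free set" where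
  "yangian_f h1 h2 h3 j = yangian_class h1 h2 h3 (free_gen (F j))"

definition yangian_psi :: "complex \<Rightarrow> complex \<Rightarrow> complex \<Rightarrow> nat \<Rightarrow> yangian_free set" where
  "yangian_psi h1 h2 h3 j = yangian_class h1 h2 h3 (free_gen (Psi j))"


subsection \<open>Actions on a complex vector space\<close>

definition endo_algebra ::
  "(complex \<Rightarrow> 'v::ab_group_add \<Rightarrow> 'v) \<Rightarrow> (complex, 'v \<Rightarrow> 'v) module" where
  "endo_algebra scale =
     \<lparr>carrier = {T. Vector_Spaces.linear scale scale T}, monoid.mult = (\<circ>), one = id,
      zero = (\<lambda>v. 0), add = (\<lambda>S T v. S v + T v), module.smult = (\<lambda>c T v. scale c (T v))\<rparr>"

text \<open>
  \<open>extensional\<close> pins down the irrelevant values of \<open>\<rho>\<close> outside the algebra, so that equality of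
  actions is equality of functions.
\<close>

definition yangian_action ::
  "complex \<Rightarrow> complex \<Rightarrow> complex \<Rightarrow> (complex \<Rightarrow> 'v::ab_group_add \<Rightarrow> 'v) \<Rightarrow>
   (yangian_free set \<Rightarrow> 'v \<Rightarrow> 'v) \<Rightarrow> bool" where
  "yangian_action h1 h2 h3 scale \<rho> \<longleftrightarrow>
     \<rho> \<in> extensional (carrier (affine_yangian h1 h2 h3)) \<and>
     \<rho> \<in> ring_hom (affine_yangian h1 h2 h3) (endo_algebra scale) \<and>
     (\<forall>c. \<forall>A \<in> carrier (affine_yangian h1 h2 h3).
        \<rho> (c \<odot>\<^bsub>affine_yangian h1 h2 h3\<^esub> A) = c \<odot>\<^bsub>endo_algebra scale\<^esub> \<rho> A)"

definition is_basis :: "(complex \<Rightarrow> 'v::ab_group_add \<Rightarrow> 'v) \<Rightarrow> ('i \<Rightarrow> 'v) \<Rightarrow> bool" where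
  "is_basis scale b \<longleftrightarrow>
     inj b \<and> \<not> Modules.module.dependent scale (range b) \<and> Modules.module.span scale (range b) = UNIV"


subsection \<open>Young diagrams\<close>

text \<open>Rows are numbered from 1; the value 0 at index 0 is a convention.\<close>

definition is_young :: "(nat \<Rightarrow> nat) \<Rightarrow> bool" where
  "is_young l \<longleftrightarrow> l 0 = 0 \<and> (\<forall>i\<ge>1. l (i + 1) \<le> l i) \<and> finite {i. l i \<noteq> 0}"

typedef young = "{l. is_young l}"
  morphisms row Abs_young
  by (rule exI[of _ "\<lambda>_. 0"]) (simp add: is_young_def)

definition addable :: "young \<Rightarrow> nat \<Rightarrow> bool" where
  "addable l i \<longleftrightarrow> i \<ge> 1 \<and> is_young ((row l)(i := row l i + 1))"

definition removable :: "young \<Rightarrow> nat \<Rightarrow> bool" where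
  "removable l i \<longleftrightarrow> i \<ge> 1 \<and> row l i \<ge> 1 \<and> is_young ((row l)(i := row l i - 1))"

definition add_box :: "young \<Rightarrow> nat \<Rightarrow> young" where
  "add_box l i = Abs_young ((row l)(i := row l i + 1))"

definition remove_box :: "young \<Rightarrow> nat \<Rightarrow> young" where
  "remove_box l i = Abs_young ((row l)(i := row l i - 1))"

definition row_len :: "young \<Rightarrow> nat \<Rightarrow> complex" where
  "row_len l i = of_nat (row l i)"


subsection \<open>Series in the inverse of z\<close>

text \<open>
  Formal Laurent series in \<open>fls_X\<close>, read as \<open>z\<inverse>\<close>: the coefficient at index \<open>n\<close> is that
  of \<open>z\<^sup>-\<^sup>n\<close>. A rational function in \<open>z\<close>, evaluated in this field at \<open>z = fls_X_inv\<close>, is its own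
  expansion \<open>\<gamma>(z)\<^sup>+\<close>.
\<close>

definition zvar :: "complex fls" where
  "zvar = fls_X_inv"

text \<open>\<open>delta_plus a\<close> is \<open>\<delta>\<^sup>+(a/z)\<close>.\<close>

definition delta_plus :: "complex \<Rightarrow> complex fls" where
  "delta_plus a = fps_to_fls (fps_compose (Abs_fps (\<lambda>_. 1)) (fps_const a * fps_X))"

text \<open>
  A series in powers of \<open>z\<close> with vector coefficients is a function on \<open>int\<close> with the same
  indexing. \<open>current x\<close> is the sum of \<open>x j z\<^sup>-\<^sup>j\<^sup>-\<^sup>1\<close> over \<open>j \<ge> 0\<close>, and \<open>series_ket scale g v\<close> is
  \<open>g(z) \<cdot> v\<close>.
\<close>

definition current :: "(nat \<Rightarrow> 'v::ab_group_add) \<Rightarrow> int \<Rightarrow> 'v" where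
  "current x n = (if n \<ge> 1 then x (nat (n - 1)) else 0)"

definition series_ket ::
  "(complex \<Rightarrow> 'v::ab_group_add \<Rightarrow> 'v) \<Rightarrow> complex fls \<Rightarrow> 'v \<Rightarrow> int \<Rightarrow> 'v" where
  "series_ket scale g v n = scale (fls_nth g n) v"


subsection \<open>The matrix coefficients\<close>

definition e_num :: "complex \<Rightarrow> complex \<Rightarrow> young \<Rightarrow> nat \<Rightarrow> nat \<Rightarrow> complex" where
  "e_num h1 h2 l i j =
     ((row_len l i - row_len l j) * h1 + (of_nat i - of_nat j - 1) * h2)
     * ((row_len l i - row_len l j + 1) * h1 + (of_nat i - of_nat j + 1) * h2)"

definition e_den :: "complex \<Rightarrow> complex \<Rightarrow> young \<Rightarrow> nat \<Rightarrow> nat \<Rightarrow> complex" where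
  "e_den h1 h2 l i j =
     ((row_len l i - row_len l j) * h1 + (of_nat i - of_nat j) * h2)
     * ((row_len l i - row_len l j + 1) * h1 + (of_nat i - of_nat j) * h2)"

definition e_series :: "complex \<Rightarrow> complex \<Rightarrow> complex \<Rightarrow> young \<Rightarrow> nat \<Rightarrow> complex fls" where
  "e_series h1 h2 u l i =
     1 / (fls_const h1 * zvar)
     * fls_const (\<Prod>j\<in>{1..<i}. e_num h1 h2 l i j / e_den h1 h2 l i j)
     * delta_plus (row_len l i * h1 + (of_nat i - 1) * h2 + u)"

definition f_num :: "complex \<Rightarrow> complex \<Rightarrow> young \<Rightarrow> nat \<Rightarrow> nat \<Rightarrow> complex" where
  "f_num h1 h2 l i j =
     ((row_len l j - row_len l i + 1) * h1 + (of_nat j - of_nat i + 1) * h2)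
     * ((row_len l (j + 1) - row_len l i) * h1 + (of_nat j - of_nat i) * h2)"

definition f_den :: "complex \<Rightarrow> complex \<Rightarrow> young \<Rightarrow> nat \<Rightarrow> nat \<Rightarrow> complex" where
  "f_den h1 h2 l i j =
     ((row_len l (j + 1) - row_len l i + 1) * h1 + (of_nat j - of_nat i + 1) * h2)
     * ((row_len l j - row_len l i) * h1 + (of_nat j - of_nat i) * h2)"

definition f_last_den :: "complex \<Rightarrow> complex \<Rightarrow> young \<Rightarrow> nat \<Rightarrow> complex" where
  "f_last_den h1 h2 l i = (row_len l (i + 1) - row_len l i + 1) * h1 + h2"

text \<open>
  In the infinite products below almost all factors are 1 (both rows involved are empty), so they
  are instances of \<open>Prod_any\<close>.
\<close>

definition f_series :: "complex \<Rightarrow> complex \<Rightarrow> complex \<Rightarrow> young \<Rightarrow> nat \<Rightarrow> complex fls" where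
  "f_series h1 h2 u l i =
     - (1 / (fls_const h1 * zvar))
     * fls_const (Prod_any (\<lambda>j. if j \<ge> i + 1 then f_num h1 h2 l i j / f_den h1 h2 l i j else 1))
     * fls_const ((row_len l (i + 1) - row_len l i) * h1 / f_last_den h1 h2 l i)
     * delta_plus ((row_len l i - 1) * h1 + (of_nat i - 1) * h2 + u)"

definition psi_factor :: "complex \<Rightarrow> complex \<Rightarrow> complex \<Rightarrow> young \<Rightarrow> nat \<Rightarrow> complex fls" where
  "psi_factor h1 h2 u l i =
     ((zvar - fls_const (row_len l i * h1 + of_nat i * h2 + u))
      * (zvar - fls_const ((row_len l (i + 1) - 1) * h1 + (of_nat i - 1) * h2 + u)))
     / ((zvar - fls_const (row_len l (i + 1) * h1 + of_nat i * h2 + u))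
      * (zvar - fls_const ((row_len l i - 1) * h1 + (of_nat i - 1) * h2 + u)))"

definition psi_series :: "complex \<Rightarrow> complex \<Rightarrow> complex \<Rightarrow> young \<Rightarrow> complex fls" where
  "psi_series h1 h2 u l =
     Prod_any (\<lambda>i. if i \<ge> 1 then psi_factor h1 h2 u l i else 1)
     * ((zvar - fls_const ((row_len l 1 - 1) * h1 - h2 + u))
        / (zvar - fls_const (row_len l 1 * h1 + u)))"

text \<open>
  The condition under which the formulas are meaningful: no denominator of a term that occurs
  vanishes. (The denominators in the formula for \<open>\<psi>(z)\<close> are nonzero for all parameters.)
\<close>

definition denominators_nonzero :: "complex \<Rightarrow> complex \<Rightarrow> bool" where
  "denominators_nonzero h1 h2 \<longleftrightarrow>
     h1 \<noteq> 0 \<and>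
     (\<forall>l i. addable l i \<longrightarrow> (\<forall>j\<in>{1..<i}. e_den h1 h2 l i j \<noteq> 0)) \<and>
     (\<forall>l i. removable l i \<longrightarrow> (\<forall>j\<ge>i + 1. f_den h1 h2 l i j \<noteq> 0) \<and> f_last_den h1 h2 l i \<noteq> 0)"

lemma young_antimono:
  assumes "1 \<le> i" "i \<le> j"
  shows "row l j \<le> row l i"
  using assms(2,1)
proof (induction j rule: dec_induct)
  case (step n)
  then show ?case using row[of l] by (auto simp: is_young_def intro: order_trans)
qed simp

lemma denominators_nonzero_iff:
  "denominators_nonzero h1 h2 \<longleftrightarrow>
     h1 \<noteq> 0 \<and> (\<forall>m n::nat. n \<ge> 1 \<longrightarrow> of_nat n * h2 \<noteq> of_nat m * h1)"
  (is "?L \<longleftrightarrow> ?h1 \<and> ?R")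
proof (intro iffI conjI allI impI)
  assume ?L
  then show "?h1" by (simp add: denominators_nonzero_def)
next
  fix m n :: nat assume L: ?L and n: "n \<ge> 1"
  define r where "r = (\<lambda>k. if 1 \<le> k \<and> k \<le> n then m + 1 else 0)"
  have fin: "finite {k. f k \<noteq> 0}" if "\<And>k. k > n + 1 \<Longrightarrow> f k = 0" for f :: "nat \<Rightarrow> nat"
    by (rule finite_subset[of _ "{..n + 1}"]) (use that in \<open>force simp flip: linorder_not_less\<close>, simp)
  have r: "is_young r" unfolding is_young_def
    by (intro conjI fin) (auto simp: r_def)
  have row: "row (Abs_young r) = r" using r by (simp add: Abs_young_inverse)
  have "is_young (r(n + 1 := r (n + 1) + 1))" unfolding is_young_def
    by (intro conjI fin) (auto simp: r_def)
  then have "addable (Abs_young r) (n + 1)"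
    unfolding addable_def row by simp
  then have "e_den h1 h2 (Abs_young r) (n + 1) 1 \<noteq> 0"
    using L n unfolding denominators_nonzero_def by auto
  moreover have "row_len (Abs_young r) (n + 1) = 0" "row_len (Abs_young r) 1 = of_nat m + 1"
    using n by (simp_all only: row_len_def row) (simp_all add: r_def)
  ultimately have "(of_nat n * h2 - (of_nat m + 1) * h1) * (of_nat n * h2 - of_nat m * h1) \<noteq> 0"
    by (simp add: e_den_def algebra_simps)
  then show "of_nat n * h2 \<noteq> of_nat m * h1" by simp
next
  assume "?h1 \<and> ?R"
  then have h1: ?h1 and R: ?R by auto
  have nz: "x * h1 + y * h2 \<noteq> 0"
    if "x = - of_nat m" "y = of_nat n" "n \<ge> 1" for x y and m n :: nat
    using R that by (auto simp: add_eq_0_iff)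
  show ?L unfolding denominators_nonzero_def
  proof (intro conjI allI impI ballI)
    fix l i j assume a: "addable l i" and j: "j \<in> {1..<i}"
    have "is_young ((row l)(i := row l i + 1))" "i - 1 \<ge> 1"
      using a j by (auto simp: addable_def)
    then have "((row l)(i := row l i + 1)) (i - 1 + 1) \<le> ((row l)(i := row l i + 1)) (i - 1)"
      unfolding is_young_def by blast
    then have "row l i + 1 \<le> row l (i - 1)" using j by (auto split: if_splits)
    also have "\<dots> \<le> row l j" using j by (intro young_antimono) auto
    finally have le: "row l i + 1 \<le> row l j" .
    have "(row_len l i - row_len l j) * h1 + (of_nat i - of_nat j) * h2 \<noteq> 0"
      by (rule nz[of _ "row l j - row l i" _ "i - j"])
         (use le j in \<open>auto simp: row_len_def\<close>)
    moreover have "(row_len l i - row_len l j + 1) * h1 + (of_nat i - of_nat j) * h2 \<noteq> 0"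
      by (rule nz[of _ "row l j - (row l i + 1)" _ "i - j"])
         (use le j in \<open>auto simp: row_len_def\<close>)
    ultimately show "e_den h1 h2 l i j \<noteq> 0" by (simp add: e_den_def)
  next
    fix l i assume a: "removable l i"
    have y: "is_young ((row l)(i := row l i - 1))" and i: "i \<ge> 1" "row l i \<ge> 1"
      using a by (auto simp: removable_def)
    have "((row l)(i := row l i - 1)) (i + 1) \<le> ((row l)(i := row l i - 1)) i"
      using y i unfolding is_young_def by blast
    then have le1: "row l (i + 1) + 1 \<le> row l i" using i by auto
    have le: "row l k + 1 \<le> row l i" if "k \<ge> i + 1" for k
      using young_antimono[of "i + 1" k l] that le1 by auto
    have "(row_len l (i + 1) - row_len l i + 1) * h1 + 1 * h2 \<noteq> 0"
      by (rule nz[of _ "row l i - (row l (i + 1) + 1)" _ 1])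
         (use le1 in \<open>auto simp: row_len_def\<close>)
    then show "f_last_den h1 h2 l i \<noteq> 0" by (simp add: f_last_den_def)
    fix j assume j: "j \<ge> i + 1"
    have le2: "row l (j + 1) + 1 \<le> row l i" "row l j \<le> row l i"
      using le[of "j + 1"] le[of j] j by auto
    have "(row_len l (j + 1) - row_len l i + 1) * h1 + (of_nat j - of_nat i + 1) * h2 \<noteq> 0"
      by (rule nz[of _ "row l i - (row l (j + 1) + 1)" _ "j - i + 1"])
         (use le2 j in \<open>auto simp: row_len_def\<close>)
    moreover have "(row_len l j - row_len l i) * h1 + (of_nat j - of_nat i) * h2 \<noteq> 0"
      by (rule nz[of _ "row l i - row l j" _ "j - i"])
         (use le2 j in \<open>auto simp: row_len_def\<close>)
    ultimately show "f_den h1 h2 l i j \<noteq> 0" by (simp add: f_den_def)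
  qed (use h1 in simp)
qed


subsection \<open>The formulas\<close>

definition fock_formulas ::
  "complex \<Rightarrow> complex \<Rightarrow> complex \<Rightarrow> complex \<Rightarrow> (complex \<Rightarrow> 'v::ab_group_add \<Rightarrow> 'v) \<Rightarrow>
   (young \<Rightarrow> 'v) \<Rightarrow> (yangian_free set \<Rightarrow> 'v \<Rightarrow> 'v) \<Rightarrow> bool" where
  "fock_formulas h1 h2 h3 u scale ket \<rho> \<longleftrightarrow>
     (\<forall>l n. current (\<lambda>j. \<rho> (yangian_e h1 h2 h3 j) (ket l)) n =
        (\<Sum>i | addable l i. series_ket scale (e_series h1 h2 u l i) (ket (add_box l i)) n)) \<and>
     (\<forall>l n. current (\<lambda>j. \<rho> (yangian_f h1 h2 h3 j) (ket l)) n =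
        (\<Sum>i | removable l i. series_ket scale (f_series h1 h2 u l i) (ket (remove_box l i)) n)) \<and>
     (\<forall>l n. series_ket scale 1 (ket l) n
          + scale (sigma3 h1 h2 h3) (current (\<lambda>j. \<rho> (yangian_psi h1 h2 h3 j) (ket l)) n) =
        series_ket scale (psi_series h1 h2 u l) (ket l) n)"

end

theory Submission
  imports Defs
begin

text \<open>
  Put \<open>p\<^sub>i = \<lambda>\<^sub>i h1 + (i - 1) h2 + u\<close>, the position of the box that row \<open>i\<close> would receive next,
  and \<open>A w = (w - h2) (w - h3) / (w (w + h1))\<close>. The coefficient of \<open>e\<close> for row \<open>i\<close> is \<open>1 / h1\<close>
  times the product of \<open>A (p\<^sub>i - p\<^sub>j)\<close> over \<open>j < i\<close>. The infinite product in the coefficient of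
  \<open>f\<close> telescopes: for every \<open>N\<close> beyond the last nonempty row it leaves the product of
  \<open>A (p\<^sub>j - p\<^sub>i)\<close> over \<open>i < j \<le> N\<close> and a factor that depends on row \<open>i\<close> only. Because \<open>A h2 = 0\<close>
  and because of the last factor if \<open>i = N\<close>, these coefficients vanish by themselves when the box
  cannot be added or removed. So all sums may run over the rows \<open>1, \<dots>, N\<close>, a product of operators
  is a multiple sum over rows, and a relation holds if the terms belonging to the different orders
  of the same steps cancel.

  Moving one row shifts the arguments of \<open>A\<close> by \<open>h1\<close>. Two boxes added in the two possible orders
  have coefficients in the ratio \<open>A (w - h1) : A w = - q (- w) : q w\<close> with
  \<open>q w = (w - h1) (w - h2) (w - h3)\<close>, which is the cubic relation (\<open>pair_exchange\<close>,
  \<open>cubic_relation\<close>). For three boxes the Serre relation says that the coefficients of the six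
  orders, weighted by the second difference \<open>z\<^sub>1 - 2 z\<^sub>2 + z\<^sub>3\<close> of the positions, add up to zero,
  an identity of rational functions (\<open>serre_sum_generic\<close>, \<open>serre_relation\<close>). The operators \<open>f\<close>
  arise from \<open>e\<close> by reversing the order of the rows and the direction of the steps; the locale
  \<open>ladder\<close> treats both, with a sign \<open>s\<close>.

  In \<open>[e\<^sub>i, f\<^sub>j]\<close> the terms that move two different rows cancel, and the diagonal terms depend on
  \<open>i + j\<close> only; they define the eigenvalues of \<open>\<psi>\<close>. The rational function in the formula for
  \<open>\<psi>(z)\<close> has simple, pairwise distinct poles at the addable and removable corners, and the
  diagonal terms times \<open>h1 h2 h3\<close> are its residues (\<open>EF_diagonal\<close>, \<open>FE_diagonal\<close>,
  \<open>psi_rational_phi\<close>). Adding a box at \<open>x\<close> multiplies this function by \<open>- q (- w) / q w\<close>, where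
  \<open>w = z - x\<close>, and the coefficients of the resulting functional equation (\<open>phi_step\<close>) are the
  relations between \<open>\<psi>\<close> and \<open>e\<close> and between \<open>\<psi>\<close> and \<open>f\<close>.

  If \<open>h3 = 0\<close>, then \<open>\<psi>(z) = 1\<close> carries no information about the \<open>\<psi>\<^sub>j\<close>. For existence the
  functional equation is then proved from the residues themselves; for uniqueness
  \<open>\<psi>\<^sub>j = [e\<^sub>j, f\<^sub>0]\<close> determines \<open>\<psi>\<^sub>j\<close> for all parameters.
\<close>

section \<open>Rational identities for the interaction of rows\<close>

text \<open>The identities hold over any field; besides \<open>complex\<close> they are used over the field of
  Laurent series in the inverse of \<open>z\<close>.\<close>

locale yangian_parameters =
  fixes h1 h2 h3 :: "'a::field"
  assumes sum0: "h1 + h2 + h3 = 0"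
begin

definition A where "A w = (w - h2) * (w - h3) / (w * (w + h1))"

lemma h3_eq: "h3 = - h1 - h2" using sum0 by (simp add: add_eq_0_iff algebra_simps)

lemma A_h2: "A h2 = 0" by (simp add: A_def)

lemma A_shift: "A (w - h1) = (w + h2) * (w + h3) / ((w - h1) * w)"
  unfolding A_def unfolding h3_eq by (simp add: algebra_simps)

text \<open>At \<open>w = h2 = - h1\<close>, which occurs for adjacent rows of equal length when \<open>h3 = 0\<close>, the
  function \<open>A\<close> takes the value \<open>0\<close> by the convention \<open>x / 0 = 0\<close>. Multiplied by \<open>w + h1\<close> it obeys
  the generic formula there too, so the identities below need no separate treatment of this case.\<close>

lemma A_cleared:
  assumes "w \<noteq> - h1 \<or> w = h2" shows "(w + h1) * A w = (w - h2) * (w - h3) / w"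
  using assms by (cases "w = h2") (auto simp: A_def add_eq_0_iff2)

definition q where "q w = (w - h1) * (w - h2) * (w - h3)"

lemma q_eq: "q w = w ^ 3 + (h1 * h2 + h1 * h3 + h2 * h3) * w - h1 * h2 * h3"
  unfolding q_def unfolding h3_eq by (simp add: algebra_simps power3_eq_cube)

lemma pair_exchange:
  assumes "w \<noteq> 0" "w \<noteq> h1" "w \<noteq> - h1 \<or> w = h2"
  shows "A (w - h1) * q w + A w * q (- w) = 0"
proof -
  have 1: "q (-w) = - (w + h1) * ((w + h2) * (w + h3))" by (simp add: q_def algebra_simps)
  have "A w * q (-w) = - (((w + h1) * A w) * ((w + h2) * (w + h3)))"
    unfolding 1 by (simp add: algebra_simps)
  also have "\<dots> = - ((w - h2) * (w - h3) / w * ((w + h2) * (w + h3)))"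
    using A_cleared[of w] assms by simp
  finally show ?thesis using assms by (simp add: A_shift q_def divide_simps)
qed

text \<open>The Serre identity for two boxes in one row and one box in a row that depends on it: the
  arguments of \<open>A\<close> are the differences of positions when the third box comes last, in the middle
  and first.\<close>

lemma serre_double_below:
  assumes "w \<noteq> 0" "w \<noteq> h1" "w \<noteq> 2 * h1" "w \<noteq> - h1 \<or> w = h2"
  shows "(w - 2 * h1) * A (w - 2 * h1) + (h1 - 2 * w) * A (w - h1) + (w + h1) * A w = 0"
proof -
  have 1: "A (w - 2 * h1) = (w - h1 + h2) * (w - h1 + h3) / ((w - 2 * h1) * (w - h1))"
    using A_shift[of "w - h1"] by (simp add: algebra_simps)
  show ?thesis using assms unfolding A_cleared[OF assms(4)] 1 unfolding A_shift
    apply (simp add: divide_simps) unfolding h3_eq by (simp add: algebra_simps)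
qed

text \<open>The same with the roles exchanged: the row with two boxes depends on the row of the single
  box. A common factor \<open>A w\<close> has been cancelled.\<close>

lemma serre_double_above:
  assumes "w \<noteq> 0" "w \<noteq> h1" "w \<noteq> - h1" "w \<noteq> - 2 * h1 \<or> w + h1 = h2"
  shows "(h1 - w) * A (w - h1) + (2 * w + h1) * A w - (w + 2 * h1) * A (w + h1) = 0"
proof -
  have 2: "w + h1 + h1 = w + 2 * h1" by simp
  have 1: "(w + 2 * h1) * A (w + h1) = (w + h1 - h2) * (w + h1 - h3) / (w + h1)"
    using A_cleared[of "w + h1"] assms(4) unfolding 2 by (auto simp: eq_neg_iff_add_eq_0 2)
  have nz: "w + h1 \<noteq> 0" using assms by (simp add: add_eq_0_iff2)
  show ?thesis using assms(1,2) nz unfolding 1 unfolding A_shift unfolding A_def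
    apply (simp add: divide_simps) unfolding h3_eq by (simp add: algebra_simps)
qed

text \<open>The sum over the orders \<open>xyz\<close>, \<open>xzy\<close>, \<open>zxy\<close>, \<open>yxz\<close>, \<open>yzx\<close>, \<open>zyx\<close> of three boxes at positions
  \<open>x\<close>, \<open>y = x + a\<close>, \<open>z = x + a + b\<close>. Each pair contributes \<open>A\<close> of its distance, shifted by \<open>h1\<close> if
  it occurs in the order in which the boxes are named here, and the whole is weighted by the
  second difference of the positions.\<close>

definition serre_sum where
  "serre_sum a b = (let c = a + b in
      (b - a) * A (a - h1) * A (b - h1) * A (c - h1)
    + (- b - c) * A (a - h1) * A b * A (c - h1)
    + (c + a) * A (a - h1) * A b * A c
    + (a + c) * A a * A (b - h1) * A (c - h1)
    + (- c - b) * A a * A (b - h1) * A c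
    + (b - a) * A a * A b * A c)"

text \<open>Since \<open>(w - h2) (w - h3) = w (w + h1) + h2 h3\<close>, the Serre sum becomes a polynomial of degree
  three in \<open>h2 h3\<close> whose coefficients can be treated one by one.\<close>

lemma A_kappa:
  "w \<noteq> 0 \<Longrightarrow> w + h1 \<noteq> 0 \<Longrightarrow> A w = (w * (w + h1) + h2 * h3) / (w * (w + h1))"
  unfolding A_def unfolding h3_eq by (simp add: algebra_simps)

lemma A_kappa_shift:
  "w \<noteq> 0 \<Longrightarrow> w - h1 \<noteq> 0 \<Longrightarrow> A (w - h1) = (w * (w - h1) + h2 * h3) / (w * (w - h1))"
  using A_kappa[of "w - h1"] by (simp add: algebra_simps)

text \<open>The sum factors through the differences \<open>al' - al\<close>, \<open>be' - be\<close>, \<open>ga' - ga\<close>, each of which is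
  \<open>2 h\<close> over an odd cubic; the three products then combine because \<open>c = a + b\<close>.\<close>

lemma serre_quadratic_part: fixes a b c h :: 'a
  assumes "c = a + b" "a \<noteq> 0" "b \<noteq> 0" "c \<noteq> 0"
    "a + h \<noteq> 0" "b + h \<noteq> 0" "c + h \<noteq> 0" "a - h \<noteq> 0" "b - h \<noteq> 0" "c - h \<noteq> 0"
  defines "al \<equiv> 1 / (a * (a + h))" and "be \<equiv> 1 / (b * (b + h))" and "ga \<equiv> 1 / (c * (c + h))"
    and "al' \<equiv> 1 / (a * (a - h))" and "be' \<equiv> 1 / (b * (b - h))" and "ga' \<equiv> 1 / (c * (c - h))"
  shows "al' * be' * (b - a) + al' * be * (a - b) + al * be' * (a - b) + al * be * (b - a)
    + al' * ga' * (- b - 2 * a) + al' * ga * (2 * a + b) + al * ga' * (2 * a + b)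
        + al * ga * (- 2 * a - b)
    + be' * ga' * (a + 2 * b) + be' * ga * (- a - 2 * b) + be * ga' * (- a - 2 * b)
        + be * ga * (a + 2 * b) = 0"
proof -
  have "(al' - al) * (be' - be) * (b - a) - (al' - al) * (ga' - ga) * (2 * a + b)
     + (be' - be) * (ga' - ga) * (a + 2 * b) = 0"
  proof -
    have 1: "1 / (x * (x - h)) - 1 / (x * (x + h)) = 2 * h / (x * ((x + h) * (x - h)))"
      if "x \<noteq> 0" "x + h \<noteq> 0" "x - h \<noteq> 0" for x
      using that by (simp add: divide_simps)
    have "(x * x - h * h) = (x + h) * (x - h)" for x by (simp add: algebra_simps)
    then have 2: "(b - a) * (c * ((c + h) * (c - h))) - (2 * a + b) * (b * ((b + h) * (b - h)))
      + (a + 2 * b) * (a * ((a + h) * (a - h))) = 0"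
      unfolding assms(1) by (simp add: algebra_simps)
    have 3: "p / x * (p / y) * t1 - p / x * (p / z) * t2 + p / y * (p / z) * t3 = 0"
      if "t1 * z - t2 * y + t3 * x = 0" "x \<noteq> 0" "y \<noteq> 0" "z \<noteq> 0" for p x y z t1 t2 t3 :: 'a
    proof -
      have "p / x * (p / y) * t1 - p / x * (p / z) * t2 + p / y * (p / z) * t3 =
         p * p * (t1 * z - t2 * y + t3 * x) / (x * y * z)"
        using that(2-) by (simp add: divide_simps) (simp add: algebra_simps)
      then show ?thesis using that(1) by simp
    qed
    show ?thesis unfolding al_def be_def ga_def al'_def be'_def ga'_def
      unfolding 1[OF assms(2,5,8)] 1[OF assms(3,6,9)] 1[OF assms(4,7,10)]
      by (rule 3[OF 2]) (use assms(2-10) in auto)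
  qed
  then show ?thesis by (simp add: algebra_simps)
qed

lemma serre_cubic_part: fixes a b c h :: 'a
  assumes "c = a + b" "a \<noteq> 0" "b \<noteq> 0" "c \<noteq> 0"
    "a + h \<noteq> 0" "b + h \<noteq> 0" "c + h \<noteq> 0" "a - h \<noteq> 0" "b - h \<noteq> 0" "c - h \<noteq> 0"
  defines "al \<equiv> 1 / (a * (a + h))" and "be \<equiv> 1 / (b * (b + h))" and "ga \<equiv> 1 / (c * (c + h))"
    and "al' \<equiv> 1 / (a * (a - h))" and "be' \<equiv> 1 / (b * (b - h))" and "ga' \<equiv> 1 / (c * (c - h))"
  shows "al' * be' * ga' * (b - a) + al' * be * ga' * (- a - 2 * b) + al' * be * ga * (2 * a + b)
    + al * be' * ga' * (2 * a + b) + al * be' * ga * (- a - 2 * b) + al * be * ga * (b - a) = 0"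
proof -
  define D where "D = a * b * c * ((a + h) * (b + h) * (c + h)) * ((a - h) * (b - h) * (c - h))"
  have e: "D * (x * y * z * t) = (a * (a + h) * (a - h) * x) * (b * (b + h) * (b - h) * y) *
      (c * (c + h) * (c - h) * z) * t"
    for x y z t by (simp add: D_def mult_ac)
  have f: "a * (a + h) * (a - h) * al = a - h" "b * (b + h) * (b - h) * be = b - h"
      "c * (c + h) * (c - h) * ga = c - h"
     "a * (a + h) * (a - h) * al' = a + h" "b * (b + h) * (b - h) * be' = b + h"
         "c * (c + h) * (c - h) * ga' = c + h"
    using assms(2-10) by (simp_all add: al_def be_def ga_def al'_def be'_def ga'_def)
  have "D * (al' * be' * ga' * (b - a) + al' * be * ga' * (- a - 2 * b)
      + al' * be * ga * (2 * a + b)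
    + al * be' * ga' * (2 * a + b) + al * be' * ga * (- a - 2 * b) + al * be * ga * (b - a)) = 0"
    unfolding distrib_left[of D] e f unfolding assms(1) by (simp add: algebra_simps)
  moreover have "D \<noteq> 0" using assms(2-10) by (simp add: D_def)
  ultimately show ?thesis by (metis mult_eq_0_iff)
qed

lemma serre_sum_generic:
  assumes "a \<noteq> 0" "a \<noteq> h1" "a \<noteq> - h1" "b \<noteq> 0" "b \<noteq> h1" "b \<noteq> - h1" "a + b \<noteq> 0" "a + b \<noteq> h1"
      "a + b \<noteq> - h1"
  shows "serre_sum a b = 0"
proof -
  have nz: "a + h1 \<noteq> 0" "b + h1 \<noteq> 0" "a + b + h1 \<noteq> 0" "a - h1 \<noteq> 0" "b - h1 \<noteq> 0" "a + b - h1 \<noteq> 0"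
    using assms by (auto simp: add_eq_0_iff2)
  define c where "c = a + b"
  define al be ga al' be' ga' where "al = 1 / (a * (a + h1))" and "be = 1 / (b * (b + h1))"
      and "ga = 1 / (c * (c + h1))"
    and "al' = 1 / (a * (a - h1))" and "be' = 1 / (b * (b - h1))" and "ga' = 1 / (c * (c - h1))"
  note defs = al_def be_def ga_def al'_def be'_def ga'_def
  define k where "k = h2 * h3"
  have c: "c \<noteq> 0" "c + h1 \<noteq> 0" "c - h1 \<noteq> 0" using assms nz by (auto simp: c_def)
  have A: "A a = 1 + k * al" "A b = 1 + k * be" "A c = 1 + k * ga"
     "A (a - h1) = 1 + k * al'" "A (b - h1) = 1 + k * be'" "A (c - h1) = 1 + k * ga'"
    using assms(1,4) c nz by (simp_all add: A_kappa A_kappa_shift defs add_divide_distrib k_def)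
  note k2 = serre_quadratic_part[OF c_def assms(1,4) c(1) nz(1,2) c(2) nz(4,5) c(3), folded defs]
  note k3 = serre_cubic_part[OF c_def assms(1,4) c(1) nz(1,2) c(2) nz(4,5) c(3), folded defs]

  \<comment> \<open>The coefficients of \<open>1\<close> and \<open>k\<close> vanish: the second differences of three orders that agree on
      the relative order of one pair add up to zero.\<close>
  have E: "(b - a) * (1 + k * al') * (1 + k * be') * (1 + k * ga')
      + (- b - (a + b)) * (1 + k * al') * (1 + k * be) * (1 + k * ga')
    + (a + b + a) * (1 + k * al') * (1 + k * be) * (1 + k * ga)
        + (a + (a + b)) * (1 + k * al) * (1 + k * be') * (1 + k * ga')
    + (- (a + b) - b) * (1 + k * al) * (1 + k * be') * (1 + k * ga)
        + (b - a) * (1 + k * al) * (1 + k * be) * (1 + k * ga)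
   = k\<^sup>2 * (al' * be' * (b - a) + al' * be * (a - b) + al * be' * (a - b) + al * be * (b - a)
    + al' * ga' * (- b - 2 * a) + al' * ga * (2 * a + b) + al * ga' * (2 * a + b)
        + al * ga * (- 2 * a - b)
    + be' * ga' * (a + 2 * b) + be' * ga * (- a - 2 * b) + be * ga' * (- a - 2 * b)
        + be * ga * (a + 2 * b))
    + k ^ 3 * (al' * be' * ga' * (b - a) + al' * be * ga' * (- a - 2 * b)
        + al' * be * ga * (2 * a + b)
    + al * be' * ga' * (2 * a + b) + al * be' * ga * (- a - 2 * b) + al * be * ga * (b - a))"
    for al be ga al' be' ga' k :: 'a
    by (simp add: algebra_simps power2_eq_square power3_eq_cube)
  show ?thesis unfolding serre_sum_def Let_def c_def[symmetric] A
    using E[where al = al and be = be and ga = ga and al' = al' and be' = be' and ga' = ga' and k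
        = k]
    unfolding c_def[symmetric] k2 k3 by simp
qed

text \<open>If two of the boxes lie in adjacent rows of equal length, \<open>A h2 = 0\<close> removes three of the
  six orders. The remaining sum has the same shape for the upper and the lower pair.\<close>

lemma serre_adjacent:
  assumes "x \<noteq> 0" "x \<noteq> h1" "x \<noteq> - h1" "x + h2 \<noteq> 0" "x + h2 \<noteq> h1" "x + h2 \<noteq> - h1"
  shows "(x - h2) * (A (x - h1) * A (x + h2 - h1)) - (2 * x + h2) * (A x * A (x + h2 - h1))
    + (x + 2 * h2) * (A x * A (x + h2)) = 0"
proof -
  define c where "c = x + h2"
  have nz: "x + h1 \<noteq> 0" "c + h1 \<noteq> 0" "x - h1 \<noteq> 0" "c - h1 \<noteq> 0" "c \<noteq> 0"
    using assms by (auto simp: add_eq_0_iff2 c_def)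
  have e: "x - h3 = c + h1" "c - h3 = c + h1 + h2" "x + h3 = x - h1 - h2" "c + h3 = x - h1"
      "c - h2 = x" "x + h2 = c" "c + h2 = x + 2 * h2"
    unfolding c_def h3_eq by (simp_all add: algebra_simps)
  have 1: "A (x - h1) * A (c - h1) = (x - h1 - h2) * (x + 2 * h2) / (x * (c - h1))"
  proof -
    have "y * n / (m * z) * (t * m / (l * y)) = n * t / (z * l)"
      if "y \<noteq> 0" "m \<noteq> 0" for y n m z t l :: 'a using that by (simp add: mult_ac)
    then show ?thesis unfolding A_shift e using nz by blast
  qed
  have 2: "A x * A (c - h1) = (x - h2) * (c + h1) * ((x + 2 * h2) * (x - h1)) /
      ((x * (x + h1)) * ((c - h1) * c))"
    unfolding A_shift unfolding A_def e by (simp add: mult_ac)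
  have 3: "A x * A c = (x - h2) * (c + h1 + h2) / ((x + h1) * c)"
  proof -
    have "n * l / (y * m) * (y * k / (z * l)) = n * k / (m * z)"
      if "y \<noteq> 0" "l \<noteq> 0" for y n m z k l :: 'a using that by (simp add: mult_ac)
    then have "(x - h2) * (c + h1) / (x * (x + h1)) * (x * (c + h1 + h2) / (c * (c + h1)))
        = (x - h2) * (c + h1 + h2) / ((x + h1) * c)"
      using nz assms(1) by blast
    then show ?thesis unfolding A_def e .
  qed
  have p: "(x - h1 - h2) * ((x + h1) * c) - (2 * x + h2) * ((c + h1) * (x - h1))
     + (c + h1 + h2) * (x * (c - h1)) = 0" unfolding c_def by (simp add: algebra_simps)
  have r: "m * (n1 * t / (a * b)) - l * (m * n2 * (t * n4) / (a * d * (b * e)))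
      + t * (m * n3 / (d * e)) = 0"
    if "n1 * (d * e) - l * (n2 * n4) + n3 * (a * b) = 0" "a \<noteq> 0" "b \<noteq> 0" "d \<noteq> 0" "e \<noteq> 0"
    for m n1 n2 n3 n4 t a b d e l :: 'a
  proof -
    have x: "m * (n1 * t / (a * b)) = m * t * (n1 * (d * e)) / (a * d * (b * e))"
        "l * (m * n2 * (t * n4) / (a * d * (b * e))) = m * t * (l * (n2 * n4)) / (a * d * (b * e))"
        "t * (m * n3 / (d * e)) = m * t * (n3 * (a * b)) / (a * d * (b * e))"
      using that(2-) by (simp_all add: frac_eq_eq mult_ac)
    have "m * t * (n1 * (d * e)) / (a * d * (b * e)) - m * t * (l * (n2 * n4)) / (a * d * (b * e))
       + m * t * (n3 * (a * b)) / (a * d * (b * e))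
      = m * t * (n1 * (d * e) - l * (n2 * n4) + n3 * (a * b)) / (a * d * (b * e))"
      by (simp add: add_divide_distrib diff_divide_distrib distrib_left right_diff_distrib)
    then show ?thesis unfolding x using that(1) by simp
  qed
  show ?thesis unfolding c_def[symmetric] 1 2 3
    by (rule r) (use p assms(1) nz in auto)
qed

lemma serre_sum_adjacent_left:
  assumes "b \<noteq> 0" "b \<noteq> h1" "b \<noteq> - h1" "h2 + b \<noteq> 0" "h2 + b \<noteq> h1" "h2 + b \<noteq> - h1"
  shows "serre_sum h2 b = 0"
proof -
  have "serre_sum h2 b = A (h2 - h1) * ((b - h2) * (A (b - h1) * A (b + h2 - h1))
    - (2 * b + h2) * (A b * A (b + h2 - h1)) + (b + 2 * h2) * (A b * A (b + h2)))"
    unfolding serre_sum_def Let_def A_h2 add.commute[of h2] by (simp add: algebra_simps)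
  then show ?thesis using serre_adjacent[of b] assms by (simp add: add.commute)
qed

lemma serre_sum_adjacent_right:
  assumes "a \<noteq> 0" "a \<noteq> h1" "a \<noteq> - h1" "a + h2 \<noteq> 0" "a + h2 \<noteq> h1" "a + h2 \<noteq> - h1"
  shows "serre_sum a h2 = 0"
proof -
  have "serre_sum a h2 = - A (h2 - h1) * ((a - h2) * (A (a - h1) * A (a + h2 - h1))
    - (2 * a + h2) * (A a * A (a + h2 - h1)) + (a + 2 * h2) * (A a * A (a + h2)))"
    unfolding serre_sum_def Let_def A_h2 by (simp add: algebra_simps)
  then show ?thesis using serre_adjacent[of a] assms by simp
qed

lemma serre_sum_adjacent_both: "serre_sum h2 h2 = 0"
  unfolding serre_sum_def Let_def A_h2 by simp

end

section \<open>Diagrams as integer sequences\<close>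

text \<open>Young diagrams as integer sequences: adding and removing a box become shifts of one entry by
  \<open>1\<close> and \<open>- 1\<close>, which commute and make sense whether or not the result is a diagram.\<close>

definition young_seq :: "(nat \<Rightarrow> int) \<Rightarrow> bool" where
  "young_seq m \<longleftrightarrow> m 0 = 0 \<and> (\<forall>i\<ge>1. m (i + 1) \<le> m i) \<and> finite {i. m i \<noteq> 0}"

definition shift :: "(nat \<Rightarrow> int) \<Rightarrow> nat \<Rightarrow> int \<Rightarrow> nat \<Rightarrow> int" where
  "shift m i s = m(i := m i + s)"

lemma shift_apply: "shift m i s j = (if j = i then m i + s else m j)"
  by (simp add: shift_def)

lemma shift_commute: "shift (shift m i s) k t = shift (shift m k t) i s"
  by (auto simp: shift_def fun_eq_iff)

lemma young_seq_antimono: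
  assumes "young_seq m" "1 \<le> i" "i \<le> j" shows "m j \<le> m i"
  using assms(3,2)
proof (induction j rule: dec_induct)
  case (step n)
  then show ?case using assms(1) by (auto simp: young_seq_def intro: order_trans)
qed simp

lemma young_seq_vanishes: assumes "young_seq m" shows "\<exists>b\<ge>1. \<forall>i\<ge>b. m i = 0"
proof -
  have "finite {i. m i \<noteq> 0}" using assms by (simp add: young_seq_def)
  then obtain b where "\<forall>i\<in>{i. m i \<noteq> 0}. i < b" using finite_nat_set_iff_bounded by blast
  then show ?thesis by (intro exI[of _ "Suc b"]) (force simp: not_less)
qed

lemma young_seq_nonneg: assumes "young_seq m" shows "0 \<le> m i"
proof (cases "i = 0")
  case False
  obtain b where "b \<ge> 1" "\<forall>i\<ge>b. m i = 0" using young_seq_vanishes[OF assms] by blast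
  then show ?thesis using young_seq_antimono[OF assms, of i "max i b"] False by auto
qed (use assms in \<open>simp add: young_seq_def\<close>)

definition vanishes_from :: "nat \<Rightarrow> (nat \<Rightarrow> int) \<Rightarrow> bool" where
  "vanishes_from b m \<longleftrightarrow> young_seq m \<and> b \<ge> 1 \<and> m b = 0"

lemma vanishes_fromD: "vanishes_from b m \<Longrightarrow> i \<ge> b \<Longrightarrow> m i = 0"
  using young_seq_antimono[of m b i] young_seq_nonneg[of m i] by (auto simp: vanishes_from_def)

lemma vanishes_from_mono: "vanishes_from b m \<Longrightarrow> b \<le> b' \<Longrightarrow> vanishes_from b' m"
  using vanishes_fromD[of b m b'] by (auto simp: vanishes_from_def)

lemma vanishes_from_ex: "young_seq m \<Longrightarrow> \<exists>b. vanishes_from b m"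
  using young_seq_vanishes[of m] by (auto simp: vanishes_from_def)

text \<open>The bound grows by at most one with each step, so a fixed number of rows suffices for a
  product of boundedly many operators.\<close>

lemma vanishes_from_shift:
  assumes "vanishes_from b m" "young_seq (shift m i s)" shows "vanishes_from (Suc b) (shift m i s)"
proof -
  have b: "b \<ge> 1" "m b = 0" "m (Suc b) = 0" using assms(1) vanishes_fromD[OF assms(1)]
      by (auto simp: vanishes_from_def)
  have "shift m i s (Suc b) \<le> shift m i s b" using young_seq_antimono[OF assms(2) b(1), of "Suc b"]
      by simp
  moreover have "0 \<le> shift m i s (Suc b)" by (rule young_seq_nonneg[OF assms(2)])
  ultimately show ?thesis using b assms(2)
      by (auto simp: vanishes_from_def shift_apply split: if_splits)
qed

lemma finite_support_shift: "finite {i. m i \<noteq> 0} \<Longrightarrow> finite {i. shift m k s i \<noteq> 0}"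
  by (rule finite_subset[of _ "insert k {i. m i \<noteq> 0}"]) (auto simp: shift_apply)

lemma young_seq_add_iff:
  assumes "young_seq m" "i \<ge> 1" shows "young_seq (shift m i 1) \<longleftrightarrow> i = 1 \<or> m i < m (i - 1)"
proof
  assume "young_seq (shift m i 1)"
  then show "i = 1 \<or> m i < m (i - 1)"
  proof (cases "i = 1")
    case False
    then have "1 \<le> i - 1" "i - 1 \<noteq> i" using assms(2) by auto
    then show ?thesis using young_seq_antimono[of "shift m i 1" "i - 1" i] \<open>young_seq (shift m i 1)\<close>
        by (simp add: shift_apply)
  qed simp
next
  assume *: "i = 1 \<or> m i < m (i - 1)"
  have "shift m i 1 (k + 1) \<le> shift m i 1 k" if "k \<ge> 1" for k
    using * assms young_seq_antimono[OF assms(1) that, of "k + 1"] that by (auto simp: shift_apply)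
  then show "young_seq (shift m i 1)" using assms finite_support_shift
      by (auto simp: young_seq_def shift_apply)
qed

lemma young_seq_remove_iff:
  assumes "young_seq m" "i \<ge> 1" shows "young_seq (shift m i (- 1)) \<longleftrightarrow> m (i + 1) < m i"
proof
  assume "young_seq (shift m i (- 1))"
  then show "m (i + 1) < m i"
    using young_seq_antimono[of "shift m i (- 1)" i "i + 1"] assms(2) by (auto simp: shift_apply)
next
  assume *: "m (i + 1) < m i"
  have "shift m i (- 1) (k + 1) \<le> shift m i (- 1) k" if "k \<ge> 1" for k
    using * assms young_seq_antimono[OF assms(1) that, of "k + 1"] that by (auto simp: shift_apply)
  then show "young_seq (shift m i (- 1))" using assms finite_support_shift
      by (auto simp: young_seq_def shift_apply)
qed

section \<open>Coefficients of ladder operators\<close>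

text \<open>Together the two conditions are what the nonvanishing of all denominators amounts to.\<close>

locale fock_parameters = yangian_parameters h1 h2 h3 for h1 h2 h3 :: complex +
  fixes u :: complex
  assumes h1_nz: "h1 \<noteq> 0"
    and nonresonant: "\<And>a b :: nat. b \<ge> 1 \<Longrightarrow> of_nat b * h2 \<noteq> of_nat a * h1"
begin

lemma nonresonant_int:
  fixes a b :: int assumes "a \<le> 0" "b \<ge> 1" shows "of_int a * h1 + of_int b * h2 \<noteq> 0"
  using nonresonant[of "nat b" "nat (- a)"] assms by (auto simp: add_eq_0_iff)

definition pos :: "(nat \<Rightarrow> int) \<Rightarrow> nat \<Rightarrow> complex" where
  "pos m i = of_int (m i) * h1 + (of_nat i - 1) * h2 + u"

lemma pos_shift: "pos (shift m i s) j = (if j = i then pos m i + of_int s * h1 else pos m j)"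
  by (simp add: pos_def shift_apply algebra_simps)

lemma pos_diff: "pos m j - pos m i = of_int (m j - m i) * h1 + of_int (int j - int i) * h2"
  by (simp add: pos_def algebra_simps)

end

text \<open>The common form of \<open>e\<close> (\<open>s = 1\<close>) and \<open>f\<close> (\<open>s = - 1\<close>): a step moves row \<open>i\<close> by \<open>s\<close>, and its
  coefficient is the product of \<open>A\<close> over the rows below \<open>i\<close> in the order of the rows for \<open>s = 1\<close>
  and in the reversed order for \<open>s = - 1\<close>, times a factor \<open>g\<close> that depends on row \<open>i\<close> alone. In
  both cases a step in row \<open>i\<close> raises \<open>s p\<^sub>i\<close> by \<open>h1\<close>.\<close>

locale ladder = fock_parameters +
  fixes s :: int and N :: nat and g :: "nat \<Rightarrow> int \<Rightarrow> complex"
  assumes s_sign: "s = 1 \<or> s = - 1"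
begin

definition below :: "nat \<Rightarrow> nat set" where
  "below k = {i \<in> {1..N}. s * (int k - int i) > 0}"

lemma finite_below [simp]: "finite (below k)" by (simp add: below_def)

lemma below_irrefl: "i \<notin> below i" by (simp add: below_def)

lemma below_asym: "i \<in> below k \<Longrightarrow> k \<notin> below i" by (auto simp: below_def algebra_simps)

lemma below_trans: "i \<in> below j \<Longrightarrow> j \<in> below k \<Longrightarrow> i \<in> below k"
  using s_sign by (auto simp: below_def algebra_simps)

lemma below_total: "i \<in> {1..N} \<Longrightarrow> k \<in> {1..N} \<Longrightarrow> i = k \<or> i \<in> below k \<or> k \<in> below i"
  using s_sign by (auto simp: below_def algebra_simps)

abbreviation step :: "(nat \<Rightarrow> int) \<Rightarrow> nat \<Rightarrow> nat \<Rightarrow> int" where "step m i \<equiv> shift m i s"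

definition gap :: "(nat \<Rightarrow> int) \<Rightarrow> nat \<Rightarrow> nat \<Rightarrow> complex" where
  "gap m i k = of_int s * (pos m k - pos m i)"

lemma s_sq: "of_int s * of_int s = (1 :: complex)" using s_sign by auto

lemma gap_step:
  "gap (step m r) i k = gap m i k + (if r = k \<and> r \<noteq> i then h1 else if r = i \<and> r \<noteq> k then
      - h1 else 0)"
proof -
  have "of_int s * (of_int s * x) = x" for x :: complex using s_sq by (metis mult.assoc mult_1)
  then show ?thesis by (auto simp: gap_def pos_shift algebra_simps)
qed

lemma gap_eq: "gap m i k = - of_int (s * (m i - m k)) * h1 + of_int (s * (int k - int i)) * h2"
  unfolding gap_def pos_diff by (simp add: algebra_simps)

lemma gap_add: "gap m i j + gap m j k = gap m i k" by (simp add: gap_def algebra_simps)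

text \<open>Leaving out the rows in \<open>S\<close> makes the coefficient insensitive to steps in these rows; all
  dependence on the order of steps is then in the factors \<open>A\<close> split off.\<close>

definition coef_without :: "nat set \<Rightarrow> (nat \<Rightarrow> int) \<Rightarrow> nat \<Rightarrow> complex" where
  "coef_without S m k = g k (m k) * (\<Prod>j\<in>below k - S. A (gap m j k))"

abbreviation coef :: "(nat \<Rightarrow> int) \<Rightarrow> nat \<Rightarrow> complex" where "coef \<equiv> coef_without {}"

lemma coef_split:
  assumes "S \<subseteq> below k" shows "coef m k = coef_without S m k * (\<Prod>j\<in>S. A (gap m j k))"
  using prod.subset_diff[OF assms, of "\<lambda>j. A (gap m j k)"] by (simp add: coef_without_def mult_ac)

lemma coef_split1: "i \<in> below k \<Longrightarrow> coef m k = coef_without {i} m k * A (gap m i k)"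
  using coef_split[of "{i}"] by simp

lemma coef_split2:
  "i \<in> below k \<Longrightarrow> j \<in> below k \<Longrightarrow> i \<noteq> j \<Longrightarrow> coef m k
      = coef_without {i, j} m k * A (gap m i k) * A (gap m j k)"
  using coef_split[of "{i, j}"] by simp

lemma coef_without_step:
  assumes "r \<noteq> k" "r \<in> S \<or> r \<notin> below k" shows "coef_without S (step m r) k = coef_without S m k"
proof -
  have "(\<Prod>j\<in>below k - S. A (gap (step m r) j k)) = (\<Prod>j\<in>below k - S. A (gap m j k))"
    using assms by (intro prod.cong refl) (auto simp: gap_step)
  then show ?thesis using assms(1) by (simp add: coef_without_def shift_apply)
qed

lemma gap_sign:
  assumes "young_seq m" "i \<in> below k" "k \<in> {1..N}"
  shows "s * (m i - m k) \<ge> 0" "s * (int k - int i) \<ge> 1"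
proof -
  show "s * (int k - int i) \<ge> 1" using assms(2) by (simp add: below_def)
  show "s * (m i - m k) \<ge> 0"
    using s_sign assms young_seq_antimono[OF assms(1), of i k]
        young_seq_antimono[OF assms(1), of k i]
    by (auto simp: below_def)
qed

lemma gap_nonzero:
  assumes "young_seq m" "i \<in> below k" "k \<in> {1..N}" and "r \<ge> 0"
  shows "gap m i k \<noteq> of_int r * h1"
proof
  assume "gap m i k = of_int r * h1"
  then have "of_int (- s * (m i - m k) - r) * h1 + of_int (s * (int k - int i)) * h2 = 0"
    by (simp add: gap_eq algebra_simps)
  then show False using nonresonant_int[of "- s * (m i - m k) - r" "s * (int k - int i)"]
     gap_sign[OF assms(1-3)] assms(4) by simp
qed

lemma gap_generic:
  assumes "young_seq m" "i \<in> below k" "k \<in> {1..N}"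
  shows "gap m i k \<noteq> 0" "gap m i k \<noteq> h1" "gap m i k \<noteq> 2 * h1"
  using gap_nonzero[OF assms, of 0] gap_nonzero[OF assms, of 1] gap_nonzero[OF assms, of 2]
      by simp_all

lemma gap_not_negative:
  assumes "young_seq m" "i \<in> below k" "k \<in> {1..N}" "s * (m i - m k) \<ge> r"
  shows "gap m i k \<noteq> - of_int r * h1"
proof
  assume "gap m i k = - of_int r * h1"
  then have "of_int (- s * (m i - m k) + r) * h1 + of_int (s * (int k - int i)) * h2 = 0"
    by (simp add: gap_eq algebra_simps)
  then show False using nonresonant_int[of "- s * (m i - m k) + r" "s * (int k - int i)"]
     gap_sign[OF assms(1-3)] assms(4) by simp
qed

text \<open>If row \<open>k\<close> overtakes the old level of row \<open>i\<close>, every row between them must have moved as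
  well.\<close>

lemma no_row_between:
  assumes y: "young_seq m" "young_seq m'" and ik: "i \<in> below k" "k \<in> {1..N}"
    and r: "i \<in> below r" "r \<in> below k" "m' r = m r"
    and grow: "s * (m' k - m k) > s * (m i - m k)"
  shows False
proof (cases "s = 1")
  case True
  then have "i < r" "r < k" "1 \<le> i" using r ik unfolding below_def by auto
  then show False using young_seq_antimono[OF y(1), of i r] young_seq_antimono[OF y(2), of r k] True
      grow r(3) by auto
next
  case False
  then have s: "s = - 1" using s_sign by auto
  then have "k < r" "r < i" "1 \<le> k" using r ik unfolding below_def by auto
  then show False using young_seq_antimono[OF y(1), of r i] young_seq_antimono[OF y(2), of k r] s
      grow r(3) by auto
qed

lemma not_adjacent_between:
  assumes "i \<in> below k" "k \<in> {1..N}" "s * (int k - int i) \<noteq> 1"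
  obtains r where "i \<in> below r" "r \<in> below k" "r \<in> {1..N}"
proof -
  define r where "r = nat (int i + s)"
  have "i \<in> below r" "r \<in> below k" "r \<in> {1..N}"
    using assms s_sign by (auto simp: r_def below_def)
  then show ?thesis by (rule that)
qed

lemma between_unique_adjacent:
  assumes "i \<in> below k" "k \<in> {1..N}"
    and "\<And>r. i \<in> below r \<Longrightarrow> r \<in> below k \<Longrightarrow> False"
  shows "s * (int k - int i) = 1"
  using not_adjacent_between[OF assms(1,2)] assms(3) by blast

lemma gap_equal_rows:
  assumes "s * (m i - m k) = 0" "s * (int k - int i) = 1" shows "gap m i k = h2"
  using assms unfolding gap_eq assms by simp

text \<open>The only possible pole of \<open>A\<close> at a gap comes from rows of equal length; if row \<open>k\<close> moves and
  no row strictly between does, they are adjacent and the gap is \<open>h2\<close>, where \<open>A\<close> vanishes.\<close>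

lemma gap_pair:
  assumes y: "young_seq m" "young_seq m'" and ik: "i \<in> below k" "k \<in> {1..N}"
    and m': "m' k = m k + s" "\<And>r. i \<in> below r \<Longrightarrow> r \<in> below k \<Longrightarrow> m' r = m r"
  shows "gap m i k \<noteq> - h1 \<or> gap m i k = h2"
proof (cases "s * (m i - m k) \<ge> 1")
  case True
  then show ?thesis using gap_not_negative[OF y(1) ik True] by simp
next
  case False
  then have 0: "s * (m i - m k) = 0" using gap_sign[OF y(1) ik] by linarith
  have "s * s = 1" using s_sign by auto
  then have "s * (int k - int i) = 1"
    using no_row_between[OF y ik] 0 m' by (intro between_unique_adjacent[OF ik]) auto
  then show ?thesis using gap_equal_rows[OF 0] by simp
qed

lemma pair_coef:
  assumes y: "young_seq m" "young_seq (step (step m i) k)" and ik: "i \<in> {1..N}" "k \<in> {1..N}"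
  shows "coef m i * coef (step m i) k * q (of_int s * (pos (step m i) k - pos m i))
       + coef m k * coef (step m k) i * q (of_int s * (pos (step m k) i - pos m k)) = 0"
proof -
  have *: "coef m i * coef (step m i) k * q (of_int s * (pos (step m i) k - pos m i))
       + coef m k * coef (step m k) i * q (of_int s * (pos (step m k) i - pos m k)) = 0"
    if ik: "i \<in> below k" "k \<in> {1..N}" and y: "young_seq (step (step m i) k)" for i k
  proof -
    have ne: "i \<noteq> k" using below_irrefl ik by auto
    note b = below_asym[OF ik(1)]
    have 1: "coef (step m i) k = coef_without {i} m k * A (gap m i k - h1)"
      using ne by (simp add: coef_split1[OF ik(1)] coef_without_step gap_step)
    have 2: "coef m k = coef_without {i} m k * A (gap m i k)" by (rule coef_split1[OF ik(1)])
    have 3: "coef (step m k) i = coef m i" using ne b by (simp add: coef_without_step)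
    have 4: "of_int s * (pos (step m i) k - pos m i) = gap m i k"
            "of_int s * (pos (step m k) i - pos m k) = - gap m i k"
      using ne by (simp_all add: pos_shift gap_def algebra_simps)
    have "gap m i k \<noteq> - h1 \<or> gap m i k = h2"
      by (rule gap_pair[OF assms(1) y ik]) (use ne below_irrefl in \<open>auto simp: shift_apply\<close>)
    then have "A (gap m i k - h1) * q (gap m i k) + A (gap m i k) * q (- gap m i k) = 0"
      by (intro pair_exchange gap_generic[OF assms(1) ik])
    then have "coef m i * coef_without {i} m k *
       (A (gap m i k - h1) * q (gap m i k) + A (gap m i k) * q (- gap m i k)) = 0" by simp
    then show ?thesis unfolding 1 2 3 4 by (simp add: algebra_simps)
  qed
  consider "i = k" | "i \<in> below k" | "k \<in> below i" using below_total[OF ik] by blast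
  then show ?thesis
  proof cases
    case 1
    have "of_int s * (pos (step m i) i - pos m i) = h1"
      using s_sq by (simp add: pos_shift mult.assoc[symmetric])
    then show ?thesis using 1 by (simp add: q_def)
  next
    case 2 then show ?thesis using *[of i k] ik y by simp
  next
    case 3 then show ?thesis using *[of k i] ik y by (simp add: shift_commute[of m i] add.commute)
  qed
qed

text \<open>The contribution of the steps \<open>i\<close>, \<open>j\<close>, \<open>k\<close>, in this order, to the symmetrized triple
  commutator.\<close>

definition serre_path :: "(nat \<Rightarrow> int) \<Rightarrow> nat \<Rightarrow> nat \<Rightarrow> nat \<Rightarrow> complex" where
  "serre_path m i j k = coef m i * coef (step m i) j * coef (step (step m i) j) k *
     (pos m i - 2 * pos (step m i) j + pos (step (step m i) j) k)"

text \<open>The six coefficients share the factor \<open>X\<close>; what remains is \<open>serre_sum\<close>. Of the hypotheses of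
  \<open>serre_sum_generic\<close> only those excluding \<open>- h1\<close> can fail, and only for rows of equal length,
  which are then adjacent.\<close>

lemma serre_path_distinct:
  assumes y: "young_seq m" "young_seq (step (step (step m i) j) k)" and ij: "i \<in> below j"
      and jk: "j \<in> below k"
    and R: "k \<in> {1..N}"
  shows "serre_path m i j k + serre_path m i k j + serre_path m k i j + serre_path m j i k
      + serre_path m j k i + serre_path m k j i = 0"
proof -
  have ik: "i \<in> below k" using below_trans[OF ij jk] .
  have j: "j \<in> {1..N}" using jk by (simp add: below_def)
  have ne: "i \<noteq> j" "j \<noteq> k" "i \<noteq> k" "j \<noteq> i" "k \<noteq> j" "k \<noteq> i" using below_irrefl ij jk ik by auto
  note b = below_asym[OF ij] below_asym[OF jk] below_asym[OF ik]
  note simps = coef_split1[OF ij] coef_split2[OF ik jk ne(1)] coef_without_step gap_step ne b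
  define X where "X = coef m i * coef_without {i} m j * coef_without {i, j} m k"
  let ?a = "gap m i j" and ?b = "gap m j k"
  have c: "gap m i k = ?a + ?b" by (simp add: gap_add)
  have C: "coef m i * coef (step m i) j * coef (step (step m i) j) k
      = X * (A (?a - h1) * A (?b - h1) * A (?a + ?b - h1))"
    "coef m i * coef (step m i) k * coef (step (step m i) k) j
        = X * (A (?a - h1) * A ?b * A (?a + ?b - h1))"
    "coef m k * coef (step m k) i * coef (step (step m k) i) j
        = X * (A (?a - h1) * A ?b * A (?a + ?b))"
    "coef m j * coef (step m j) i * coef (step (step m j) i) k
        = X * (A ?a * A (?b - h1) * A (?a + ?b - h1))"
    "coef m j * coef (step m j) k * coef (step (step m j) k) i
        = X * (A ?a * A (?b - h1) * A (?a + ?b))"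
    "coef m k * coef (step m k) j * coef (step (step m k) j) i = X * (A ?a * A ?b * A (?a + ?b))"
    unfolding c[symmetric] X_def by (simp_all add: simps mult_ac)
  have P: "of_int s * (pos m i - 2 * pos (step m i) j + pos (step (step m i) j) k) = ?b - ?a"
    "of_int s * (pos m i - 2 * pos (step m i) k + pos (step (step m i) k) j) = - ?b - (?a + ?b)"
    "of_int s * (pos m k - 2 * pos (step m k) i + pos (step (step m k) i) j) = ?a + ?b + ?a"
    "of_int s * (pos m j - 2 * pos (step m j) i + pos (step (step m j) i) k) = ?a + (?a + ?b)"
    "of_int s * (pos m j - 2 * pos (step m j) k + pos (step (step m j) k) i) = - (?a + ?b) - ?b"
    "of_int s * (pos m k - 2 * pos (step m k) j + pos (step (step m k) j) i) = ?b - ?a"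
    using ne by (simp_all add: pos_shift gap_def algebra_simps)
  have serre: "serre_sum ?a ?b = 0"
  proof -
    note nz = gap_generic[OF y(1) ij j] gap_generic[OF y(1) jk R]
        gap_generic[OF y(1) ik R, unfolded c]
    let ?m' = "step (step (step m i) j) k"
    have touched: "?m' j = m j + s" "?m' k = m k + s" "?m' i = m i + s"
        "\<And>r. r \<notin> {i, j, k} \<Longrightarrow> ?m' r = m r"
      using ne by (auto simp: shift_apply)
    have notin: "r \<notin> {i, j, k}" if "i \<in> below r" "r \<in> below j" for r
      using that below_trans[OF that(2) jk] below_irrefl by auto
    have notin': "r \<notin> {i, j, k}" if "j \<in> below r" "r \<in> below k" for r
      using that below_trans[OF ij that(1)] below_irrefl by auto
    have a: "?a \<noteq> - h1 \<or> ?a = h2"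
      by (rule gap_pair[OF y ij j touched(1)]) (rule touched(4), rule notin)
    have b: "?b \<noteq> - h1 \<or> ?b = h2"
      by (rule gap_pair[OF y jk R touched(2)]) (rule touched(4), rule notin')
    have "s * s = 1" using s_sign by auto
    then have grow: "s * (?m' k - m k) = 1" "s * (?m' j - m j) = 1" by (simp_all add: touched)

    \<comment> \<open>Rows of equal length that both move are adjacent, hence \<open>h2\<close> apart.\<close>
    have adj1: "?a = h2" if "s * (m i - m j) = 0"
      by (intro gap_equal_rows[OF that] between_unique_adjacent[OF ij j])
         (use no_row_between[OF y ij j] touched(4) notin grow that in auto)
    have adj2: "?b = h2" if "s * (m j - m k) = 0"
      by (intro gap_equal_rows[OF that] between_unique_adjacent[OF jk R])
         (use no_row_between[OF y jk R] touched(4) notin' grow that in auto)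
    have sum: "s * (m i - m k) = s * (m i - m j) + s * (m j - m k)" by (simp add: algebra_simps)
    note sg = gap_sign(1)[OF y(1) ij j] gap_sign(1)[OF y(1) jk R]
    have nm: "gap m p r \<noteq> - h1" if "s * (m p - m r) \<ge> 1" "p \<in> below r" "r \<in> {1..N}" for p r
      using gap_not_negative[OF y(1) that(2,3,1)] by simp
    have cm: "?a + ?b \<noteq> - h1" if "s * (m i - m j) \<noteq> 0 \<or> s * (m j - m k) \<noteq> 0"
      using nm[OF _ ik R] sum sg that unfolding c by linarith
    consider "s * (m i - m j) = 0" "s * (m j - m k) = 0" | "s * (m i - m j) = 0"
        "s * (m j - m k) \<ge> 1"
      | "s * (m i - m j) \<ge> 1" "s * (m j - m k) = 0" | "s * (m i - m j) \<ge> 1" "s * (m j - m k) \<ge> 1"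
      using sg by linarith
    then show ?thesis
    proof cases
      case 1
      then show ?thesis using adj1 adj2 by (simp add: serre_sum_adjacent_both)
    next
      case 2
      have "?a + ?b \<noteq> - h1" by (rule cm) (use 2 in linarith)
      moreover have "?a = h2" by (rule adj1) (rule 2)
      ultimately show ?thesis using serre_sum_adjacent_left[of ?b] nz nm[OF 2(2) jk R] by simp
    next
      case 3
      have "?a + ?b \<noteq> - h1" by (rule cm) (use 3 in linarith)
      moreover have "?b = h2" by (rule adj2) (rule 3)
      ultimately show ?thesis using serre_sum_adjacent_right[of ?a] nz nm[OF 3(1) ij j] by simp
    next
      case 4
      have "?a + ?b \<noteq> - h1" by (rule cm) (use 4 in linarith)
      then show ?thesis using serre_sum_generic[of ?a ?b] nz nm[OF 4(1) ij j] nm[OF 4(2) jk R]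
          by simp
    qed
  qed
  have "of_int s * serre_path m i j k = X * (A (?a - h1) * A (?b - h1) * A (?a + ?b - h1)) *
      (?b - ?a)"
    "of_int s * serre_path m i k j = X * (A (?a - h1) * A ?b * A (?a + ?b - h1)) *
        (- ?b - (?a + ?b))"
    "of_int s * serre_path m k i j = X * (A (?a - h1) * A ?b * A (?a + ?b)) * (?a + ?b + ?a)"
    "of_int s * serre_path m j i k = X * (A ?a * A (?b - h1) * A (?a + ?b - h1)) * (?a + (?a + ?b))"
    "of_int s * serre_path m j k i = X * (A ?a * A (?b - h1) * A (?a + ?b)) * (- (?a + ?b) - ?b)"
    "of_int s * serre_path m k j i = X * (A ?a * A ?b * A (?a + ?b)) * (?b - ?a)"
    unfolding serre_path_def C mult.left_commute[of "of_int s"] P by (rule refl)+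
  then have "of_int s * (serre_path m i j k + serre_path m i k j + serre_path m k i j
      + serre_path m j i k + serre_path m j k i + serre_path m k j i) =
     X * serre_sum ?a ?b"
    unfolding serre_sum_def Let_def distrib_left[of "of_int s"] by (simp only:)
        (simp add: algebra_simps)
  then show ?thesis using serre s_sq by auto
qed

text \<open>Here row \<open>i\<close> moves twice and influences row \<open>k\<close>.\<close>

lemma serre_path_double_below:
  assumes y: "young_seq m" "young_seq (step (step (step m i) i) k)" and ik: "i \<in> below k"
      and R: "k \<in> {1..N}"
  shows "serre_path m i i k + serre_path m i k i + serre_path m k i i = 0"
proof -
  have ne: "i \<noteq> k" "k \<noteq> i" using below_irrefl ik by auto
  note b = below_asym[OF ik]
  note simps = coef_split1[OF ik] coef_without_step gap_step ne b
  define X where "X = coef m i * coef (step m i) i * coef_without {i} m k"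
  let ?w = "gap m i k"
  have eq: "coef (step (step m k) i) i = coef (step m i) i"
    unfolding shift_commute[of m k] using ne b by (simp add: coef_without_step)
  have C: "coef m i * coef (step m i) i * coef (step (step m i) i) k = X * A (?w - 2 * h1)"
    "coef m i * coef (step m i) k * coef (step (step m i) k) i = X * A (?w - h1)"
    "coef m k * coef (step m k) i * coef (step (step m k) i) i = X * A ?w"
    unfolding X_def eq by (simp_all add: simps mult_ac)
  have s': "of_int s * (of_int s * x) = x" for x :: complex using s_sq by (metis mult.assoc mult_1)
  have P: "of_int s * (pos m i - 2 * pos (step m i) i + pos (step (step m i) i) k) = ?w - 2 * h1"
    "of_int s * (pos m i - 2 * pos (step m i) k + pos (step (step m i) k) i) = h1 - 2 * ?w"
    "of_int s * (pos m k - 2 * pos (step m k) i + pos (step (step m k) i) i) = ?w + h1"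
    using ne by (simp_all add: pos_shift gap_def algebra_simps s' s_sq)
  have "?w \<noteq> - h1 \<or> ?w = h2"
    by (rule gap_pair[OF y ik R]) (use ne below_irrefl in \<open>auto simp: shift_apply\<close>)
  then have serre: "(?w - 2 * h1) * A (?w - 2 * h1) + (h1 - 2 * ?w) * A (?w - h1) + (?w + h1) * A ?w
      = 0"
    by (intro serre_double_below gap_generic[OF y(1) ik R])
  have "of_int s * serre_path m i i k = X * A (?w - 2 * h1) * (?w - 2 * h1)"
    "of_int s * serre_path m i k i = X * A (?w - h1) * (h1 - 2 * ?w)"
    "of_int s * serre_path m k i i = X * A ?w * (?w + h1)"
    unfolding serre_path_def C mult.left_commute[of "of_int s"] P by (rule refl)+
  then have "of_int s * (serre_path m i i k + serre_path m i k i + serre_path m k i i) =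
     X * ((?w - 2 * h1) * A (?w - 2 * h1) + (h1 - 2 * ?w) * A (?w - h1) + (?w + h1) * A ?w)"
    unfolding distrib_left[of "of_int s"] by (simp only:) (simp add: algebra_simps)
  then show ?thesis using serre s_sq by auto
qed

text \<open>Here row \<open>i\<close> moves twice and is influenced by row \<open>k\<close>. For the result to be a diagram row
  \<open>k\<close> must be ahead of row \<open>i\<close> by at least one box, and by exactly one only if the rows are
  adjacent.\<close>

lemma serre_path_double_above:
  assumes y: "young_seq m" "young_seq (step (step (step m i) i) k)" and ki: "k \<in> below i"
      and R: "i \<in> {1..N}"
  shows "serre_path m i i k + serre_path m i k i + serre_path m k i i = 0"
proof -
  have ne: "i \<noteq> k" "k \<noteq> i" using below_irrefl ki by auto
  note b = below_asym[OF ki]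
  note simps = coef_split1[OF ki] coef_without_step gap_step ne b
  let ?w = "gap m k i"
  define X where "X = coef m k * coef_without {k} m i * coef_without {k} (step m i) i * A ?w"
  have eq: "coef_without {k} (step (step m k) i) i = coef_without {k} (step m i) i"
    unfolding shift_commute[of m k] using ne b by (simp add: coef_without_step)
  have C: "coef m i * coef (step m i) i * coef (step (step m i) i) k = X * A (?w + h1)"
    "coef m i * coef (step m i) k * coef (step (step m i) k) i = X * A ?w"
    "coef m k * coef (step m k) i * coef (step (step m k) i) i = X * A (?w - h1)"
    unfolding X_def by (simp_all add: simps eq mult_ac)
  have s': "of_int s * (of_int s * x) = x" for x :: complex using s_sq by (metis mult.assoc mult_1)
  have P: "of_int s * (pos m i - 2 * pos (step m i) i + pos (step (step m i) i) k)
      = - (?w + 2 * h1)"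
    "of_int s * (pos m i - 2 * pos (step m i) k + pos (step (step m i) k) i) = 2 * ?w + h1"
    "of_int s * (pos m k - 2 * pos (step m k) i + pos (step (step m k) i) i) = h1 - ?w"
    using ne by (simp_all add: pos_shift gap_def algebra_simps s' s_sq)
  let ?m' = "step (step (step m i) i) k"
  have "s * (?m' k - ?m' i) \<ge> 0" using gap_sign(1)[OF y(2) ki R] .
  then have d: "s * (m k - m i) \<ge> 1" using ne s_sign by (auto simp: shift_apply)
  then have w1: "?w \<noteq> - h1" using gap_not_negative[OF y(1) ki R d] by simp
  have w2: "?w \<noteq> - 2 * h1 \<or> ?w + h1 = h2"
  proof (cases "s * (m k - m i) \<ge> 2")
    case True
    then show ?thesis using gap_not_negative[OF y(1) ki R True] by simp
  next
    case False
    then have d1: "s * (m k - m i) = 1" using d by simp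
    have "s * (?m' i - m i) = 2" using ne s_sign by (auto simp: shift_apply)
    then have "s * (?m' i - m i) > s * (m k - m i)" using d1 by simp
    moreover have "?m' r = m r" if "k \<in> below r" "r \<in> below i" for r
      using that below_irrefl by (auto simp: shift_apply)
    ultimately have "s * (int i - int k) = 1"
      using no_row_between[OF y ki R] by (blast intro: between_unique_adjacent[OF ki R])
    then have "?w = - h1 + h2" unfolding gap_eq d1 by simp
    then show ?thesis by simp
  qed
  have serre: "(h1 - ?w) * A (?w - h1) + (2 * ?w + h1) * A ?w - (?w + 2 * h1) * A (?w + h1) = 0"
    by (intro serre_double_above gap_generic[OF y(1) ki R] w1 w2)
  have "of_int s * serre_path m i i k = X * A (?w + h1) * - (?w + 2 * h1)"
    "of_int s * serre_path m i k i = X * A ?w * (2 * ?w + h1)"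
    "of_int s * serre_path m k i i = X * A (?w - h1) * (h1 - ?w)"
    unfolding serre_path_def C mult.left_commute[of "of_int s"] P by (rule refl)+
  then have "of_int s * (serre_path m i i k + serre_path m i k i + serre_path m k i i) =
     X * ((h1 - ?w) * A (?w - h1) + (2 * ?w + h1) * A ?w - (?w + 2 * h1) * A (?w + h1))"
    unfolding distrib_left[of "of_int s"] by (simp only:) (simp add: algebra_simps)
  then show ?thesis using serre s_sq by auto
qed

lemma serre_path_sum:
  assumes y: "young_seq m" "young_seq (step (step (step m i) j) k)" and R: "i \<in> {1..N}" "j \<in> {1..N}"
      "k \<in> {1..N}"
  shows "serre_path m i j k + serre_path m i k j + serre_path m j i k + serre_path m j k i
      + serre_path m k i j + serre_path m k j i = 0"
proof -
  have perm: "step (step (step m i) j) k = step (step (step m i) k) j"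
      "step (step (step m i) j) k = step (step (step m j) i) k"
     for i j k using shift_commute by metis+
  have dbl: "serre_path m r p p = - serre_path m p p r - serre_path m p r p"
    if pr: "young_seq (step (step (step m p) p) r)" "p \<in> {1..N}" "r \<in> {1..N}" for p r
  proof -
    consider "p = r" | "p \<in> below r" | "r \<in> below p" using below_total[OF pr(2,3)] by blast
    then show ?thesis
    proof cases
      case 1 then show ?thesis by (simp add: serre_path_def pos_shift)
    next
      case 2 then show ?thesis using serre_path_double_below[OF y(1) pr(1)] pr
          by (simp add: eq_neg_iff_add_eq_0 algebra_simps)
    next
      case 3 then show ?thesis using serre_path_double_above[OF y(1) pr(1)] pr
          by (simp add: eq_neg_iff_add_eq_0 algebra_simps)
    qed
  qed
  note p = perm(1) perm(2)
  show ?thesis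
  proof (cases "i = j \<or> j = k \<or> i = k")
    case True
    then consider "i = j" | "j = k" | "i = k" by blast
    then show ?thesis
    proof cases
      case 1
      then have "serre_path m k i i = - serre_path m i i k - serre_path m i k i" using y R
          by (intro dbl) simp_all
      then show ?thesis unfolding 1[symmetric] by simp
    next
      case 2
      then have "young_seq (step (step (step m j) j) i)" using y(2) perm by metis
      then have "serre_path m i j j = - serre_path m j j i - serre_path m j i j" using R
          by (intro dbl)
      then show ?thesis unfolding 2[symmetric] by simp
    next
      case 3
      then have "young_seq (step (step (step m i) i) j)" using y(2) perm by metis
      then have "serre_path m j i i = - serre_path m i i j - serre_path m i j i" using R
          by (intro dbl)
      then show ?thesis unfolding 3[symmetric] by simp
    qed
  next
    case False
    note sorted = serre_path_distinct[OF y(1)]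
    consider "i \<in> below j" "j \<in> below k" | "i \<in> below k" "k \<in> below j" | "j \<in> below i" "i \<in> below k"
      | "j \<in> below k" "k \<in> below i" | "k \<in> below i" "i \<in> below j" | "k \<in> below j" "j \<in> below i"
      using below_total R False by metis
    then show ?thesis
    proof cases
      case 1
      then show ?thesis using sorted[of i j k] y R by (simp add: algebra_simps)
    next
      case 2
      moreover have "young_seq (step (step (step m i) k) j)" using y(2) perm by metis
      ultimately show ?thesis using sorted[of i k j] R by (simp add: algebra_simps)
    next
      case 3
      moreover have "young_seq (step (step (step m j) i) k)" using y(2) perm by metis
      ultimately show ?thesis using sorted[of j i k] R by (simp add: algebra_simps)
    next
      case 4
      moreover have "young_seq (step (step (step m j) k) i)" using y(2) perm by metis
      ultimately show ?thesis using sorted[of j k i] R by (simp add: algebra_simps)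
    next
      case 5
      moreover have "young_seq (step (step (step m k) i) j)" using y(2) perm by metis
      ultimately show ?thesis using sorted[of k i j] R by (simp add: algebra_simps)
    next
      case 6
      moreover have "young_seq (step (step (step m k) j) i)" using y(2) perm by metis
      ultimately show ?thesis using sorted[of k j i] R by (simp add: algebra_simps)
    qed
  qed
qed

end

section \<open>Partial fractions of the eigenvalue of \<open>\<psi>(z)\<close>\<close>

text \<open>Induction on the number of poles: multiplying by one more factor turns each residue \<open>r\<close> at
  \<open>d k\<close> into \<open>r (d k - n x) / (d k - d x)\<close>, and the residue at the new pole is \<open>d x - n x\<close> times
  the old product evaluated there.\<close>

lemma partial_fractions:
  fixes z :: "'a::field" and d n :: "'i \<Rightarrow> 'a"
  assumes "finite S" "inj_on d S" "z \<notin> d ` S"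
  shows "(\<Prod>k\<in>S. (z - n k) / (z - d k)) =
    1 + (\<Sum>k\<in>S. (d k - n k) * (\<Prod>l\<in>S - {k}. (d k - n l) / (d k - d l)) / (z - d k))"
  using assms
proof (induction S arbitrary: z rule: finite_induct)
  case (insert x S)
  define r where "r = (\<lambda>S k. (d k - n k) * (\<Prod>l\<in>S - {k}. (d k - n l) / (d k - d l)))"
  have IH: "(\<Prod>k\<in>S. (z - n k) / (z - d k)) = 1 + (\<Sum>k\<in>S. r S k / (z - d k))" if "z \<notin> d ` S" for z
    using insert.IH[of z] insert.prems(1) that by (simp add: r_def)
  have dx: "d x \<notin> d ` S" using insert.prems(1) insert.hyps by auto
  have zx: "z - d x \<noteq> 0" and zS: "z \<notin> d ` S" using insert.prems(2) by auto
  have rx: "r (insert x S) x = (d x - n x) * (1 + (\<Sum>k\<in>S. r S k / (d x - d k)))"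
    using IH[OF dx] insert.hyps by (simp add: r_def)
  have rk: "r (insert x S) k = r S k * ((d k - n x) / (d k - d x))" if "k \<in> S" for k
  proof -
    have "insert x S - {k} = insert x (S - {k})" using that insert.hyps by auto
    then show ?thesis using insert.hyps by (simp add: r_def mult_ac)
  qed
  have pf: "r S k / (z - d k) * ((z - n x) / (z - d x)) =
     r S k * ((d k - n x) / (d k - d x)) / (z - d k)
         + (d x - n x) * (r S k / (d x - d k)) / (z - d x)"
    if "k \<in> S" for k
  proof -
    have "d k \<noteq> d x" "d k \<noteq> z" using dx zS that by (metis imageI)+
    then have "d k - d x \<noteq> 0" "z - d k \<noteq> 0" by auto
    moreover have "r * (D * (z - n)) = r * (d - n) * (z - e) - (e - n) * r * (z - d)"
      if "D = d - e" for r D z n d e :: 'a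
      unfolding that by (simp add: algebra_simps)
    ultimately have "r S k / (z - d k) * ((z - n x) / (z - d x)) =
      (r S k * (d k - n x) * (z - d x) - (d x - n x) * r S k * (z - d k)) /
          ((d k - d x) * ((z - d k) * (z - d x)))"
      using zx by (simp add: divide_simps)
    also have "\<dots> = r S k * (d k - n x) / ((d k - d x) * (z - d k))
        - (d x - n x) * r S k / ((d k - d x) * (z - d x))"
      using zx \<open>d k - d x \<noteq> 0\<close> \<open>z - d k \<noteq> 0\<close> by (simp add: diff_divide_distrib mult_ac)
    also have "\<dots> = r S k * ((d k - n x) / (d k - d x)) / (z - d k)
        + (d x - n x) * (r S k / (d x - d k)) / (z - d x)"
    proof -
      have "d x - d k = - (d k - d x)" by simp
      then show ?thesis by (simp only: divide_minus_right mult_minus_right mult_minus_left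
          minus_divide_left[symmetric])
         (simp add: mult_ac)
    qed
    finally show ?thesis .
  qed
  have "(\<Prod>k\<in>insert x S. (z - n k) / (z - d k))
      = (1 + (\<Sum>k\<in>S. r S k / (z - d k))) * ((z - n x) / (z - d x))"
    using insert.hyps IH[OF zS] by (simp add: mult_ac)
  also have "\<dots> = (z - n x) / (z - d x) + (\<Sum>k\<in>S. r S k / (z - d k) * ((z - n x) / (z - d x)))"
    unfolding distrib_right sum_distrib_right by simp
  also have "(\<Sum>k\<in>S. r S k / (z - d k) * ((z - n x) / (z - d x))) =
     (\<Sum>k\<in>S. r (insert x S) k / (z - d k)) + (d x - n x) * (\<Sum>k\<in>S. r S k / (d x - d k)) / (z - d x)"
  proof -
    have "(\<Sum>k\<in>S. r S k / (z - d k) * ((z - n x) / (z - d x))) =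
      (\<Sum>k\<in>S. r (insert x S) k / (z - d k) + (d x - n x) * (r S k / (d x - d k)) / (z - d x))"
      by (intro sum.cong refl) (simp only: pf rk)
    then show ?thesis unfolding sum.distrib sum_distrib_left sum_divide_distrib .
  qed
  also have "(z - n x) / (z - d x) = 1 + (d x - n x) / (z - d x)"
    using zx by (simp add: field_simps)
  also have "1 + (d x - n x) / (z - d x) + ((\<Sum>k\<in>S. r (insert x S) k / (z - d k)) +
       (d x - n x) * (\<Sum>k\<in>S. r S k / (d x - d k)) / (z - d x)) =
     1 + (\<Sum>k\<in>insert x S. r (insert x S) k / (z - d k))"
    using insert.hyps unfolding sum.insert[OF insert.hyps] rx
        by (simp add: distrib_left add_divide_distrib)
  finally show ?case unfolding r_def .
qed simp

context yangian_parameters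
begin

text \<open>\<open>A\<close> is split into the factor with the pole at \<open>0\<close>, where a box can be added, and the factor
  with the pole at \<open>- h1\<close>, where a box can be removed.\<close>

definition alpha where "alpha w = (w - h3) / w"

definition beta where "beta w = (w - h2) / (w + h1)"

lemma A_eq_alpha_beta: "A w = alpha w * beta w" by (simp add: A_def alpha_def beta_def mult_ac)

lemma A_reflect: "A (- h1 - w) = A w"
proof -
  have e: "- h1 - w - h2 = - (w - h3)" "- h1 - w - h3 = - (w - h2)" "- h1 - w + h1 = - w"
      "- h1 - w = - (w + h1)"
    unfolding h3_eq by (simp_all add: algebra_simps)
  show ?thesis unfolding A_def e(1-3) unfolding e(4) by (simp only: minus_mult_minus mult.commute)
qed

lemma alpha_beta_adjacent:
  assumes "w \<noteq> h2" "w \<noteq> - h1" shows "alpha (w - h2) * beta w = 1"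
proof -
  have "w - h2 \<noteq> 0" "w + h1 \<noteq> 0" using assms by (auto simp: add_eq_0_iff2)
  then show ?thesis unfolding alpha_def beta_def unfolding h3_eq by simp
qed

text \<open>The product over all rows reduces to one over corners: for a row \<open>j\<close> of the same length as
  the next one, the factor \<open>beta\<close> of row \<open>j\<close> cancels the factor \<open>alpha\<close> of row \<open>j + 1\<close>. The sets
  \<open>X\<close> and \<open>Y\<close> allow singling out the corner at which a residue is taken.\<close>

lemma telescope_prod:
  fixes P :: "nat \<Rightarrow> 'a" and z :: 'a
  assumes corners: "As \<subseteq> {1..N + 1}" "Rs \<subseteq> {1..N}" "1 \<in> As"
    and flat: "\<And>j. j \<in> {1..N} \<Longrightarrow> j \<notin> Rs \<longleftrightarrow> Suc j \<notin> As"
      "\<And>j. j \<in> {1..N} - Rs \<Longrightarrow> P (Suc j) = P j + h2"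
    and z: "\<And>j. j \<in> {1..N} - Rs \<Longrightarrow> z \<noteq> P (Suc j) \<and> z \<noteq> P j - h1"
    and sub: "X \<subseteq> As" "Y \<subseteq> Rs"
  shows "(\<Prod>j\<in>{1..N + 1} - X. alpha (z - P j)) * (\<Prod>j\<in>{1..N} - Y. beta (z - P j)) =
    (\<Prod>j\<in>As - X. alpha (z - P j)) * (\<Prod>j\<in>Rs - Y. beta (z - P j))"
proof -
  have split: "prod f (T - U) = prod f (T - V) * prod f (V - U)" if "finite T" "V \<subseteq> T" "U \<subseteq> V"
    for f :: "nat \<Rightarrow> 'a" and T U V
  proof -
    have "T - U - (V - U) = T - V" using that by blast
    then show ?thesis using prod.subset_diff[of "V - U" "T - U" f] that by auto
  qed
  have 1: "(\<Prod>j\<in>{1..N + 1} - X. alpha (z - P j))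
      = (\<Prod>j\<in>{1..N + 1} - As. alpha (z - P j)) * (\<Prod>j\<in>As - X. alpha (z - P j))"
    by (rule split) (use corners sub in auto)
  have 2: "(\<Prod>j\<in>{1..N} - Y. beta (z - P j))
      = (\<Prod>j\<in>{1..N} - Rs. beta (z - P j)) * (\<Prod>j\<in>Rs - Y. beta (z - P j))"
    by (rule split) (use corners sub in auto)
  have img: "Suc ` ({1..N} - Rs) = {1..N + 1} - As"
  proof
    show "{1..N + 1} - As \<subseteq> Suc ` ({1..N} - Rs)"
    proof
      fix x assume x: "x \<in> {1..N + 1} - As"
      then have "x \<noteq> 1" using corners(3) by auto
      then obtain y where "x = Suc y" "y \<in> {1..N}" using x by (cases x) auto
      then have "y \<in> {1..N} - Rs" "x = Suc y" using x flat(1)[of y] by auto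
      then show "x \<in> Suc ` ({1..N} - Rs)" by blast
    qed
  qed (use flat(1) in auto)
  have "(\<Prod>j\<in>{1..N + 1} - As. alpha (z - P j)) * (\<Prod>j\<in>{1..N} - Rs. beta (z - P j)) =
    (\<Prod>j\<in>{1..N} - Rs. alpha (z - P (Suc j)) * beta (z - P j))"
    unfolding img[symmetric] by (simp add: prod.reindex prod.distrib)
  also have "\<dots> = 1"
  proof (rule prod.neutral, rule ballI)
    fix j assume j: "j \<in> {1..N} - Rs"
    have "z - P j - h2 \<noteq> 0" "z - P j + h1 \<noteq> 0" using z[OF j] flat(2)[OF j]
        by (auto simp: algebra_simps)
    then have "z - P j \<noteq> h2" "z - P j \<noteq> - h1" by (auto simp: add_eq_0_iff2)
    then show "alpha (z - P (Suc j)) * beta (z - P j) = 1"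
      unfolding flat(2)[OF j] using alpha_beta_adjacent[of "z - P j"] by (simp add: algebra_simps)
  qed
  finally have one: "(\<Prod>j\<in>{1..N + 1} - As. alpha (z - P j)) * (\<Prod>j\<in>{1..N} - Rs. beta (z - P j)) = 1" .
  have "p * x * (r * y) = (p * r) * (x * y)" for p x r y :: 'a by (simp add: mult_ac)
  then show ?thesis unfolding 1 2 using one by simp
qed

end

notation fls_nth (infixl "$$" 75)

lemma fls_const_prod: "fls_const (\<Prod>i\<in>S. f i) = (\<Prod>i\<in>S. fls_const (f i :: complex))"
  by (induction S rule: infinite_finite_induct) (simp_all flip: fls_const_mult_const)

lemma zvar_nth: "(zvar * f) $$ n = f $$ (n + 1)"
  by (simp add: zvar_def fls_X_inv_times_conv_shift)

lemma zvar_minus_const_nz: "zvar - fls_const x \<noteq> 0"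
proof
  assume "zvar - fls_const x = 0"
  then have "(zvar - fls_const x) $$ (- 1) = 0" by simp
  then show False by (simp add: zvar_def)
qed

lemma zvar_nz: "zvar \<noteq> 0" using zvar_minus_const_nz[of 0] by simp

lemma delta_plus_eq: "delta_plus x = fps_to_fls (Abs_fps (\<lambda>n. x ^ n))"
proof -
  have "fps_compose (Abs_fps (\<lambda>_. 1 :: complex)) (fps_const x * fps_X) = Abs_fps (\<lambda>n. x ^ n)"
    by (rule fps_ext) (simp add: fps_compose_linear)
  then show ?thesis by (simp add: delta_plus_def)
qed

lemma inverse_zvar_nth: "(f / zvar) $$ n = f $$ (n - 1)"
proof -
  have "zvar * (f / zvar) = f" using zvar_nz by simp
  then have "f $$ (n - 1) = (zvar * (f / zvar)) $$ (n - 1)" by simp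
  then show ?thesis by (simp only: zvar_nth) simp
qed

lemma geometric_fls: "fls_const r / (zvar - fls_const x) = fls_const r * delta_plus x / zvar"
proof -
  have "(zvar - fls_const x) * (delta_plus x / zvar) = 1"
  proof (rule fls_eqI)
    fix n :: int
    have "((zvar - fls_const x) * (delta_plus x / zvar)) $$ n = delta_plus x $$ n
        - x * delta_plus x $$ (n - 1)"
      by (simp add: left_diff_distrib zvar_nth inverse_zvar_nth)
    also have "\<dots> = (1 :: complex fls) $$ n"
    proof (cases "n \<le> 0")
      case False
      then have "nat n = Suc (nat (n - 1))" by simp
      then show ?thesis using False by (simp add: delta_plus_eq)
    qed (auto simp: delta_plus_eq)
    finally show "((zvar - fls_const x) * (delta_plus x / zvar)) $$ n = (1 :: complex fls) $$ n" .
  qed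
  then have "delta_plus x / zvar = 1 / (zvar - fls_const x)"
    using zvar_minus_const_nz[of x] by (simp add: field_simps)
  then show ?thesis by (metis times_divide_eq_right mult.right_neutral)
qed

lemma geometric_fls_nth:
  "(fls_const r / (zvar - fls_const x)) $$ n = (if n \<ge> 1 then r * x ^ nat (n - 1) else 0)"
  unfolding geometric_fls inverse_zvar_nth by (auto simp: delta_plus_eq)

context fock_parameters
begin

sublocale L: yangian_parameters "fls_const h1" "fls_const h2" "fls_const h3"
  by unfold_locales (simp add: fls_plus_const sum0)

lemma h2_nz: "h2 \<noteq> 0" using nonresonant[of 1 0] by simp

definition addable_rows :: "(nat \<Rightarrow> int) \<Rightarrow> nat set"
    where "addable_rows m = {i. i \<ge> 1 \<and> young_seq (shift m i 1)}"

definition removable_rows :: "(nat \<Rightarrow> int) \<Rightarrow> nat set"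
    where "removable_rows m = {i. i \<ge> 1 \<and> young_seq (shift m i (- 1))}"

lemma addable_rows_subset: assumes "vanishes_from N m" shows "addable_rows m \<subseteq> {1..N}"
proof
  fix i assume "i \<in> addable_rows m"
  then have i: "i \<ge> 1" "i = 1 \<or> m i < m (i - 1)"
    using assms young_seq_add_iff by (auto simp: addable_rows_def vanishes_from_def)
  moreover have "N \<ge> 1" "young_seq m" using assms by (auto simp: vanishes_from_def)
  moreover have "m (i - 1) = 0" if "i > N" using vanishes_fromD[OF assms, of "i - 1"] that by simp
  ultimately show "i \<in> {1..N}" using young_seq_nonneg[of m i] by force
qed

lemma removable_rows_subset: assumes "vanishes_from N m" shows "removable_rows m \<subseteq> {1..N}"
proof
  fix i assume "i \<in> removable_rows m"
  then have i: "i \<ge> 1" "m (i + 1) < m i" "young_seq m"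
    using assms young_seq_remove_iff by (auto simp: removable_rows_def vanishes_from_def)
  moreover have "m i = 0" if "i \<ge> N" using vanishes_fromD[OF assms that] .
  ultimately show "i \<in> {1..N}" using young_seq_nonneg[of m "i + 1"] by force
qed

lemma finite_addable_rows [simp]: "young_seq m \<Longrightarrow> finite (addable_rows m)"
    and finite_removable_rows [simp]: "young_seq m \<Longrightarrow> finite (removable_rows m)"
  using vanishes_from_ex addable_rows_subset removable_rows_subset finite_subset
      finite_atLeastAtMost by metis+

lemma first_row_addable: "young_seq m \<Longrightarrow> 1 \<in> addable_rows m"
    by (simp add: addable_rows_def young_seq_add_iff)

lemma not_removable_iff:
  assumes "young_seq m" "j \<ge> 1" shows "j \<notin> removable_rows m \<longleftrightarrow> Suc j \<notin> addable_rows m"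
  using assms young_seq_remove_iff[OF assms(1), of j] young_seq_add_iff[OF assms(1), of "Suc j"]
  by (simp add: removable_rows_def addable_rows_def)

lemma pos_Suc_flat:
  assumes "young_seq m" "j \<ge> 1" "j \<notin> removable_rows m" shows "pos m (Suc j) = pos m j + h2"
proof -
  have "m (Suc j) = m j" using assms young_seq_remove_iff[OF assms(1), of j]
      young_seq_antimono[OF assms(1), of j "Suc j"]
    by (simp add: removable_rows_def)
  then show ?thesis by (simp add: pos_def algebra_simps)
qed

text \<open>Together with \<open>pos_separated\<close> this makes the poles of \<open>\<psi>(z)\<close> simple.\<close>

lemma pos_distinct:
  assumes "young_seq m" "1 \<le> i" "1 \<le> k" "i \<noteq> k" shows "pos m i \<noteq> pos m k"
proof -
  have "pos m i \<noteq> pos m k" if "1 \<le> i" "i < k" for i k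
  proof
    assume "pos m i = pos m k"
    then have "of_int (m k - m i) * h1 + of_int (int k - int i) * h2 = 0" using pos_diff[of m k i]
        by simp
    then show False using nonresonant_int[of "m k - m i" "int k - int i"] that
        young_seq_antimono[OF assms(1), of i k] by simp
  qed
  from this[of i k] this[of k i] show ?thesis using assms(2-4) by (metis linorder_neqE_nat)
qed

lemma pos_separated:
  assumes "young_seq m" "1 \<le> i" "1 \<le> k" "i \<in> addable_rows m \<or> k \<in> removable_rows m" shows
      "pos m i \<noteq> pos m k - h1"
proof
  assume eq: "pos m i = pos m k - h1"
  have lt: "m i < m k" if "k < i"
  proof -
    have "m i \<le> m (i - 1)" "m (i - 1) \<le> m k" "m i \<le> m (k + 1)" "m (k + 1) \<le> m k"
      using young_seq_antimono[OF assms(1), of "i - 1" i]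
          young_seq_antimono[OF assms(1), of k "i - 1"]
        young_seq_antimono[OF assms(1), of "k + 1" i] young_seq_antimono[OF assms(1), of k "k + 1"]
            that assms(3) by auto
    then show ?thesis using assms(4) that young_seq_add_iff[OF assms(1,2)]
        young_seq_remove_iff[OF assms(1,3)] assms(3)
      by (auto simp: addable_rows_def removable_rows_def)
  qed
  consider "i < k" | "i = k" | "k < i" by linarith
  then show False
  proof cases
    case 1
    have "of_int (m k - m i - 1) * h1 + of_int (int k - int i) * h2 = 0"
    proof -
      have "of_int (m k - m i) * h1 + of_int (int k - int i) * h2 = h1"
          unfolding pos_diff[symmetric] using eq by simp
      moreover have "of_int (m k - m i - 1) * h1 + x = of_int (m k - m i) * h1 + x - h1" for x
        by (simp add: algebra_simps)
      ultimately show ?thesis by (simp only:) simp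
    qed
    then show False using nonresonant_int[of "m k - m i - 1" "int k - int i"] 1
        young_seq_antimono[OF assms(1), of i k] assms(2) by simp
  next
    case 2
    then show False using eq h1_nz by simp
  next
    case 3
    have "of_int (m i - m k + 1) * h1 + of_int (int i - int k) * h2 = 0"
    proof -
      have "of_int (m i - m k) * h1 + of_int (int i - int k) * h2 = - h1"
          unfolding pos_diff[symmetric] using eq by simp
      moreover have "of_int (m i - m k + 1) * h1 + x = of_int (m i - m k) * h1 + x + h1" for x
        by (simp add: algebra_simps)
      ultimately show ?thesis by (simp only:) simp
    qed
    then show False using nonresonant_int[of "m i - m k + 1" "int i - int k"] 3 lt by simp
  qed
qed

text \<open>Up to the factors \<open>- h3\<close> and \<open>h3\<close> these are the residues of \<open>psi_rational\<close> at the addable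
  and removable corners. Leaving these factors out keeps the eigenvalues meaningful when \<open>h3 = 0\<close>.\<close>

definition add_residue :: "(nat \<Rightarrow> int) \<Rightarrow> nat \<Rightarrow> complex" where
  "add_residue m i = (\<Prod>k\<in>addable_rows m - {i}. alpha (pos m i - pos m k)) *
      (\<Prod>k\<in>removable_rows m. beta (pos m i - pos m k))"

definition remove_residue :: "(nat \<Rightarrow> int) \<Rightarrow> nat \<Rightarrow> complex" where
  "remove_residue m i = (\<Prod>k\<in>addable_rows m. alpha (pos m i - h1 - pos m k)) *
      (\<Prod>k\<in>removable_rows m - {i}. beta (pos m i - h1 - pos m k))"

definition psi_eigenvalue :: "(nat \<Rightarrow> int) \<Rightarrow> nat \<Rightarrow> complex" where
  "psi_eigenvalue m n = ((\<Sum>i\<in>removable_rows m. remove_residue m i * (pos m i - h1) ^ n)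
      - (\<Sum>i\<in>addable_rows m. add_residue m i * pos m i ^ n)) / (h1 * h2)"

text \<open>The generating series of the eigenvalues of \<open>\<psi>\<^sub>n\<close> (see \<open>phi_nth\<close>).\<close>

definition phi :: "(nat \<Rightarrow> int) \<Rightarrow> complex fls" where
  "phi m = fls_const (1 / (h1 * h2)) *
     ((\<Sum>i\<in>removable_rows m. fls_const (remove_residue m i) / (zvar - fls_const (pos m i - h1)))
      - (\<Sum>i\<in>addable_rows m. fls_const (add_residue m i) / (zvar - fls_const (pos m i))))"

lemma fls_nth_sum: "(\<Sum>i\<in>S. f i) $$ n = (\<Sum>i\<in>S. f i $$ n)" for f :: "'i \<Rightarrow> complex fls"
  by (induction S rule: infinite_finite_induct) auto

lemma phi_nth: "phi m $$ n = (if n \<ge> 1 then psi_eigenvalue m (nat (n - 1)) else 0)"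
  unfolding phi_def by (simp add: fls_nth_sum geometric_fls_nth psi_eigenvalue_def)

definition psi_rational :: "(nat \<Rightarrow> int) \<Rightarrow> complex fls" where
  "psi_rational m = (\<Prod>i\<in>addable_rows m. L.alpha (zvar - fls_const (pos m i))) *
      (\<Prod>i\<in>removable_rows m. L.beta (zvar - fls_const (pos m i)))"

lemma psi_rational_rows:
  assumes "vanishes_from N m"
  shows "psi_rational m = (\<Prod>i\<in>{1..N + 1}. L.alpha (zvar - fls_const (pos m i))) *
      (\<Prod>i\<in>{1..N}. L.beta (zvar - fls_const (pos m i)))"
proof -
  have y: "young_seq m" using assms by (simp add: vanishes_from_def)
  have Z: "zvar \<noteq> fls_const x" for x using zvar_minus_const_nz[of x] by auto
  have "(\<Prod>j\<in>{1..N + 1} - {}. L.alpha (zvar - fls_const (pos m j))) *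
      (\<Prod>j\<in>{1..N} - {}. L.beta (zvar - fls_const (pos m j))) =
      (\<Prod>j\<in>addable_rows m - {}. L.alpha (zvar - fls_const (pos m j))) *
          (\<Prod>j\<in>removable_rows m - {}. L.beta (zvar - fls_const (pos m j)))"
    by (rule L.telescope_prod)
       (use addable_rows_subset[OF assms] removable_rows_subset[OF assms] first_row_addable[OF y]
           not_removable_iff[OF y] in
        \<open>auto simp: pos_Suc_flat[OF y] fls_plus_const fls_minus_const Z\<close>)
  then show ?thesis by (simp add: psi_rational_def)
qed

lemma sum_pairs_telescope:
  fixes f f' :: "nat \<Rightarrow> 'b::ab_group_add"
  assumes "vanishes_from N m" and "\<And>j. j \<ge> 1 \<Longrightarrow> j \<notin> removable_rows m \<Longrightarrow> f (Suc j) = f' j"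
  shows "(\<Sum>i\<in>addable_rows m. f i) - (\<Sum>i\<in>removable_rows m. f' i) = (\<Sum>i\<in>{1..N + 1}. f i)
      - (\<Sum>i\<in>{1..N}. f' i)"
proof -
  have y: "young_seq m" using assms by (simp add: vanishes_from_def)
  have img: "Suc ` ({1..N} - removable_rows m) = {1..N + 1} - addable_rows m"
  proof
    show "{1..N + 1} - addable_rows m \<subseteq> Suc ` ({1..N} - removable_rows m)"
    proof
      fix x assume x: "x \<in> {1..N + 1} - addable_rows m"
      then have "x \<noteq> 1" using first_row_addable[OF y] by auto
      then obtain j where "x = Suc j" "j \<in> {1..N}" using x by (cases x) auto
      then have "j \<in> {1..N} - removable_rows m" "x = Suc j" using x not_removable_iff[OF y, of j]
          by auto
      then show "x \<in> Suc ` ({1..N} - removable_rows m)" by blast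
    qed
  qed (use not_removable_iff[OF y] in auto)
  have "(\<Sum>i\<in>{1..N + 1} - addable_rows m. f i) = (\<Sum>i\<in>{1..N} - removable_rows m. f' i)"
    unfolding img[symmetric] by (simp add: sum.reindex assms(2))
  moreover have "(\<Sum>i\<in>{1..N + 1}. f i) = (\<Sum>i\<in>{1..N + 1} - addable_rows m. f i)
      + (\<Sum>i\<in>addable_rows m. f i)"
    using addable_rows_subset[OF assms(1)] by (intro sum.subset_diff) auto
  moreover have "(\<Sum>i\<in>{1..N}. f' i) = (\<Sum>i\<in>{1..N} - removable_rows m. f' i)
      + (\<Sum>i\<in>removable_rows m. f' i)"
    using removable_rows_subset[OF assms(1)] by (intro sum.subset_diff) auto
  ultimately show ?thesis by simp
qed

text \<open>Poles and zeros of \<open>psi_rational\<close>, indexed by the disjoint union of addable and removable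
  corners.\<close>

definition corner_pos :: "(nat \<Rightarrow> int) \<Rightarrow> nat + nat \<Rightarrow> complex" where
  "corner_pos m k = (case k of Inl i \<Rightarrow> pos m i | Inr i \<Rightarrow> pos m i - h1)"

definition corner_zero :: "(nat \<Rightarrow> int) \<Rightarrow> nat + nat \<Rightarrow> complex" where
  "corner_zero m k = (case k of Inl i \<Rightarrow> pos m i + h3 | Inr i \<Rightarrow> pos m i + h2)"

lemma corner_pos_inj: assumes "young_seq m" shows
    "inj_on (corner_pos m) (addable_rows m <+> removable_rows m)"
proof (rule inj_onI)
  fix x x' assume x: "x \<in> addable_rows m <+> removable_rows m"
      "x' \<in> addable_rows m <+> removable_rows m" "corner_pos m x = corner_pos m x'"
  have ge: "i \<in> addable_rows m \<Longrightarrow> 1 \<le> i" "i \<in> removable_rows m \<Longrightarrow> 1 \<le> i" for i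
      by (auto simp: addable_rows_def removable_rows_def)
  show "x = x'"
  proof (cases x; cases x')
    fix i k assume [simp]: "x = Inl i" "x' = Inl k"
    then show ?thesis using x ge pos_distinct[OF assms, of i k] by (auto simp: corner_pos_def)
  next
    fix i k assume [simp]: "x = Inl i" "x' = Inr k"
    then show ?thesis using x ge pos_separated[OF assms, of i k] by (auto simp: corner_pos_def)
  next
    fix i k assume [simp]: "x = Inr i" "x' = Inl k"
    then show ?thesis using x ge pos_separated[OF assms, of k i] by (auto simp: corner_pos_def)
  next
    fix i k assume [simp]: "x = Inr i" "x' = Inr k"
    then show ?thesis using x ge pos_distinct[OF assms, of i k] by (auto simp: corner_pos_def)
  qed
qed

lemma psi_rational_phi: assumes "young_seq m" shows
    "psi_rational m = 1 + fls_const (h1 * h2 * h3) * phi m"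
proof -
  let ?S = "addable_rows m <+> removable_rows m"
  let ?d = "\<lambda>k. fls_const (corner_pos m k)" and ?n = "\<lambda>k. fls_const (corner_zero m k)"
  have fin: "finite ?S" using assms by simp
  have res: "(\<Prod>l\<in>?S - {k}. (?d k - ?n l) / (?d k - ?d l)) =
     fls_const (\<Prod>l\<in>?S - {k}. (corner_pos m k - corner_zero m l) /
         (corner_pos m k - corner_pos m l))" for k
    unfolding fls_const_prod by (simp add: fls_minus_const fls_const_divide_const)
  have SL: "?S - {Inl i} = (addable_rows m - {i}) <+> removable_rows m" for i by auto
  have SR: "?S - {Inr i} = addable_rows m <+> (removable_rows m - {i})" for i by auto
  have rA: "(\<Prod>l\<in>?S - {Inl i}. (corner_pos m (Inl i) - corner_zero m l) /
      (corner_pos m (Inl i) - corner_pos m l)) = add_residue m i" for i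
    unfolding SL using assms by (simp add: prod.Plus add_residue_def corner_pos_def corner_zero_def
        alpha_def beta_def algebra_simps)
  have rR: "(\<Prod>l\<in>?S - {Inr i}. (corner_pos m (Inr i) - corner_zero m l) /
      (corner_pos m (Inr i) - corner_pos m l)) = remove_residue m i" for i
    unfolding SR using assms by (simp add: prod.Plus remove_residue_def corner_pos_def
        corner_zero_def alpha_def beta_def algebra_simps)
  have "psi_rational m = (\<Prod>k\<in>?S. (zvar - ?n k) / (zvar - ?d k))"
    using assms by (simp add: prod.Plus psi_rational_def L.alpha_def L.beta_def corner_pos_def
        corner_zero_def algebra_simps
       fls_plus_const[symmetric] fls_minus_const[symmetric])
  also have "\<dots> = 1 + (\<Sum>k\<in>?S. (?d k - ?n k) * (\<Prod>l\<in>?S - {k}. (?d k - ?n l) / (?d k - ?d l)) /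
      (zvar - ?d k))"
  proof (rule partial_fractions[OF fin])
    have "fls_const x = fls_const y \<Longrightarrow> x = y" for x y :: complex by (metis fls_const_nth)
    then show "inj_on ?d ?S" using corner_pos_inj[OF assms] by (auto simp: inj_on_def)
    have "zvar \<noteq> fls_const x" for x using zvar_minus_const_nz[of x] by auto
    then show "zvar \<notin> ?d ` ?S" by blast
  qed
  also have "\<dots> = 1 + ((\<Sum>i\<in>addable_rows m. fls_const (- h3 * add_residue m i) /
      (zvar - fls_const (pos m i)))
     + (\<Sum>i\<in>removable_rows m. fls_const (h3 * remove_residue m i) /
         (zvar - fls_const (pos m i - h1))))"
  proof -
    have "corner_pos m (Inl i) - corner_zero m (Inl i) = - h3"
        "corner_pos m (Inr i) - corner_zero m (Inr i) = h3" for i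
      unfolding corner_pos_def corner_zero_def by (simp_all add: h3_eq)
    then show ?thesis unfolding res
      using assms by (simp add: sum.Plus rA rR fls_minus_const) (simp add: corner_pos_def)
  qed
  also have "(\<Sum>i\<in>addable_rows m. fls_const (- h3 * add_residue m i) / (zvar - fls_const (pos m i)))
      =
     - fls_const h3 * (\<Sum>i\<in>addable_rows m. fls_const (add_residue m i) /
         (zvar - fls_const (pos m i)))"
    unfolding sum_distrib_left by (rule sum.cong) (simp_all flip: fls_const_mult_const)
  also have "(\<Sum>i\<in>removable_rows m. fls_const (h3 * remove_residue m i) /
      (zvar - fls_const (pos m i - h1))) =
     fls_const h3 * (\<Sum>i\<in>removable_rows m. fls_const (remove_residue m i) /
         (zvar - fls_const (pos m i - h1)))"
    unfolding sum_distrib_left by (rule sum.cong) (simp_all flip: fls_const_mult_const)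
  finally have P: "psi_rational m = 1 + (- fls_const h3 *
      (\<Sum>i\<in>addable_rows m. fls_const (add_residue m i) / (zvar - fls_const (pos m i)))
     + fls_const h3 * (\<Sum>i\<in>removable_rows m. fls_const (remove_residue m i) /
         (zvar - fls_const (pos m i - h1))))" .
  have "h1 * h2 * h3 * (1 / (h1 * h2)) = h3" using h1_nz h2_nz by simp
  then have "fls_const (h1 * h2 * h3) * phi m = fls_const h3 *
     ((\<Sum>i\<in>removable_rows m. fls_const (remove_residue m i) / (zvar - fls_const (pos m i - h1)))
      - (\<Sum>i\<in>addable_rows m. fls_const (add_residue m i) / (zvar - fls_const (pos m i))))"
    unfolding phi_def mult.assoc[symmetric] fls_const_mult_const by simp
  then show ?thesis unfolding P by (simp add: algebra_simps)
qed

text \<open>Only the factor \<open>A\<close> of row \<open>i\<close> changes, and it changes as in the exchange of two boxes.\<close>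

lemma psi_rational_step:
  assumes y: "young_seq m" "young_seq (shift m i 1)" and i: "i \<ge> 1"
  defines "W \<equiv> zvar - fls_const (pos m i)"
  shows "psi_rational (shift m i 1) * L.q W = - psi_rational m * L.q (- W)"
proof -
  obtain N0 where N0: "vanishes_from N0 m" using vanishes_from_ex[OF y(1)] by blast
  define N where "N = max (Suc N0) i"
  have N: "vanishes_from N m" "vanishes_from N (shift m i 1)"
    using vanishes_from_mono[OF N0] vanishes_from_mono[OF vanishes_from_shift[OF N0 y(2)]]
        by (auto simp: N_def)
  have iN: "i \<in> {1..N}" using i by (simp add: N_def)
  define f where "f = (\<lambda>m j. L.alpha (zvar - fls_const (pos m j)))"
  define g where "g = (\<lambda>m j. L.beta (zvar - fls_const (pos m j)))"
  define R where "R = (\<Prod>j\<in>{1..N + 1} - {i}. f m j) * (\<Prod>j\<in>{1..N} - {i}. g m j)"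
  have eq: "f (shift m i 1) j = f m j" "g (shift m i 1) j = g m j" if "j \<noteq> i" for j
    using that by (simp_all add: f_def g_def pos_shift)
  have split: "psi_rational m' = (f m' i * g m' i) *
      ((\<Prod>j\<in>{1..N + 1} - {i}. f m' j) * (\<Prod>j\<in>{1..N} - {i}. g m' j))"
    if "vanishes_from N m'" for m'
  proof -
    have i': "i \<in> {1..N + 1}" using iN by auto
    have "psi_rational m' = prod (f m') {1..N + 1} * prod (g m') {1..N}"
        unfolding psi_rational_rows[OF that] f_def g_def ..
    also have "\<dots> = (f m' i * prod (f m') ({1..N + 1} - {i})) *
        (g m' i * prod (g m') ({1..N} - {i}))"
      by (intro arg_cong2[of _ _ _ _ "(*)"] prod.remove i' iN) auto
    finally show ?thesis by (simp only: mult_ac)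
  qed
  have 1: "psi_rational m = L.A W * R"
    unfolding split[OF N(1)] R_def W_def L.A_eq_alpha_beta by (simp add: f_def g_def)
  have R': "(\<Prod>j\<in>{1..N + 1} - {i}. f (shift m i 1) j) * (\<Prod>j\<in>{1..N} - {i}. g (shift m i 1) j) = R"
    unfolding R_def by (intro arg_cong2[of _ _ _ _ "(*)"] prod.cong refl eq) auto
  have W': "zvar - fls_const (pos (shift m i 1) i) = W - fls_const h1"
    by (simp add: W_def pos_shift flip: fls_plus_const)
  have 2: "psi_rational (shift m i 1) = L.A (W - fls_const h1) * R"
    unfolding split[OF N(2)] R' L.A_eq_alpha_beta by (simp add: f_def g_def W')
  have nz: "W \<noteq> 0" "W \<noteq> fls_const h1" "W \<noteq> - fls_const h1"
    using zvar_minus_const_nz[of "pos m i"] zvar_minus_const_nz[of "pos m i + h1"]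
        zvar_minus_const_nz[of "pos m i - h1"]
    by (auto simp: W_def algebra_simps fls_minus_const[symmetric] fls_plus_const[symmetric])
  have "L.A (W - fls_const h1) * L.q W + L.A W * L.q (- W) = 0"
    using nz by (intro L.pair_exchange) auto
  then have "R * (L.A (W - fls_const h1) * L.q W + L.A W * L.q (- W)) = 0" by simp
  then show ?thesis unfolding 1 2 by (simp add: algebra_simps eq_neg_iff_add_eq_0)
qed

text \<open>For \<open>h3 \<noteq> 0\<close> this is \<open>psi_rational_step\<close> rewritten with \<open>psi_rational_phi\<close>. For \<open>h3 = 0\<close> all
  normalized residues are \<open>1\<close>, the sum over corners extends to a sum over all rows, and only the
  summands of row \<open>i\<close> change.\<close>

lemma phi_step:
  assumes y: "young_seq m" "young_seq (shift m i 1)" and i: "i \<ge> 1"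
  defines "W \<equiv> zvar - fls_const (pos m i)"
  shows "phi (shift m i 1) * L.q W = - phi m * L.q (- W) + 2"
proof (cases "h3 = 0")
  case False
  define s3 where "s3 = fls_const (h1 * h2 * h3)"
  have nz: "s3 \<noteq> 0" using False h1_nz h2_nz by (simp add: s3_def)
  have q: "L.q W + L.q (- W) = - (2 * s3)"
    unfolding L.q_eq s3_def by (simp add: power3_eq_cube)
  have "(1 + s3 * phi (shift m i 1)) * L.q W = - (1 + s3 * phi m) * L.q (- W)"
    using psi_rational_step[OF y i] unfolding psi_rational_phi[OF y(1)] psi_rational_phi[OF y(2)]
        s3_def[symmetric] W_def .
  then have "s3 * (phi (shift m i 1) * L.q W) = - (1 + s3 * phi m) * L.q (- W) - L.q W"
    by (simp add: distrib_right eq_diff_eq add.commute mult.assoc)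
  also have "\<dots> = s3 * (- phi m * L.q (- W)) - (L.q W + L.q (- W))"
    by (simp add: algebra_simps)
  also have "\<dots> = s3 * (- phi m * L.q (- W) + 2)"
    unfolding q by (simp add: algebra_simps)
  finally show ?thesis using nz by simp
next
  case True
  then have h2: "h2 = - h1" using h3_eq by simp
  have a1: "alpha w = 1" if "w \<noteq> 0" for w unfolding alpha_def using that True by simp
  have b1: "beta w = 1" if "w \<noteq> - h1" for w unfolding beta_def using that h2
      by (simp add: add_eq_0_iff2)
  define F where "F = (\<lambda>m k. 1 / (zvar - fls_const (pos m k)))"
  define G where "G = (\<lambda>m k. 1 / (zvar - fls_const (pos m k - h1)))"
  have phi: "phi m = fls_const (1 / h1 ^ 2) * ((\<Sum>k\<in>{1..N + 1}. F m k) - (\<Sum>k\<in>{1..N}. G m k))"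
    if N: "vanishes_from N m" for m N
  proof -
    have y: "young_seq m" using N by (simp add: vanishes_from_def)
    have ge: "i \<in> addable_rows m \<Longrightarrow> 1 \<le> i" "i \<in> removable_rows m \<Longrightarrow> 1 \<le> i" for i
        by (auto simp: addable_rows_def removable_rows_def)
    have add_residue: "add_residue m i = 1" if "i \<in> addable_rows m" for i
      unfolding add_residue_def using pos_distinct[OF y, of i] pos_separated[OF y, of i] that ge
      by (subst (1 2) prod.neutral) (auto intro!: a1 b1 simp: algebra_simps add_eq_0_iff)
    have remove_residue: "remove_residue m i = 1" if "i \<in> removable_rows m" for i
      unfolding remove_residue_def using pos_distinct[OF y, of i] pos_separated[OF y, of _ i] that
          ge
      by (subst (1 2) prod.neutral) (force intro!: a1 b1 simp: algebra_simps)+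
    have "(\<Sum>k\<in>addable_rows m. F m k) - (\<Sum>k\<in>removable_rows m. G m k) = (\<Sum>k\<in>{1..N + 1}. F m k)
        - (\<Sum>k\<in>{1..N}. G m k)"
    proof (rule sum_pairs_telescope[OF N])
      fix j :: nat assume "j \<ge> 1" "j \<notin> removable_rows m"
      then have "pos m (Suc j) = pos m j - h1" using pos_Suc_flat[OF y] h2 by simp
      then show "F m (Suc j) = G m j" by (simp add: F_def G_def)
    qed
    moreover have "1 / (h1 * h2) = - (1 / h1 ^ 2)" unfolding h2 by (simp add: power2_eq_square)
    then have "phi m = fls_const (1 / h1 ^ 2) *
        ((\<Sum>k\<in>addable_rows m. F m k) - (\<Sum>k\<in>removable_rows m. G m k))"
      unfolding phi_def by (simp add: add_residue remove_residue F_def G_def algebra_simps)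
    ultimately show ?thesis by simp
  qed
  obtain N0 where N0: "vanishes_from N0 m" using vanishes_from_ex[OF y(1)] by blast
  define N where "N = max (Suc N0) i"
  have N: "vanishes_from N m" "vanishes_from N (shift m i 1)"
    using vanishes_from_mono[OF N0] vanishes_from_mono[OF vanishes_from_shift[OF N0 y(2)]]
        by (auto simp: N_def)
  have iN: "i \<in> {1..N}" "i \<in> {1..N + 1}" using i by (simp_all add: N_def)
  define H where "H = fls_const h1"
  have eq: "F (shift m i 1) j = F m j" "G (shift m i 1) j = G m j" if "j \<noteq> i" for j
    using that by (simp_all add: F_def G_def pos_shift)
  have FG: "F m i = 1 / W" "F (shift m i 1) i = 1 / (W - H)" "G m i = 1 / (W + H)"
      "G (shift m i 1) i = 1 / W"
    by (simp_all add: F_def G_def W_def H_def pos_shift diff_diff_eq diff_diff_eq2 add_diff_eq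
        algebra_simps
         flip: fls_minus_const fls_plus_const)
  have nz: "W \<noteq> 0" "W - H \<noteq> 0" "W + H \<noteq> 0" "H \<noteq> 0"
    using zvar_minus_const_nz[of "pos m i"] zvar_minus_const_nz[of "pos m i + h1"]
        zvar_minus_const_nz[of "pos m i - h1"] h1_nz
    by (auto simp: W_def H_def algebra_simps fls_minus_const[symmetric] fls_plus_const[symmetric])
  have S: "(\<Sum>k\<in>{1..N + 1}. F (shift m i 1) k) = 1 / (W - H) + ((\<Sum>k\<in>{1..N + 1}. F m k) - 1 / W)"
    "(\<Sum>k\<in>{1..N}. G (shift m i 1) k) = 1 / W + ((\<Sum>k\<in>{1..N}. G m k) - 1 / (W + H))"
    using iN by (simp_all add: sum.remove[of _ i] FG eq del: sum.atLeast_Suc_atMost sum.cl_ivl_Suc)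
  have d: "phi (shift m i 1) = phi m + fls_const (1 / h1 ^ 2) * (1 / (W - H) - 2 / W + 1 / (W + H))"
    unfolding phi[OF N(1)] phi[OF N(2)] S by (simp add: algebra_simps)
  have q: "L.q W = (W - H) * (W + H) * W" "L.q (- W) = - L.q W"
    unfolding L.q_def H_def using True h2 by (simp_all add: algebra_simps)
  have "(1 / (W - H) - 2 / W + 1 / (W + H)) * ((W - H) * (W + H) * W) = 2 * (H * H)"
    using nz by (simp add: divide_simps) (simp add: algebra_simps)
  moreover have "fls_const (1 / h1 ^ 2) * (2 * (H * H)) = 2"
  proof -
    have "fls_const (1 / h1 ^ 2) * (H * H) = 1" using h1_nz by (simp add: H_def power2_eq_square)
    then show ?thesis by (simp only: mult.left_commute[of _ 2]) simp
  qed
  ultimately have "fls_const (1 / h1 ^ 2) * (1 / (W - H) - 2 / W + 1 / (W + H)) * L.q W = 2"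
    unfolding q(1) mult.assoc[of "fls_const (1 / h1 ^ 2)"] by simp
  then show ?thesis unfolding d q(2) distrib_right by simp
qed

text \<open>Coefficients of \<open>phi_step\<close>: those at negative powers of \<open>z\<close> give the recursion, those at
  \<open>z\<^sup>2\<close>, \<open>z\<close> and \<open>1\<close> give the values for \<open>\<psi>\<^sub>0\<close>, \<open>\<psi>\<^sub>1\<close> and \<open>\<psi>\<^sub>2\<close>.\<close>

lemma psi_eigenvalue_step:
  assumes y: "young_seq m" "young_seq (shift m i 1)" and i: "i \<ge> 1"
  defines "x \<equiv> pos m i" and "m' \<equiv> shift m i 1"
  defines "\<Delta> \<equiv> \<lambda>n. psi_eigenvalue m' n - psi_eigenvalue m n"
  shows "\<Delta> (n + 3) - 3 * x * \<Delta> (n + 2) + 3 * x\<^sup>2 * \<Delta> (n + 1) - x ^ 3 * \<Delta> n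
      + (h1 * h2 + h1 * h3 + h2 * h3) * (\<Delta> (n + 1) - x * \<Delta> n)
          = h1 * h2 * h3 * (psi_eigenvalue m' n + psi_eigenvalue m n)" (is ?rec)
    and "\<Delta> 0 = 0" "\<Delta> 1 = 0" "\<Delta> 2 = 2"
proof -
  define s2 where "s2 = h1 * h2 + h1 * h3 + h2 * h3"
  define s3 where "s3 = h1 * h2 * h3"
  define W where "W = zvar - fls_const x"
  define D where "D = phi m' - phi m"
  have "phi m' * L.q W + phi m * L.q (- W) = 2"
    using phi_step[OF y i] by (simp add: W_def x_def m'_def)
  moreover have s: "fls_const h1 * fls_const h2 + fls_const h1 * fls_const h3
      + fls_const h2 * fls_const h3 = fls_const s2"
    "fls_const h1 * fls_const h2 * fls_const h3 = fls_const s3"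
    by (simp_all add: s2_def s3_def fls_plus_const)
  ultimately have "(W ^ 3 + fls_const s2 * W) * D = fls_const s3 * (phi m' + phi m) + 2"
    unfolding L.q_eq s D_def by (simp add: algebra_simps power3_eq_cube)
  moreover have "(W ^ 3 + fls_const s2 * W) * D = zvar * (zvar * (zvar * D))
      - fls_const (3 * x) * (zvar * (zvar * D))
     + fls_const (3 * x\<^sup>2) * (zvar * D) - fls_const (x ^ 3) * D
         + fls_const s2 * (zvar * D - fls_const x * D)"
    by (simp add: W_def algebra_simps power3_eq_cube power2_eq_square flip: fls_const_mult_const)
  ultimately have E: "zvar * (zvar * (zvar * D)) - fls_const (3 * x) * (zvar * (zvar * D))
     + fls_const (3 * x\<^sup>2) * (zvar * D) - fls_const (x ^ 3) * D
         + fls_const s2 * (zvar * D - fls_const x * D)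
     = fls_const s3 * (phi m' + phi m) + fls_const 2" by simp
  have e: "D $$ (k + 3) - 3 * x * D $$ (k + 2) + 3 * x\<^sup>2 * D $$ (k + 1) - x ^ 3 * D $$ k
     + s2 * (D $$ (k + 1) - x * D $$ k) = s3 * (phi m' $$ k + phi m $$ k)
         + (if k = 0 then 2 else 0)" for k
    using arg_cong[OF E, of "\<lambda>f. f $$ k"] by (simp add: zvar_nth add.assoc)
  have Dn: "D $$ k = (if k \<ge> 1 then \<Delta> (nat (k - 1)) else 0)" for k
    by (simp add: D_def phi_nth \<Delta>_def)
  show "\<Delta> 0 = 0" using e[of "- 2"] by (simp add: Dn phi_nth)
  moreover show "\<Delta> 1 = 0" using e[of "- 1"] calculation by (simp add: Dn phi_nth)
  ultimately show "\<Delta> 2 = 2" using e[of 0] by (simp add: Dn phi_nth numeral_2_eq_2)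
  show ?rec using e[of "int n + 1"] unfolding s2_def[symmetric] s3_def[symmetric]
    by (simp add: Dn phi_nth nat_add_distrib add.commute[of n 3])
qed

end

section \<open>The coefficients in the formulas\<close>

lemma is_young_iff: "is_young r \<longleftrightarrow> young_seq (\<lambda>i. int (r i))"
  by (simp add: is_young_def young_seq_def)

definition rows :: "young \<Rightarrow> nat \<Rightarrow> int" where "rows l i = int (row l i)"

lemma young_seq_rows [simp]: "young_seq (rows l)"
  using row[of l] unfolding rows_def[abs_def] by (simp add: is_young_iff)

lemma rows_inj: "rows l = rows l' \<Longrightarrow> l = l'"
proof -
  assume "rows l = rows l'"
  then have "row l = row l'" by (simp add: rows_def fun_eq_iff)
  then show ?thesis by (simp add: row_inject)
qed

lemma ex_rows: assumes "young_seq m" shows "\<exists>l. rows l = m"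
proof -
  have e: "(\<lambda>i. int (nat (m i))) = m" using young_seq_nonneg[OF assms] by (simp add: fun_eq_iff)
  then have "is_young (\<lambda>i. nat (m i))" using assms by (simp add: is_young_iff)
  then have "rows (Abs_young (\<lambda>i. nat (m i))) = m"
    using e by (simp add: rows_def[abs_def] Abs_young_inverse)
  then show ?thesis by blast
qed

lemma shift_rows_add: "(\<lambda>j. int (((row l)(i := row l i + 1)) j)) = shift (rows l) i 1"
  by (auto simp: shift_def rows_def fun_eq_iff)

lemma shift_rows_remove: "row l i \<ge> 1 \<Longrightarrow> (\<lambda>j. int (((row l)(i := row l i - 1)) j))
    = shift (rows l) i (- 1)"
  by (auto simp: shift_def rows_def fun_eq_iff)

lemma addable_iff: "addable l i \<longleftrightarrow> i \<ge> 1 \<and> young_seq (shift (rows l) i 1)"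
  unfolding addable_def is_young_iff shift_rows_add ..

lemma rows_fun: "rows l = (\<lambda>i. int (row l i))" by (simp add: rows_def fun_eq_iff)

lemma rows_add_box: assumes "addable l i" shows "rows (add_box l i) = shift (rows l) i 1"
proof -
  have "row (add_box l i) = (row l)(i := row l i + 1)"
    using assms by (simp add: addable_def add_box_def Abs_young_inverse del: fun_upd_apply)
  then show ?thesis unfolding rows_fun[of "add_box l i"] shift_rows_add[symmetric] by simp
qed

lemma removable_iff: "removable l i \<longleftrightarrow> i \<ge> 1 \<and> young_seq (shift (rows l) i (- 1))"
proof (cases "row l i \<ge> 1")
  case True
  then show ?thesis unfolding removable_def is_young_iff using shift_rows_remove[OF True] by simp
next
  case False
  then have "shift (rows l) i (- 1) i < 0" by (simp add: shift_apply rows_def)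
  then show ?thesis using young_seq_nonneg[of "shift (rows l) i (- 1)" i] False
      by (auto simp: removable_def)
qed

lemma rows_remove_box: assumes "removable l i" shows
    "rows (remove_box l i) = shift (rows l) i (- 1)"
proof -
  have "row (remove_box l i) = (row l)(i := row l i - 1)" "row l i \<ge> 1"
    using assms by (simp_all add: removable_def remove_box_def Abs_young_inverse del: fun_upd_apply)
  then show ?thesis unfolding rows_fun[of "remove_box l i"] using shift_rows_remove[of l i] by simp
qed

context ladder
begin

lemma coef_without_cong:
  assumes "\<And>j. j = k \<or> j \<in> below k - S \<Longrightarrow> m j = m' j" shows
      "coef_without S m k = coef_without S m' k"
proof -
  have "pos m j = pos m' j" if "j = k \<or> j \<in> below k - S" for j using assms[OF that]
      by (simp add: pos_def)
  then have "(\<Prod>j\<in>below k - S. A (gap m j k)) = (\<Prod>j\<in>below k - S. A (gap m' j k))"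
    by (intro prod.cong refl) (auto simp: gap_def)
  then show ?thesis using assms by (simp add: coef_without_def)
qed

end

context fock_parameters
begin

text \<open>The part of the telescoped coefficient of \<open>f\<close> that depends on row \<open>i\<close> only; \<open>u\<close> cancels in
  the difference of the position of row \<open>i\<close> and that of the first row beyond \<open>N\<close>.\<close>

definition f_own_factor :: "nat \<Rightarrow> nat \<Rightarrow> int \<Rightarrow> complex" where
  "f_own_factor N i x = - alpha (of_int x * h1 + (of_nat i - 1) * h2 - h1 - of_nat N * h2) / h1"

sublocale E: ladder h1 h2 h3 u 1 N "\<lambda>_ _. 1 / h1" for N by unfold_locales simp

sublocale F: ladder h1 h2 h3 u "- 1" N "f_own_factor N" for N by unfold_locales simp

lemma E_below: "i \<le> N \<Longrightarrow> E.below N i = {1..<i}" by (auto simp: E.below_def)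

lemma F_below: "i \<ge> 1 \<Longrightarrow> F.below N i = {i<..N}" by (auto simp: F.below_def)

lemma E_coef: "i \<le> N \<Longrightarrow> E.coef N m i = (\<Prod>j\<in>{1..<i}. A (pos m i - pos m j)) / h1"
  by (simp add: E.coef_without_def E_below E.gap_def)

lemma alpha_reflect: "alpha (- h1 - w) = beta w"
proof -
  have "- h1 - w - h3 = - (w - h2)" "- h1 - w = - (w + h1)" unfolding h3_eq by simp_all
  then show ?thesis unfolding alpha_def beta_def by (metis minus_divide_divide)
qed

lemma F_coef: "i \<ge> 1 \<Longrightarrow> F.coef N m i = - (\<Prod>j\<in>{i<..N}. A (pos m j - pos m i)) * alpha
    (pos m i - h1 - (of_nat N * h2 + u)) / h1"
proof -
  have "of_int (m i) * h1 + (of_nat i - 1) * h2 - h1 - of_nat N * h2 = pos m i - h1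
      - (of_nat N * h2 + u)"
    by (simp add: pos_def algebra_simps)
  then have "f_own_factor N i (m i) = - alpha (pos m i - h1 - (of_nat N * h2 + u)) / h1"
    by (simp only: f_own_factor_def)
  then show "i \<ge> 1 \<Longrightarrow> ?thesis" by (simp add: F.coef_without_def F_below F.gap_def)
qed

lemma E_coef_zero:
  assumes "young_seq m" "i \<in> {1..N}" "\<not> young_seq (shift m i 1)" shows "E.coef N m i = 0"
proof -
  have i: "i \<noteq> 1" "\<not> m i < m (i - 1)" using assms young_seq_add_iff[of m i] by auto
  then have "m i = m (i - 1)" "i - 1 \<in> {1..<i}"
      using young_seq_antimono[OF assms(1), of "i - 1" i] assms(2) by auto
  moreover have "pos m i - pos m (i - 1) = h2" using calculation unfolding pos_diff
      by (simp add: of_nat_diff)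
  ultimately show ?thesis using assms(2) by (auto simp: E_coef A_h2 intro!: bexI[of _ "i - 1"])
qed

lemma alpha_h3: "alpha h3 = 0" by (simp add: alpha_def)

text \<open>A row that is not longer than the next one contributes \<open>A h2 = 0\<close>; for row \<open>N\<close>, which has no
  successor in the product, the own factor vanishes instead.\<close>

lemma F_coef_zero:
  assumes "vanishes_from N m" "i \<in> {1..N}" "\<not> young_seq (shift m i (- 1))" shows "F.coef N m i = 0"
proof -
  have y: "young_seq m" "m N = 0" using assms(1) by (auto simp: vanishes_from_def)
  have flat: "m (i + 1) = m i" using assms(2,3) young_seq_remove_iff[OF y(1), of i]
      young_seq_antimono[OF y(1), of i "i + 1"] by auto
  show ?thesis
  proof (cases "i < N")
    case True
    then have "i + 1 \<in> {i<..N}" "pos m (i + 1) - pos m i = h2" using flat unfolding pos_diff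
        by simp_all
    then show ?thesis using assms(2) by (auto simp: F_coef A_h2 intro!: bexI[of _ "i + 1"])
  next
    case False
    then have "i = N" using assms(2) by simp
    moreover have "pos m N - h1 - (of_nat N * h2 + u) = h3" using y(2) unfolding h3_eq pos_def
        by (simp add: algebra_simps)
    ultimately show ?thesis using assms(2) by (simp add: F_coef alpha_h3)
  qed
qed

text \<open>For \<open>k < i\<close> either order produces the factors \<open>A w\<close> and \<open>A (w + h1)\<close> with \<open>w = p\<^sub>i - p\<^sub>k\<close>:
  the first step sees the other row unmoved, the second sees it moved. For \<open>k > i\<close> the two steps
  do not influence each other.\<close>

lemma EF_offdiagonal:
  assumes "i \<in> {1..N}" "k \<in> {1..N}" "i \<noteq> k"
  shows "E.coef N m i * F.coef N (shift m i 1) k = F.coef N m k * E.coef N (shift m k (- 1)) i"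
proof (cases "k < i")
  case True
  have ki: "k \<in> E.below N i" "i \<in> F.below N k" using True assms
      by (auto simp: E.below_def F.below_def)
  have cong: "E.coef_without N {k} (shift m k (- 1)) i = E.coef_without N {k} m i"
    "F.coef_without N {i} (shift m i 1) k = F.coef_without N {i} m k"
    using assms(3) by (auto intro!: E.coef_without_cong F.coef_without_cong simp: shift_apply
        split: if_splits)
  have "E.gap (shift m k (- 1)) k i = E.gap m k i + h1" "F.gap (shift m i 1) i k = F.gap m i k + h1"

       "F.gap m i k = E.gap m k i"
    using assms(3) by (simp_all add: E.gap_def F.gap_def pos_shift)
  then show ?thesis unfolding E.coef_split1[OF ki(1)] F.coef_split1[OF ki(2)] cong by simp
next
  case False
  then have "E.coef N (shift m k (- 1)) i = E.coef N m i" "F.coef N (shift m i 1) k = F.coef N m k"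
    using assms(3) by (auto intro!: E.coef_without_cong F.coef_without_cong simp: shift_apply
        E.below_def F.below_def split: if_splits)
  then show ?thesis by simp
qed

lemma prod_rows_without:
  assumes N: "vanishes_from N m" and sub: "X \<subseteq> addable_rows m" "Y \<subseteq> removable_rows m"
    and z: "\<And>j. j \<in> {1..N} - removable_rows m \<Longrightarrow> z \<noteq> pos m (Suc j) \<and> z \<noteq> pos m j - h1"
  shows "(\<Prod>j\<in>{1..N + 1} - X. alpha (z - pos m j)) * (\<Prod>j\<in>{1..N} - Y. beta (z - pos m j)) =
    (\<Prod>j\<in>addable_rows m - X. alpha (z - pos m j)) * (\<Prod>j\<in>removable_rows m - Y. beta (z - pos m j))"
proof -
  have y: "young_seq m" using N by (simp add: vanishes_from_def)
  show ?thesis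
    by (rule telescope_prod)
       (use addable_rows_subset[OF N] removable_rows_subset[OF N] first_row_addable[OF y]
           not_removable_iff[OF y] sub z in \<open>auto simp: pos_Suc_flat[OF y]\<close>)
qed

lemma prod_other_rows:
  fixes f g :: "nat \<Rightarrow> complex"
  assumes "i \<in> {1..N}"
  shows "(\<Prod>j\<in>{1..<i}. f j * g j) * (\<Prod>j\<in>{i<..N}. f j * g j) * f (N + 1) =
    (\<Prod>j\<in>{1..N + 1} - {i}. f j) * (\<Prod>j\<in>{1..N} - {i}. g j)"
proof -
  have s: "{1..N} - {i} = {1..<i} \<union> {i<..N}" "{1..N + 1} - {i} = insert (N + 1) ({1..N} - {i})"
      using assms by auto
  have "(\<Prod>j\<in>{1..N + 1} - {i}. f j) = f (N + 1) * (\<Prod>j\<in>{1..N} - {i}. f j)" unfolding s(2) using assms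
      by simp
  moreover have "(\<Prod>j\<in>{1..N} - {i}. h j) = (\<Prod>j\<in>{1..<i}. h j) * (\<Prod>j\<in>{i<..N}. h j)"
      for h :: "nat \<Rightarrow> complex"
    unfolding s(1) by (rule prod.union_disjoint) auto
  ultimately show ?thesis by (simp add: prod.distrib mult_ac)
qed

lemma pos_beyond: "vanishes_from N m \<Longrightarrow> pos m (N + 1) = of_nat N * h2 + u"
  using vanishes_fromD[of N m "N + 1"] by (simp add: pos_def)

lemma A_reflect_diff: "A (p - x - h1) = A (x - p)" using A_reflect[of "x - p"]
    by (simp add: algebra_simps)

text \<open>The rows before \<open>i\<close> come from \<open>e\<close> and those after \<open>i\<close> from \<open>f\<close>, by the symmetry of \<open>A\<close> under
  \<open>w \<mapsto> - h1 - w\<close>; together they form the product over all other rows, which telescopes to the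
  corners.\<close>

lemma EF_diagonal:
  assumes N: "vanishes_from N m" and i: "i \<in> addable_rows m"
  shows "E.coef N m i * F.coef N (shift m i 1) i = add_residue m i / (h1 * h2)"
proof -
  have y: "young_seq m" using N by (simp add: vanishes_from_def)
  have iN: "i \<in> {1..N}" using addable_rows_subset[OF N] i by blast
  let ?f = "\<lambda>j. alpha (pos m i - pos m j)" and ?g = "\<lambda>j. beta (pos m i - pos m j)"
  have "(\<Prod>j\<in>{i<..N}. A (pos (shift m i 1) j - pos (shift m i 1) i)) = (\<Prod>j\<in>{i<..N}. ?f j * ?g j)"
    by (intro prod.cong refl) (simp add: pos_shift A_reflect_diff A_eq_alpha_beta[symmetric]
        diff_diff_eq[symmetric])
  then have "E.coef N m i * F.coef N (shift m i 1) i =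
     - ((\<Prod>j\<in>{1..<i}. ?f j * ?g j) * (\<Prod>j\<in>{i<..N}. ?f j * ?g j) * ?f (N + 1)) / (h1 * h1)"
    using iN by (simp add: E_coef F_coef A_eq_alpha_beta pos_shift pos_beyond[OF N, simplified])
  also have "\<dots> = - ((\<Prod>j\<in>{1..N + 1} - {i}. ?f j) * (\<Prod>j\<in>{1..N} - {i}. ?g j)) / (h1 * h1)"
    by (simp only: prod_other_rows[OF iN, of ?f ?g])
  also have "\<dots> = (\<Prod>j\<in>{1..N + 1} - {i}. ?f j) * (\<Prod>j\<in>{1..N} - {}. ?g j) / (h1 * h2)"
  proof -
    have "(\<Prod>j\<in>{1..N}. ?g j) = - (h2 / h1) * (\<Prod>j\<in>{1..N} - {i}. ?g j)"
      using prod.remove[OF _ iN, of ?g] by (simp add: beta_def)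
    then show ?thesis using h1_nz h2_nz by simp
  qed
  also have "\<dots> = add_residue m i / (h1 * h2)"
  proof -
    have "pos m i \<noteq> pos m (Suc j) \<and> pos m i \<noteq> pos m j - h1" if j: "j \<in> {1..N} - removable_rows m"
        for j
    proof -
      have "Suc j \<notin> addable_rows m" using not_removable_iff[OF y, of j] j by auto
      then have "i \<noteq> Suc j" using i by auto
      then show ?thesis using pos_distinct[OF y, of i "Suc j"] pos_separated[OF y, of i j] i j iN
          by auto
    qed
    then show ?thesis using prod_rows_without[OF N, of "{i}" "{}" "pos m i"] i
        by (simp add: add_residue_def)
  qed
  finally show ?thesis .
qed

lemma FE_diagonal:
  assumes N: "vanishes_from N m" and i: "i \<in> removable_rows m"
  shows "F.coef N m i * E.coef N (shift m i (- 1)) i = remove_residue m i / (h1 * h2)"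
proof -
  have y: "young_seq m" using N by (simp add: vanishes_from_def)
  have iN: "i \<in> {1..N}" using removable_rows_subset[OF N] i by blast
  let ?z = "pos m i - h1"
  let ?f = "\<lambda>j. alpha (?z - pos m j)" and ?g = "\<lambda>j. beta (?z - pos m j)"
  have "A (pos m j - pos m i) = ?f j * ?g j" for j
    using A_reflect_diff[of "pos m j" ?z] by (simp add: A_eq_alpha_beta[symmetric])
  then have "F.coef N m i * E.coef N (shift m i (- 1)) i =
     - ((\<Prod>j\<in>{1..<i}. ?f j * ?g j) * (\<Prod>j\<in>{i<..N}. ?f j * ?g j) * ?f (N + 1)) / (h1 * h1)"
    using iN by (simp add: E_coef F_coef A_eq_alpha_beta pos_shift pos_beyond[OF N, simplified])
  also have "\<dots> = - ((\<Prod>j\<in>{1..N + 1} - {i}. ?f j) * (\<Prod>j\<in>{1..N} - {i}. ?g j)) / (h1 * h1)"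
    by (simp only: prod_other_rows[OF iN, of ?f ?g])
  also have "\<dots> = (\<Prod>j\<in>{1..N + 1} - {}. ?f j) * (\<Prod>j\<in>{1..N} - {i}. ?g j) / (h1 * h2)"
  proof -
    have i': "i \<in> {1..N + 1}" using iN by simp
    have "?f i = - (h2 / h1)" unfolding alpha_def unfolding h3_eq by simp
    then have "(\<Prod>j\<in>{1..N + 1}. ?f j) = - (h2 / h1) * (\<Prod>j\<in>{1..N + 1} - {i}. ?f j)"
      using prod.remove[OF _ i', of ?f] by simp
    then have "(\<Prod>j\<in>{1..N + 1} - {}. ?f j) = - (h2 / h1) * (\<Prod>j\<in>{1..N + 1} - {i}. ?f j)" by simp
    then show ?thesis using h1_nz h2_nz by (simp only:) simp
  qed
  also have "\<dots> = remove_residue m i / (h1 * h2)"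
  proof -
    have "?z \<noteq> pos m (Suc j) \<and> ?z \<noteq> pos m j - h1" if j: "j \<in> {1..N} - removable_rows m" for j
    proof -
      have "i \<noteq> j" using i j by auto
      then show ?thesis using pos_distinct[OF y, of i j] pos_separated[OF y, of "Suc j" i] i j iN
          by auto
    qed
    then show ?thesis using prod_rows_without[OF N, of "{}" "{i}" ?z] i
        by (simp add: remove_residue_def)
  qed
  finally show ?thesis .
qed

lemma row_len_rows: "row_len l i = of_int (rows l i)" by (simp add: row_len_def rows_def)

lemma inv_h1: "fls_const (1 / h1) = 1 / fls_const h1"
  using fls_const_divide_const[of 1 h1] by simp

lemma e_series_nth:
  assumes "i \<in> {1..N}"
  shows "e_series h1 h2 u l i $$ n = (if n \<ge> 1 then E.coef N (rows l) i * pos (rows l) i ^ nat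
      (n - 1) else 0)"
proof -
  have "e_num h1 h2 l i j / e_den h1 h2 l i j = A (pos (rows l) i - pos (rows l) j)" for j
    unfolding e_num_def e_den_def A_def pos_def row_len_rows unfolding h3_eq
        by (simp add: algebra_simps)
  then have c: "(\<Prod>j\<in>{1..<i}. e_num h1 h2 l i j / e_den h1 h2 l i j) = h1 * E.coef N (rows l) i"
    using assms h1_nz by (simp add: E_coef)
  have x: "row_len l i * h1 + (of_nat i - 1) * h2 + u = pos (rows l) i"
      by (simp add: pos_def row_len_rows)
  have "e_series h1 h2 u l i = fls_const (1 / h1 * (h1 * E.coef N (rows l) i)) * delta_plus
      (pos (rows l) i) / zvar"
    unfolding e_series_def c x fls_const_mult_const[symmetric, of "1 / h1"] inv_h1 by simp
  then show ?thesis unfolding geometric_fls[symmetric] using h1_nz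
      by (simp only: geometric_fls_nth) simp
qed

lemma prod_shifted_row:
  fixes g :: "nat \<Rightarrow> 'b::comm_monoid_mult"
  assumes "i \<le> N" shows "g (Suc i) * (\<Prod>j\<in>{i<..N}. g (Suc j)) = (\<Prod>j\<in>{i<..N}. g j) * g (Suc N)"
  using assms
proof (induction N rule: dec_induct)
  case (step n)
  have e: "(\<Prod>j\<in>{i<..Suc n}. f j) = f (Suc n) * (\<Prod>j\<in>{i<..n}. f j)" for f :: "nat \<Rightarrow> 'b"
  proof -
    have "{i<..Suc n} = insert (Suc n) {i<..n}" using step by auto
    then show ?thesis by simp
  qed
  have "g (Suc i) * (\<Prod>j\<in>{i<..Suc n}. g (Suc j))
      = g (Suc i) * (\<Prod>j\<in>{i<..n}. g (Suc j)) * g (Suc (Suc n))"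
    unfolding e by (simp only: mult_ac)
  also have "\<dots> = (\<Prod>j\<in>{i<..Suc n}. g j) * g (Suc (Suc n))"
    unfolding e step.IH by (simp only: mult_ac)
  finally show ?case .
qed simp

text \<open>The factor of row \<open>j\<close> in the infinite product is \<open>alpha\<close> of row \<open>j\<close> times \<open>beta\<close> of row
  \<open>j + 1\<close>; the extra factor supplies the missing \<open>beta\<close> of row \<open>i + 1\<close>, and \<open>beta\<close> of row \<open>N + 1\<close>
  is left over.\<close>

lemma f_series_nth:
  assumes N: "vanishes_from N (rows l)" and i: "i \<in> removable_rows (rows l)"
  shows "f_series h1 h2 u l i $$ n = (if n \<ge> 1 then F.coef N (rows l) i * (pos (rows l) i - h1) ^
      nat (n - 1) else 0)"
proof -
  let ?m = "rows l"
  let ?w = "\<lambda>j. pos ?m j - pos ?m i"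
  have iN: "i \<in> {1..N}" using removable_rows_subset[OF N] i by blast
  have "?m (i + 1) < ?m i" using i young_seq_remove_iff[of ?m i] by (auto simp: removable_rows_def)
  then have mi: "?m i \<ge> 1" using young_seq_nonneg[of ?m "i + 1"] by simp
  have q: "f_num h1 h2 l i j / f_den h1 h2 l i j = alpha (?w j) * beta (?w (Suc j))" for j
    unfolding f_num_def f_den_def alpha_def beta_def pos_def row_len_rows unfolding h3_eq
        by (simp add: algebra_simps)
  have last: "(row_len l (i + 1) - row_len l i) * h1 / f_last_den h1 h2 l i = beta (?w (Suc i))"
    unfolding f_last_den_def beta_def pos_def row_len_rows by (simp add: algebra_simps)
  have tail: "alpha (?w j) * beta (?w (Suc j)) = 1" if j: "j \<ge> N + 1" for j
  proof -
    have z: "?m j = 0" "?m (Suc j) = 0" using vanishes_fromD[OF N] j by auto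
    have w: "?w j = of_int (- ?m i) * h1 + of_int (int j - int i) * h2" using z unfolding pos_diff
        by simp
    have "?w j - h3 = of_int (1 - ?m i) * h1 + of_int (int j - int i + 1) * h2"
      unfolding w unfolding h3_eq by (simp add: algebra_simps)
    moreover have "of_int (1 - ?m i) * h1 + of_int (int j - int i + 1) * h2 \<noteq> 0"
      by (rule nonresonant_int) (use mi iN j in auto)
    moreover have "of_int (- ?m i) * h1 + of_int (int j - int i) * h2 \<noteq> 0"
      by (rule nonresonant_int) (use mi iN j in auto)
    ultimately have nz: "?w j \<noteq> 0" "?w j - h3 \<noteq> 0" unfolding w by simp_all
    have eqs: "?w (Suc j) - h2 = ?w j" "?w (Suc j) + h1 = ?w j - h3"
      using z unfolding pos_def h3_eq by (simp_all add: algebra_simps)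
    show ?thesis unfolding alpha_def beta_def eqs using nz by simp
  qed
  have "Prod_any (\<lambda>j. if j \<ge> i + 1 then f_num h1 h2 l i j / f_den h1 h2 l i j else 1) =
    (\<Prod>j\<in>{i<..N}. if j \<ge> i + 1 then f_num h1 h2 l i j / f_den h1 h2 l i j else 1)"
    unfolding q by (rule Prod_any.expand_superset, simp, rule subsetI, rule ccontr)
      (use tail iN in \<open>auto split: if_splits simp: not_le\<close>)
  also have "\<dots> = (\<Prod>j\<in>{i<..N}. alpha (?w j)) * (\<Prod>j\<in>{i<..N}. beta (?w (Suc j)))"
    unfolding prod.distrib[symmetric] q by (rule prod.cong) auto
  finally have "Prod_any (\<lambda>j. if j \<ge> i + 1 then f_num h1 h2 l i j / f_den h1 h2 l i j else 1) * beta
      (?w (Suc i))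
    = (\<Prod>j\<in>{i<..N}. alpha (?w j)) * (beta (?w (Suc i)) * (\<Prod>j\<in>{i<..N}. beta (?w (Suc j))))"
        by (simp add: mult_ac)
  also have "\<dots> = (\<Prod>j\<in>{i<..N}. A (?w j)) * beta (?w (Suc N))"
    using prod_shifted_row[of i N "\<lambda>j. beta (?w j)"] iN
        by (simp add: A_eq_alpha_beta prod.distrib mult_ac)
  also have "beta (?w (Suc N)) = alpha (pos ?m i - h1 - (of_nat N * h2 + u))"
    using alpha_reflect[of "?w (Suc N)"] pos_beyond[OF N] by (simp add: algebra_simps)
  finally have c: "Prod_any (\<lambda>j. if j \<ge> i + 1 then f_num h1 h2 l i j / f_den h1 h2 l i j else 1) *
      beta (?w (Suc i)) = - h1 * F.coef N ?m i"
    using iN h1_nz by (simp add: F_coef)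
  have x: "(row_len l i - 1) * h1 + (of_nat i - 1) * h2 + u = pos ?m i - h1"
      by (simp add: pos_def row_len_rows algebra_simps)
  have "f_series h1 h2 u l i = - (1 / (fls_const h1 * zvar)) * fls_const (- h1 * F.coef N ?m i) *
      delta_plus (pos ?m i - h1)"
    unfolding f_series_def last x c[symmetric] by (simp add: mult.assoc flip: fls_const_mult_const)
  also have "\<dots> = fls_const (1 / h1 * (h1 * F.coef N ?m i)) * delta_plus (pos ?m i - h1) / zvar"
    unfolding fls_const_mult_const[symmetric, of "1 / h1"] inv_h1 by simp
  finally show ?thesis unfolding geometric_fls[symmetric] using h1_nz
      by (simp only: geometric_fls_nth) simp
qed

lemma psi_series_eq: "psi_series h1 h2 u l = psi_rational (rows l)"
proof -
  let ?m = "rows l"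
  obtain N where N: "vanishes_from N ?m" using vanishes_from_ex[of ?m] by auto
  let ?a = "\<lambda>i. L.alpha (zvar - fls_const (pos ?m i))" and ?b
      = "\<lambda>i. L.beta (zvar - fls_const (pos ?m i))"
  have f: "psi_factor h1 h2 u l i = ?a (Suc i) * ?b i" for i
  proof -
    have "row_len l i * h1 + of_nat i * h2 + u = pos ?m i + h2"
      "(row_len l (i + 1) - 1) * h1 + (of_nat i - 1) * h2 + u = pos ?m (Suc i) + h3"
      "row_len l (i + 1) * h1 + of_nat i * h2 + u = pos ?m (Suc i)"
      "(row_len l i - 1) * h1 + (of_nat i - 1) * h2 + u = pos ?m i - h1"
      unfolding pos_def row_len_rows h3_eq by (simp_all add: algebra_simps)
    then show ?thesis unfolding psi_factor_def
      by (simp add: L.alpha_def L.beta_def mult_ac diff_diff_eq diff_diff_eq2 add_diff_eq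
          diff_add_eq fls_minus_const[symmetric] fls_plus_const[symmetric])
  qed
  have tail: "?a (Suc i) * ?b i = 1" if "i \<ge> N + 1" for i
  proof -
    have "?m i = 0" "?m (Suc i) = 0" using vanishes_fromD[OF N] that by auto
    then have p: "pos ?m (Suc i) = pos ?m i + h2" unfolding pos_def by (simp add: algebra_simps)
    have "zvar - fls_const (pos ?m i) \<noteq> fls_const h2" "zvar - fls_const (pos ?m i) \<noteq> - fls_const h1"
      using zvar_minus_const_nz[of "pos ?m i + h2"] zvar_minus_const_nz[of "pos ?m i - h1"]
      by (auto simp: algebra_simps fls_minus_const[symmetric] fls_plus_const[symmetric])
    then show ?thesis using L.alpha_beta_adjacent[of "zvar - fls_const (pos ?m i)"] unfolding p
      by (simp add: diff_diff_eq fls_plus_const)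
  qed
  have "Prod_any (\<lambda>i. if i \<ge> 1 then psi_factor h1 h2 u l i else 1) =
     (\<Prod>i\<in>{1..N}. if i \<ge> 1 then psi_factor h1 h2 u l i else 1)"
    unfolding f by (rule Prod_any.expand_superset, simp, rule subsetI, rule ccontr)
      (use tail in \<open>auto split: if_splits simp: not_le\<close>)
  also have "\<dots> = (\<Prod>i\<in>{1..N}. ?a (Suc i)) * (\<Prod>i\<in>{1..N}. ?b i)"
    unfolding prod.distrib[symmetric] f by (rule prod.cong) auto
  moreover have "(zvar - fls_const ((row_len l 1 - 1) * h1 - h2 + u)) /
      (zvar - fls_const (row_len l 1 * h1 + u)) = ?a 1"
  proof -
    have "(row_len l 1 - 1) * h1 - h2 + u = pos ?m 1 + h3" "row_len l 1 * h1 + u = pos ?m 1"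
      unfolding pos_def row_len_rows h3_eq by (simp_all add: algebra_simps)
    then show ?thesis by (simp add: L.alpha_def diff_diff_eq flip: fls_plus_const)
  qed
  moreover have "(\<Prod>i\<in>{1..N + 1}. ?a i) = ?a 1 * (\<Prod>i\<in>{1..N}. ?a (Suc i))"
    by (simp add: prod.atLeast_Suc_atMost_Suc_shift prod.atLeast_Suc_atMost del: prod.cl_ivl_Suc)
  ultimately show ?thesis unfolding psi_series_def psi_rational_rows[OF N]
      by (simp add: mult_ac del: prod.cl_ivl_Suc)
qed

end

section \<open>Relations among ladder operators\<close>

text \<open>In \<open>z m i\<close>, the position of the box added or removed, the removed box lies \<open>h1\<close> before the
  next free place of the row.\<close>

locale ladder_ops = ladder h1 h2 h3 u s N g + V: vector_space scale
  for h1 h2 h3 u :: complex and s N g and scale :: "complex \<Rightarrow> 'v::ab_group_add \<Rightarrow> 'v" +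
  fixes T :: "nat \<Rightarrow> 'v \<Rightarrow> 'v" and P :: "nat \<Rightarrow> 'v \<Rightarrow> 'v" and K :: "(nat \<Rightarrow> int) \<Rightarrow> 'v" and z
  defines "z \<equiv> \<lambda>m i. pos m i + (if s = 1 then 0 else - h1)"
  assumes T_linear: "Vector_Spaces.linear scale scale (T j)"
    and P_linear: "Vector_Spaces.linear scale scale (P j)"
    and ket_seq_zero: "\<not> young_seq m \<Longrightarrow> K m = 0"
    and coef_zero: "vanishes_from N m \<Longrightarrow> i \<in> {1..N} \<Longrightarrow> \<not> young_seq (step m i) \<Longrightarrow> coef m i = 0"
    and T_K: "vanishes_from N m \<Longrightarrow> T j (K m)
        = (\<Sum>i\<in>{1..N}. scale (coef m i * z m i ^ j) (K (step m i)))"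
    and P_K: "young_seq m \<Longrightarrow> P j (K m) = scale (psi_eigenvalue m j) (K m)"
begin

sublocale VP: vector_space_pair scale scale ..

text \<open>A product of ladder operators applied to a basis vector is such a sum with \<open>f\<close> a monomial;
  linear combinations of products only change \<open>f\<close>.\<close>

definition S1 where
  "S1 m f = (\<Sum>i\<in>{1..N}. scale (coef m i * f i (z m i)) (K (step m i)))"

definition S2 where
  "S2 m f = (\<Sum>i\<in>{1..N}. \<Sum>k\<in>{1..N}. scale (coef m i * coef (step m i) k * f (z m i) (z (step m i) k))

     (K (step (step m i) k)))"

definition S3 where
  "S3 m f = (\<Sum>i\<in>{1..N}. \<Sum>k\<in>{1..N}. \<Sum>l\<in>{1..N}.
     scale (coef m i * coef (step m i) k * coef (step (step m i) k) l *
       f (z m i) (z (step m i) k) (z (step (step m i) k) l)) (K (step (step (step m i) k) l)))"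

lemma S1_linear: "S1 m f + S1 m f' = S1 m (\<lambda>i x. f i x + f' i x)"
    "S1 m f - S1 m f' = S1 m (\<lambda>i x. f i x - f' i x)"
    "scale c (S1 m f) = S1 m (\<lambda>i x. c * f i x)"
  subgoal unfolding S1_def sum.distrib[symmetric] V.scale_left_distrib[symmetric]
      distrib_left[symmetric] ..
  subgoal unfolding S1_def sum_subtractf[symmetric] V.scale_left_diff_distrib[symmetric]
      right_diff_distrib[symmetric] ..
  subgoal unfolding S1_def V.scale_sum_right by (simp add: mult_ac)
  done

lemma S2_linear: "S2 m f + S2 m f' = S2 m (\<lambda>x y. f x y + f' x y)"
    "S2 m f - S2 m f' = S2 m (\<lambda>x y. f x y - f' x y)"
    "scale c (S2 m f) = S2 m (\<lambda>x y. c * f x y)"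
  subgoal unfolding S2_def sum.distrib[symmetric] V.scale_left_distrib[symmetric]
      distrib_left[symmetric] ..
  subgoal unfolding S2_def sum_subtractf[symmetric] V.scale_left_diff_distrib[symmetric]
      right_diff_distrib[symmetric] ..
  subgoal unfolding S2_def V.scale_sum_right by (simp add: mult_ac)
  done

lemma S3_linear: "S3 m f + S3 m f' = S3 m (\<lambda>x y w. f x y w + f' x y w)"
    "S3 m f - S3 m f' = S3 m (\<lambda>x y w. f x y w - f' x y w)"
  subgoal unfolding S3_def sum.distrib[symmetric] V.scale_left_distrib[symmetric]
      distrib_left[symmetric] ..
  subgoal unfolding S3_def sum_subtractf[symmetric] V.scale_left_diff_distrib[symmetric]
      right_diff_distrib[symmetric] ..
  done

lemma T_eq_S1: "vanishes_from N m \<Longrightarrow> T j (K m) = S1 m (\<lambda>_ x. x ^ j)"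
  by (simp add: T_K S1_def)

lemma step_vanishes:
  assumes "vanishes_from b m" "Suc b \<le> N" "young_seq (step m i)" shows "vanishes_from N (step m i)"
  using vanishes_from_shift[OF assms(1,3)] vanishes_from_mono assms(2) by blast

lemma T_S1:
  assumes "vanishes_from b m" "Suc b \<le> N"
  shows "T a (S1 m f) = (\<Sum>i\<in>{1..N}. \<Sum>k\<in>{1..N}.
    scale (coef m i * coef (step m i) k * (f i (z m i) * z (step m i) k ^ a))
        (K (step (step m i) k)))"
proof -
  have N: "vanishes_from N m" using vanishes_from_mono[OF assms(1)] assms(2) by simp
  have "T a (scale (coef m i * f i (z m i)) (K (step m i))) = (\<Sum>k\<in>{1..N}.
    scale (coef m i * coef (step m i) k * (f i (z m i) * z (step m i) k ^ a))
        (K (step (step m i) k)))"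
    if i: "i \<in> {1..N}" for i
  proof (cases "young_seq (step m i)")
    case True
    then show ?thesis
      unfolding VP.linear_scale[OF T_linear] T_K[OF step_vanishes[OF assms True]] V.scale_sum_right
      by (simp add: mult_ac)
  next
    case False
    then show ?thesis using coef_zero[OF N i False] VP.linear_0[OF T_linear] by simp
  qed
  then show ?thesis unfolding S1_def VP.linear_sum[OF T_linear] by simp
qed

lemma T_T:
  assumes "vanishes_from b m" "Suc b \<le> N" shows "T a (T c (K m)) = S2 m (\<lambda>x y. x ^ c * y ^ a)"
  using T_S1[OF assms, of a "\<lambda>_ x. x ^ c"] vanishes_from_mono[OF assms(1)] assms(2)
      by (simp add: T_eq_S1 S2_def)

lemma T_T_T:
  assumes "vanishes_from b m" "Suc (Suc b) \<le> N"
  shows "T a (T c (T d (K m))) = S3 m (\<lambda>x y w. x ^ d * y ^ c * w ^ a)"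
proof -
  have N: "vanishes_from N m" using vanishes_from_mono[OF assms(1)] assms(2) by simp
  have "T a (scale (coef m i * coef (step m i) k * (z m i ^ d * z (step m i) k ^ c))
      (K (step (step m i) k))) =
    (\<Sum>l\<in>{1..N}. scale (coef m i * coef (step m i) k * coef (step (step m i) k) l *
       (z m i ^ d * z (step m i) k ^ c * z (step (step m i) k) l ^ a))
           (K (step (step (step m i) k) l)))"
    if i: "i \<in> {1..N}" and k: "k \<in> {1..N}" for i k
  proof (cases "young_seq (step m i) \<and> young_seq (step (step m i) k)")
    case True
    then have "vanishes_from (Suc b) (step m i)" using vanishes_from_shift[OF assms(1)] by blast
    then have v: "vanishes_from N (step (step m i) k)" using step_vanishes[of "Suc b"] assms(2) True
        by simp
    show ?thesis
      unfolding VP.linear_scale[OF T_linear] T_K[OF v] V.scale_sum_right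
      by (simp add: mult_ac)
  next
    case False
    then have "coef m i * coef (step m i) k = 0"
      using coef_zero[OF N i] coef_zero[OF step_vanishes[OF assms(1), of i] k] assms(2) by auto
    then show ?thesis
      by (simp only: mult_zero_left V.scale_zero_left VP.linear_0[OF T_linear] sum.neutral_const)
  qed
  moreover have "Suc b \<le> N" using assms(2) by simp
  ultimately show ?thesis unfolding T_T[OF assms(1) \<open>Suc b \<le> N\<close>] S3_def S2_def
      VP.linear_sum[OF T_linear]
    by (intro sum.cong refl)
qed

lemma double_zero: "v + v = 0 \<Longrightarrow> v = (0 :: 'v)"
proof -
  assume "v + v = 0"
  then have "scale 2 v = 0" using V.scale_left_distrib[of 1 1 v] by simp
  then show ?thesis by simp
qed

lemma double_sum_symmetric:
  fixes G :: "nat \<Rightarrow> nat \<Rightarrow> 'v"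
  assumes "\<And>i k. i \<in> I \<Longrightarrow> k \<in> I \<Longrightarrow> G i k + G k i = 0" shows "(\<Sum>i\<in>I. \<Sum>k\<in>I. G i k) = 0"
proof -
  have "(\<Sum>i\<in>I. \<Sum>k\<in>I. G i k) + (\<Sum>i\<in>I. \<Sum>k\<in>I. G i k) = (\<Sum>i\<in>I. \<Sum>k\<in>I. G i k) + (\<Sum>i\<in>I. \<Sum>k\<in>I. G k i)"
    using sum.swap[of "\<lambda>i k. G i k" I I] by simp
  also have "\<dots> = 0" using assms by (simp add: sum.distrib[symmetric])
  finally show ?thesis by (rule double_zero)
qed

lemma triple_sum_symmetric:
  fixes G :: "nat \<Rightarrow> nat \<Rightarrow> nat \<Rightarrow> 'v"
  assumes "\<And>i j k. i \<in> I \<Longrightarrow> j \<in> I \<Longrightarrow> k \<in> I \<Longrightarrow>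
    G i j k + G i k j + G j i k + G j k i + G k i j + G k j i = 0"
  shows "(\<Sum>i\<in>I. \<Sum>j\<in>I. \<Sum>k\<in>I. G i j k) = 0"
proof -
  define S where "S = (\<lambda>G. \<Sum>i\<in>I. \<Sum>j\<in>I. \<Sum>k\<in>I. G i j k :: 'v)"
  have sw1: "S (\<lambda>i j k. G j i k) = S G" for G
    unfolding S_def by (rule sum.swap)
  have sw2: "S (\<lambda>i j k. G i k j) = S G" for G
    unfolding S_def by (rule sum.cong[OF refl], rule sum.swap)
  have p: "S (\<lambda>i j k. G j k i) = S G" "S (\<lambda>i j k. G k i j) = S G" "S (\<lambda>i j k. G k j i) = S G"
    using sw1[of "\<lambda>i j k. G i k j"] sw2[of "\<lambda>i j k. G j i k"] sw2[of G] sw1[of G]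
      sw1[of "\<lambda>i j k. G k i j"] by simp_all
  have "S G + S G + (S G + S G) + (S G + S G) = S G + S (\<lambda>i j k. G i k j) + S (\<lambda>i j k. G j i k) +
      S (\<lambda>i j k. G j k i) + S (\<lambda>i j k. G k i j) + S (\<lambda>i j k. G k j i)"
    unfolding p sw1[of G] sw2[of G] by (simp only: add.assoc)
  also have "\<dots> = 0" unfolding S_def sum.distrib[symmetric] using assms by simp
  finally have "scale 6 (S G) = 0"
  proof -
    assume *: "S G + S G + (S G + S G) + (S G + S G) = 0"
    have "scale 6 v = v + v + (v + v) + (v + v)" for v
      using V.scale_left_distrib[of 4 2 v] V.scale_left_distrib[of 2 2 v]
          V.scale_left_distrib[of 1 1 v] by simp
    then show ?thesis using * by simp
  qed
  then show ?thesis by (simp add: S_def)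
qed

lemma z_step: "z (step m i) k = (if k = i then z m i + of_int s * h1 else z m k)"
  by (simp add: z_def pos_shift)

text \<open>The terms for the steps \<open>i, k\<close> and \<open>k, i\<close> end in the same vector and cancel by \<open>pair_coef\<close>.\<close>

lemma S2_zero:
  assumes y: "young_seq m" and M: "\<And>x y. M x y = M y x"
    and f: "\<And>x y. f x y = M x y * q (of_int s * (y - x))"
  shows "S2 m f = 0"
  unfolding S2_def
proof (rule double_sum_symmetric)
  fix i k assume ik: "i \<in> {1..N}" "k \<in> {1..N}"
  show "scale (coef m i * coef (step m i) k * f (z m i) (z (step m i) k)) (K (step (step m i) k)) +
      scale (coef m k * coef (step m k) i * f (z m k) (z (step m k) i)) (K (step (step m k) i)) = 0"
  proof (cases "young_seq (step (step m i) k)")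
    case True
    have Msym: "M (z m i) (z (step m i) k) = M (z m k) (z (step m k) i)"
      by (cases "i = k") (simp_all add: z_step M)
    have d: "z (step m i) k - z m i = pos (step m i) k - pos m i" for i k by (simp add: z_def)
    have "coef m i * coef (step m i) k * f (z m i) (z (step m i) k)
        + coef m k * coef (step m k) i * f (z m k) (z (step m k) i)
      = M (z m k) (z (step m k) i) * (coef m i * coef (step m i) k * q
          (of_int s * (pos (step m i) k - pos m i))
       + coef m k * coef (step m k) i * q (of_int s * (pos (step m k) i - pos m k)))"
      unfolding f d Msym distrib_left by (simp only: mult_ac)
    then show ?thesis unfolding pair_coef[OF y True ik] shift_commute[of m k]
      by (simp add: V.scale_left_distrib[symmetric])
  next
    case False
    then show ?thesis using ket_seq_zero[OF False] by (simp add: shift_commute[of m k])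
  qed
qed

text \<open>The symmetric factor \<open>M\<close> takes the same value for all orders of the three steps, so the six
  terms cancel by \<open>serre_path_sum\<close>.\<close>

lemma S3_zero:
  assumes y: "young_seq m" and M: "\<And>x y w. M x y w = M y x w" "\<And>x y w. M x y w = M x w y"
    and f: "\<And>x y w. f x y w = M x y w * (x - 2 * y + w)"
  shows "S3 m f = 0"
  unfolding S3_def
proof (rule triple_sum_symmetric)
  fix i j k assume ijk: "i \<in> {1..N}" "j \<in> {1..N}" "k \<in> {1..N}"
  let ?C = "\<lambda>i j k. coef m i * coef (step m i) j * coef (step (step m i) j) k *
       f (z m i) (z (step m i) j) (z (step (step m i) j) k)"
  let ?M = "\<lambda>i j k. M (z m i) (z (step m i) j) (z (step (step m i) j) k)"
  have M1: "?M i j k = ?M j i k" for i j k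
    by (cases "i = j") (auto simp: z_step M(1) shift_commute)
  have M2: "?M i j k = ?M i k j" for i j k
    by (cases "j = k") (auto simp: z_step M(2))
  have C: "?C i j k = ?M i j k * serre_path m i j k" for i j k
    unfolding f serre_path_def by (simp add: z_def algebra_simps)
  have Ms: "?M i k j = ?M i j k" "?M j i k = ?M i j k" "?M j k i = ?M i j k" "?M k i j = ?M i j k"
      "?M k j i = ?M i j k"
    using M1 M2 by metis+
  have perm: "step (step (step m i) k) j = step (step (step m i) j) k"
     "step (step (step m j) i) k = step (step (step m i) j) k"
     "step (step (step m j) k) i = step (step (step m i) j) k"
     "step (step (step m k) i) j = step (step (step m i) j) k"
     "step (step (step m k) j) i = step (step (step m i) j) k"
     using shift_commute by metis+
  let ?K = "K (step (step (step m i) j) k)"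
  show "scale (?C i j k) (K (step (step (step m i) j) k))
      + scale (?C i k j) (K (step (step (step m i) k) j)) +
    scale (?C j i k) (K (step (step (step m j) i) k))
        + scale (?C j k i) (K (step (step (step m j) k) i)) +
    scale (?C k i j) (K (step (step (step m k) i) j))
        + scale (?C k j i) (K (step (step (step m k) j) i)) = 0"
  proof (cases "young_seq (step (step (step m i) j) k)")
    case True
    have "?M i j k * serre_path m i j k + ?M i j k * serre_path m i k j
        + ?M i j k * serre_path m j i k +
       ?M i j k * serre_path m j k i + ?M i j k * serre_path m k i j + ?M i j k * serre_path m k j i
           =
      ?M i j k * (serre_path m i j k + serre_path m i k j + serre_path m j i k + serre_path m j k i
          + serre_path m k i j + serre_path m k j i)"
      by (simp only: distrib_left)
    then show ?thesis unfolding C Ms perm serre_path_sum[OF y True ijk]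
        V.scale_left_distrib[symmetric] by simp
  next
    case False
    then show ?thesis unfolding perm using ket_seq_zero[OF False] by simp
  qed
qed

definition op_comm :: "('v \<Rightarrow> 'v) \<Rightarrow> ('v \<Rightarrow> 'v) \<Rightarrow> 'v \<Rightarrow> 'v" where
  "op_comm X Y v = X (Y v) - Y (X v)"

lemma cubic_relation:
  assumes "vanishes_from b m" "Suc b \<le> N"
  shows "op_comm (T (i + 3)) (T j) (K m) - scale 3 (op_comm (T (i + 2)) (T (j + 1)) (K m))
     + scale 3 (op_comm (T (i + 1)) (T (j + 2)) (K m)) - op_comm (T i) (T (j + 3)) (K m)
     + scale (h1 * h2 + h1 * h3 + h2 * h3)
         (op_comm (T (i + 1)) (T j) (K m) - op_comm (T i) (T (j + 1)) (K m))
     - scale (of_int s * (h1 * h2 * h3)) (T i (T j (K m)) + T j (T i (K m))) = 0"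
  unfolding op_comm_def T_T[OF assms] S2_linear
proof (rule S2_zero[where M = "\<lambda>x y. of_int s * (x ^ j * y ^ i + x ^ i * y ^ j)"], goal_cases)
  case 1 then show ?case using assms by (simp add: vanishes_from_def)
next
  case (2 x y) then show ?case by (simp add: algebra_simps)
next
  case (3 x y)
  have "of_int s * q (of_int s * w) = w ^ 3 + (h1 * h2 + h1 * h3 + h2 * h3) * w
      - of_int s * (h1 * h2 * h3)" for w
    unfolding q_eq using s_sign by (auto simp: algebra_simps power3_eq_cube)
  then have "of_int s * (x ^ j * y ^ i + x ^ i * y ^ j) * q (of_int s * (y - x)) =
    (x ^ j * y ^ i + x ^ i * y ^ j) * ((y - x) ^ 3 + (h1 * h2 + h1 * h3 + h2 * h3) * (y - x)
        - of_int s * (h1 * h2 * h3))"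
    by (metis mult.assoc mult.left_commute)
  then show ?case
    by (simp only:) (simp add: power_add power3_eq_cube power2_eq_square algebra_simps)
qed

definition serre_term :: "nat \<Rightarrow> nat \<Rightarrow> nat \<Rightarrow> 'v \<Rightarrow> 'v" where
  "serre_term i j k v = op_comm (T i) (op_comm (T j) (T (k + 1))) v"

lemma serre_term_K:
  assumes "vanishes_from b m" "Suc (Suc b) \<le> N"
  shows "serre_term i j k (K m) = S3 m (\<lambda>x y w. x ^ (k + 1) * y ^ j * w ^ i
      - x ^ j * y ^ (k + 1) * w ^ i
     - (x ^ i * y ^ (k + 1) * w ^ j - x ^ i * y ^ j * w ^ (k + 1)))"
  unfolding serre_term_def op_comm_def VP.linear_diff[OF T_linear] T_T_T[OF assms] S3_linear ..

lemma serre_relation: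
  assumes "vanishes_from b m" "Suc (Suc b) \<le> N"
  shows "serre_term i j k (K m) + serre_term i k j (K m) + serre_term j i k (K m)
       + serre_term j k i (K m) + serre_term k i j (K m) + serre_term k j i (K m) = 0"
  unfolding serre_term_K[OF assms] S3_linear
proof (rule S3_zero[where M = "\<lambda>x y w. x ^ i * y ^ j * w ^ k + x ^ i * y ^ k * w ^ j
    + x ^ j * y ^ i * w ^ k
     + x ^ j * y ^ k * w ^ i + x ^ k * y ^ i * w ^ j + x ^ k * y ^ j * w ^ i"], goal_cases)
  case 1 then show ?case using assms by (simp add: vanishes_from_def)
next
  case 2 then show ?case by (simp add: algebra_simps)
next
  case 3 then show ?case by (simp add: algebra_simps)
next
  case 4 then show ?case by (simp add: power_add algebra_simps)
qed

lemma P_T: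
  assumes "vanishes_from N m"
  shows "P a (T c (K m)) = S1 m (\<lambda>i x. x ^ c * psi_eigenvalue (step m i) a)"
proof -
  have "P a (scale (coef m i * z m i ^ c) (K (step m i))) =
     scale (coef m i * (z m i ^ c * psi_eigenvalue (step m i) a)) (K (step m i))" for i
    unfolding VP.linear_scale[OF P_linear]
    by (cases "young_seq (step m i)") (simp_all add: P_K ket_seq_zero VP.linear_0[OF P_linear]
        mult_ac)
  then show ?thesis unfolding T_K[OF assms] VP.linear_sum[OF P_linear] S1_def by simp
qed

lemma T_P:
  assumes "vanishes_from N m"
  shows "T c (P a (K m)) = S1 m (\<lambda>i x. x ^ c * psi_eigenvalue m a)"
proof -
  have y: "young_seq m" using assms by (simp add: vanishes_from_def)
  show ?thesis unfolding P_K[OF y] VP.linear_scale[OF T_linear] T_eq_S1[OF assms] S1_linear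
      by (simp add: mult.commute)
qed

lemma S1_zero:
  assumes "\<And>i. i \<in> {1..N} \<Longrightarrow> young_seq (step m i) \<Longrightarrow> f i (z m i) = 0" shows "S1 m f = 0"
  unfolding S1_def using assms ket_seq_zero
      by (intro sum.neutral ballI) (metis V.scale_zero_left V.scale_zero_right mult_zero_right)

text \<open>For \<open>s = - 1\<close> the step is the inverse of adding a box at \<open>z m i\<close>, so every difference
  changes its sign.\<close>

lemma psi_eigenvalue_ladder_step:
  assumes y: "young_seq m" "young_seq (step m i)" and i: "i \<ge> 1"
  defines "\<Delta> \<equiv> \<lambda>n. psi_eigenvalue (step m i) n - psi_eigenvalue m n" and "x \<equiv> z m i"
  shows "\<Delta> (n + 3) - 3 * x * \<Delta> (n + 2) + 3 * x\<^sup>2 * \<Delta> (n + 1) - x ^ 3 * \<Delta> n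
      + (h1 * h2 + h1 * h3 + h2 * h3) * (\<Delta> (n + 1) - x * \<Delta> n)
          = of_int s * (h1 * h2 * h3) * (psi_eigenvalue (step m i) n + psi_eigenvalue m n)"
    and "\<Delta> 0 = 0" "\<Delta> 1 = 0" "\<Delta> 2 = 2 * of_int s"
proof -
  have "(\<Delta> (n + 3) - 3 * x * \<Delta> (n + 2) + 3 * x\<^sup>2 * \<Delta> (n + 1) - x ^ 3 * \<Delta> n
      + (h1 * h2 + h1 * h3 + h2 * h3) * (\<Delta> (n + 1) - x * \<Delta> n)
          = of_int s * (h1 * h2 * h3) * (psi_eigenvalue (step m i) n + psi_eigenvalue m n))
    \<and> \<Delta> 0 = 0 \<and> \<Delta> 1 = 0 \<and> \<Delta> 2 = 2 * of_int s"
  proof (cases "s = 1")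
    case True
    then show ?thesis using psi_eigenvalue_step(1)[of m i n] psi_eigenvalue_step(2-)[of m i] assms
        unfolding z_def by simp
  next
    case False
    then have s: "s = - 1" using s_sign by simp
    have inv_step: "shift (step m i) i 1 = m" using s by (auto simp: shift_apply fun_eq_iff)
    have x: "pos (step m i) i = x" using s by (simp add: x_def z_def pos_shift)
    note st = psi_eigenvalue_step[where m = "step m i" and i = i, unfolded inv_step x, OF y(2,1) i]
    have d: "\<Delta> n = - (psi_eigenvalue m n - psi_eigenvalue (step m i) n)" for n by (simp add: \<Delta>_def)
    show ?thesis using st(1)[of n] st(2-) unfolding d s by (simp add: algebra_simps)
  qed
  then show "\<Delta> (n + 3) - 3 * x * \<Delta> (n + 2) + 3 * x\<^sup>2 * \<Delta> (n + 1) - x ^ 3 * \<Delta> n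
      + (h1 * h2 + h1 * h3 + h2 * h3) * (\<Delta> (n + 1) - x * \<Delta> n)
          = of_int s * (h1 * h2 * h3) * (psi_eigenvalue (step m i) n + psi_eigenvalue m n)"
    and "\<Delta> 0 = 0" "\<Delta> 1 = 0" "\<Delta> 2 = 2 * of_int s" by blast+
qed

lemma psi_cubic_relation:
  assumes "vanishes_from N m"
  shows "op_comm (P (i + 3)) (T j) (K m) - scale 3 (op_comm (P (i + 2)) (T (j + 1)) (K m))
     + scale 3 (op_comm (P (i + 1)) (T (j + 2)) (K m)) - op_comm (P i) (T (j + 3)) (K m)
     + scale (h1 * h2 + h1 * h3 + h2 * h3)
         (op_comm (P (i + 1)) (T j) (K m) - op_comm (P i) (T (j + 1)) (K m))
     - scale (of_int s * (h1 * h2 * h3)) (P i (T j (K m)) + T j (P i (K m))) = 0"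
  unfolding op_comm_def P_T[OF assms] T_P[OF assms] S1_linear
proof (rule S1_zero, goal_cases)
  case (1 k)
  have y: "young_seq m" using assms by (simp add: vanishes_from_def)
  let ?p = "psi_eigenvalue (step m k)" and ?r = "psi_eigenvalue m" and ?x = "z m k"
  have "k \<ge> 1" using 1 by simp
  note st = psi_eigenvalue_ladder_step(1)[OF y 1(2) this, of i]
  have "?x ^ j * ((?p (i + 3) - ?r (i + 3)) - 3 * ?x * (?p (i + 2) - ?r (i + 2))
      + 3 * ?x\<^sup>2 * (?p (i + 1) - ?r (i + 1))
      - ?x ^ 3 * (?p i - ?r i) + (h1 * h2 + h1 * h3 + h2 * h3) *
          ((?p (i + 1) - ?r (i + 1)) - ?x * (?p i - ?r i)))
     - ?x ^ j * (of_int s * (h1 * h2 * h3) * (?p i + ?r i)) = 0"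
    using st by simp
  then show ?case by (simp add: power_add power3_eq_cube power2_eq_square algebra_simps)
qed

lemma psi_low_relations:
  assumes "vanishes_from N m"
  shows "op_comm (P 0) (T j) (K m) = 0" "op_comm (P 1) (T j) (K m) = 0"
    "op_comm (P 2) (T j) (K m) = scale (2 * of_int s) (T j (K m))"
proof -
  have y: "young_seq m" using assms by (simp add: vanishes_from_def)
  note st = psi_eigenvalue_ladder_step(2-)[OF y]
  show "op_comm (P 0) (T j) (K m) = 0" "op_comm (P 1) (T j) (K m) = 0"
    unfolding op_comm_def P_T[OF assms] T_P[OF assms] S1_linear
    by (rule S1_zero, use st in \<open>simp add: right_diff_distrib[symmetric]\<close>)+
  have "op_comm (P 2) (T j) (K m) - scale (2 * of_int s) (T j (K m)) = 0"
    unfolding op_comm_def P_T[OF assms] T_P[OF assms] unfolding T_eq_S1[OF assms] S1_linear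
    by (rule S1_zero, use st in \<open>simp add: right_diff_distrib[symmetric]\<close>)
  then show "op_comm (P 2) (T j) (K m) = scale (2 * of_int s) (T j (K m))" by simp
qed

end

section \<open>Actions of the presented algebra\<close>

lemma ring_free_ring: "ring free_ring"
proof (intro ringI abelian_groupI monoidI)
  fix x :: yangian_free
  assume "x \<in> carrier free_ring"
  show "\<exists>y\<in>carrier free_ring. y \<oplus>\<^bsub>free_ring\<^esub> x = \<zero>\<^bsub>free_ring\<^esub>"
    by (rule bexI[of _ "- x"]) (simp_all add: free_ring_def)
qed (simp_all add: free_ring_def algebra_simps)

interpretation FR: ring free_ring by (rule ring_free_ring)

lemma free_ring_simps [simp]:
  "carrier free_ring = UNIV" "x \<otimes>\<^bsub>free_ring\<^esub> y = x * y" "x \<oplus>\<^bsub>free_ring\<^esub> y = x + y"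
  "\<one>\<^bsub>free_ring\<^esub> = 1" "\<zero>\<^bsub>free_ring\<^esub> = 0"
  by (simp_all add: free_ring_def)

lemma free_ring_minus: "x \<ominus>\<^bsub>free_ring\<^esub> y = x - y"
proof -
  have "\<ominus>\<^bsub>free_ring\<^esub> y = - y" by (rule FR.minus_equality) simp_all
  then show ?thesis by (simp add: a_minus_def)
qed

lemma ideal_yangian: "ideal (yangian_ideal h1 h2 h3) free_ring"
  unfolding yangian_ideal_def by (rule FR.genideal_ideal) simp

lemma yangian_class_eq_iff: "yangian_class h1 h2 h3 x = yangian_class h1 h2 h3 y \<longleftrightarrow> x - y
    \<in> yangian_ideal h1 h2 h3"
  using FR.quotient_eq_iff_same_a_r_cos[OF ideal_yangian, of x y h1 h2 h3]
  by (simp add: yangian_class_def free_ring_minus)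

lemma relation_in_ideal: "r \<in> yangian_relations h1 h2 h3 \<Longrightarrow> r \<in> yangian_ideal h1 h2 h3"
  unfolding yangian_ideal_def using FR.genideal_self[of "yangian_relations h1 h2 h3"] by auto

lemma affine_yangian_ops:
  "carrier (affine_yangian h1 h2 h3) = range (yangian_class h1 h2 h3)"
  "yangian_class h1 h2 h3 x \<otimes>\<^bsub>affine_yangian h1 h2 h3\<^esub> yangian_class h1 h2 h3 y
      = yangian_class h1 h2 h3 (x * y)"
  "yangian_class h1 h2 h3 x \<oplus>\<^bsub>affine_yangian h1 h2 h3\<^esub> yangian_class h1 h2 h3 y
      = yangian_class h1 h2 h3 (x + y)"
  "\<one>\<^bsub>affine_yangian h1 h2 h3\<^esub> = yangian_class h1 h2 h3 1"
  "c \<odot>\<^bsub>affine_yangian h1 h2 h3\<^esub> yangian_class h1 h2 h3 x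
      = yangian_class h1 h2 h3 (free_const c * x)"
proof -
  interpret I: ideal "yangian_ideal h1 h2 h3" free_ring by (rule ideal_yangian)
  show "carrier (affine_yangian h1 h2 h3) = range (yangian_class h1 h2 h3)"
    unfolding affine_yangian_def Let_def FactRing_def A_RCOSETS_def RCOSETS_def
        yangian_class_def[abs_def] a_r_coset_def
    by auto
  show m: "yangian_class h1 h2 h3 x \<otimes>\<^bsub>affine_yangian h1 h2 h3\<^esub> yangian_class h1 h2 h3 y
      = yangian_class h1 h2 h3 (x * y)" for x y
    using I.rcoset_mult_add[of x y] by (simp add: affine_yangian_def Let_def FactRing_def
        yangian_class_def)
  show "yangian_class h1 h2 h3 x \<oplus>\<^bsub>affine_yangian h1 h2 h3\<^esub> yangian_class h1 h2 h3 y
      = yangian_class h1 h2 h3 (x + y)"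
    using I.a_rcos_sum[of x y] by (simp add: affine_yangian_def Let_def FactRing_def
        yangian_class_def)
  show "\<one>\<^bsub>affine_yangian h1 h2 h3\<^esub> = yangian_class h1 h2 h3 1"
    by (simp add: affine_yangian_def Let_def FactRing_def yangian_class_def)
  show "c \<odot>\<^bsub>affine_yangian h1 h2 h3\<^esub> yangian_class h1 h2 h3 x
      = yangian_class h1 h2 h3 (free_const c * x)"
    using m[of "free_const c" x] by (simp add: affine_yangian_def Let_def)
qed

lemma single_word_Cons: "Poly_Mapping.single (Word (g # gs)) c
    = free_gen g * Poly_Mapping.single (Word gs) (c :: complex)"
  by (simp add: free_gen_def mult_single)

lemma single_word_const: "Poly_Mapping.single w c
    = free_const c * Poly_Mapping.single w (1 :: complex)"
  by (simp add: free_const_def mult_single)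

lemma free_induct [case_names zero add single]:
  fixes x :: yangian_free
  assumes "P 0" "\<And>x y. P x \<Longrightarrow> P y \<Longrightarrow> P (x + y)" "\<And>w c. P (Poly_Mapping.single w c)"
  shows "P x"
proof -
  have s: "P (\<Sum>w\<in>S. Poly_Mapping.single w (Poly_Mapping.lookup x w))" if "finite S" for S
    using that by (induction S rule: finite_induct) (auto simp: assms)
  have "x = (\<Sum>w\<in>Poly_Mapping.keys x. Poly_Mapping.single w (Poly_Mapping.lookup x w))"
    by (rule poly_mapping_eqI) (auto simp: lookup_sum lookup_single when_def in_keys_iff sum.delta)
  then show ?thesis using s[of "Poly_Mapping.keys x"] by simp
qed

lemma word_gen_induct [case_names one gen]:
  assumes "P 1" "\<And>g x. P x \<Longrightarrow> P (free_gen g * x)"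
  shows "P (Poly_Mapping.single w (1 :: complex))"
proof (cases w)
  case (Word gs)
  have "P (Poly_Mapping.single (Word gs) (1 :: complex))"
  proof (induction gs)
    case Nil
    have "Poly_Mapping.single (Word [] :: yangian_gen word) (1 :: complex) = 1"
        by (simp flip: zero_word_def)
    then show ?case using assms(1) by simp
  qed (simp add: single_word_Cons assms(2))
  then show ?thesis using Word by simp
qed

text \<open>A family of linear operators indexed by the generators extends to the free algebra; the
  extension descends to the quotient as soon as it annihilates the relations.\<close>

locale free_rep = V: vector_space scale for scale :: "complex \<Rightarrow> 'v::ab_group_add \<Rightarrow> 'v" +
  fixes act :: "yangian_gen \<Rightarrow> 'v \<Rightarrow> 'v"
  assumes act_linear: "Vector_Spaces.linear scale scale (act g)"
begin

sublocale VP: vector_space_pair scale scale ..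

fun word_act :: "yangian_gen word \<Rightarrow> 'v \<Rightarrow> 'v" where
  "word_act (Word gs) v = foldr act gs v"

lemma word_act_add: "word_act (w + w') v = word_act w (word_act w' v)"
  by (cases w; cases w') simp

lemma word_act_zero: "word_act 0 v = v" by (simp add: zero_word_def)

lemma word_act_linear: "Vector_Spaces.linear scale scale (word_act w)"
proof (cases w)
  case (Word gs)
  have "Vector_Spaces.linear scale scale (foldr act gs)"
  proof (induction gs)
    case Nil
    then show ?case using V.linear_id by (simp add: id_def)
  next
    case (Cons g gs)
    have "foldr act (g # gs) = act g \<circ> foldr act gs" by (simp add: fun_eq_iff)
    then show ?case using Vector_Spaces.linear_compose[OF Cons.IH act_linear] by (simp only:)
  qed
  moreover have "word_act w = foldr act gs" using Word by (simp add: fun_eq_iff)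
  ultimately show ?thesis by simp
qed

definition free_act :: "yangian_free \<Rightarrow> 'v \<Rightarrow> 'v" where
  "free_act x v = (\<Sum>w\<in>Poly_Mapping.keys x. scale (Poly_Mapping.lookup x w) (word_act w v))"

lemma free_act_superset:
  assumes "finite S" "Poly_Mapping.keys x \<subseteq> S"
  shows "free_act x v = (\<Sum>w\<in>S. scale (Poly_Mapping.lookup x w) (word_act w v))"
  unfolding free_act_def using assms by (intro sum.mono_neutral_left) (auto simp: in_keys_iff)

lemma free_act_add: "free_act (x + y) v = free_act x v + free_act y v"
proof -
  let ?S = "Poly_Mapping.keys x \<union> Poly_Mapping.keys y"
  have "Poly_Mapping.keys (x + y) \<subseteq> ?S" by (rule Poly_Mapping.keys_add)
  then show ?thesis
    using free_act_superset[of ?S "x + y"] free_act_superset[of ?S x] free_act_superset[of ?S y]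
    by (simp add: lookup_add V.scale_left_distrib sum.distrib)
qed

lemma free_act_zero: "free_act 0 v = 0" by (simp add: free_act_def)

lemma free_act_minus: "free_act (x - y) v = free_act x v - free_act y v"
  using free_act_add[of "x - y" y v] by (simp add: algebra_simps)

lemma free_act_single: "free_act (Poly_Mapping.single w c) v = scale c (word_act w v)"
  using free_act_superset[of "{w}" "Poly_Mapping.single w c"] by simp

lemma free_act_linear: "Vector_Spaces.linear scale scale (free_act x)"
  unfolding free_act_def
  by (intro VP.linear_compose_sum ballI VP.linear_compose_scale_right word_act_linear)

lemma free_act_mult: "free_act (x * y) v = free_act x (free_act y v)"
proof (induction x rule: free_induct)
  case (single w c)
  show ?case
  proof (induction y rule: free_induct)
    case (single w' c')
    show ?case by (simp add: mult_single free_act_single word_act_add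
        VP.linear_scale[OF word_act_linear])
  next
    case (add y y')
    then show ?case by (simp add: distrib_left free_act_add VP.linear_add[OF free_act_linear])
  qed (simp add: free_act_zero VP.linear_0[OF free_act_linear])
qed (simp_all add: free_act_zero free_act_add distrib_right)

lemma free_act_gen: "free_act (free_gen g) v = act g v"
  by (simp add: free_gen_def free_act_single)

lemma free_act_const: "free_act (free_const c) v = scale c v"
  by (simp add: free_const_def free_act_single word_act_zero)

lemma free_act_one: "free_act 1 v = v"
  using free_act_const[of 1] by (simp add: free_const_def)

lemma numeral_eq_const: "(numeral n :: yangian_free) = free_const (numeral n)"
  by (simp add: free_const_def single_numeral)

lemmas free_act_simps = free_act_add free_act_minus free_act_mult free_act_gen free_act_const
    free_act_one
  free_act_zero

text \<open>The annihilated elements form a two-sided ideal, and \<open>yangian_ideal\<close> is the least ideal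
  containing the relations.\<close>

lemma ideal_annihilated:
  assumes "\<And>r v. r \<in> yangian_relations h1 h2 h3 \<Longrightarrow> free_act r v = 0" and "x \<in> yangian_ideal h1 h2 h3"
  shows "free_act x v = 0"
proof -
  let ?K = "{x. \<forall>v. free_act x v = 0}"
  have neg: "\<ominus>\<^bsub>free_ring\<^esub> x = - x" for x by (rule FR.minus_equality) simp_all
  have "ideal ?K free_ring"
  proof (rule idealI[OF ring_free_ring])
    show "subgroup ?K (add_monoid free_ring)"
    proof (rule FR.add.subgroupI)
      fix x assume "x \<in> ?K"
      then have "- x \<in> ?K" using free_act_minus[of 0 x] by (simp add: free_act_zero)
      then show "\<ominus>\<^bsub>free_ring\<^esub> x \<in> ?K" by (simp add: neg)
    qed (auto simp: free_act_simps intro: exI[of _ 0])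
  qed (auto simp: free_act_simps VP.linear_0[OF free_act_linear])
  then have "yangian_ideal h1 h2 h3 \<subseteq> ?K"
    unfolding yangian_ideal_def by (rule FR.genideal_minimal) (use assms(1) in auto)
  then show ?thesis using assms(2) by auto
qed

lemma yangian_action_exists:
  assumes rel: "\<And>r v. r \<in> yangian_relations h1 h2 h3 \<Longrightarrow> free_act r v = 0"
  shows "\<exists>\<rho>. yangian_action h1 h2 h3 scale \<rho>
      \<and> (\<forall>g. \<rho> (yangian_class h1 h2 h3 (free_gen g)) = act g)"
proof -
  let ?Y = "affine_yangian h1 h2 h3" and ?cl = "yangian_class h1 h2 h3"
  define \<rho> where "\<rho> = (\<lambda>A. if A \<in> carrier ?Y then free_act (SOME x. ?cl x = A) else undefined)"
  have rho: "\<rho> (?cl x) = free_act x" for x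
  proof -
    have "?cl (SOME y. ?cl y = ?cl x) = ?cl x" by (rule someI) (rule refl)
    then have "free_act ((SOME y. ?cl y = ?cl x) - x) v = 0" for v
      using ideal_annihilated[OF rel] by (simp add: yangian_class_eq_iff)
    then show ?thesis by (simp add: \<rho>_def affine_yangian_ops(1) free_act_minus fun_eq_iff)
  qed
  have "yangian_action h1 h2 h3 scale \<rho>"
    unfolding yangian_action_def
  proof (intro conjI allI ballI)
    show "\<rho> \<in> extensional (carrier ?Y)" by (simp add: \<rho>_def extensional_def)
    show "\<rho> \<in> ring_hom ?Y (endo_algebra scale)"
    proof (rule ring_hom_memI)
      fix A assume "A \<in> carrier ?Y"
      then show "\<rho> A \<in> carrier (endo_algebra scale)"
        by (auto simp: affine_yangian_ops(1) rho endo_algebra_def free_act_linear)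
    next
      fix A B assume "A \<in> carrier ?Y" "B \<in> carrier ?Y"
      then obtain x y where [simp]: "A = ?cl x" "B = ?cl y" by (auto simp: affine_yangian_ops(1))
      show "\<rho> (A \<otimes>\<^bsub>?Y\<^esub> B) = \<rho> A \<otimes>\<^bsub>endo_algebra scale\<^esub> \<rho> B"
        by (simp add: affine_yangian_ops rho endo_algebra_def free_act_mult fun_eq_iff)
      show "\<rho> (A \<oplus>\<^bsub>?Y\<^esub> B) = \<rho> A \<oplus>\<^bsub>endo_algebra scale\<^esub> \<rho> B"
        by (simp add: affine_yangian_ops rho endo_algebra_def free_act_add fun_eq_iff)
    next
      show "\<rho> \<one>\<^bsub>?Y\<^esub> = \<one>\<^bsub>endo_algebra scale\<^esub>"
        by (simp add: affine_yangian_ops rho endo_algebra_def free_act_one fun_eq_iff)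
    qed
    fix c A assume "A \<in> carrier ?Y"
    then obtain x where [simp]: "A = ?cl x" by (auto simp: affine_yangian_ops(1))
    show "\<rho> (c \<odot>\<^bsub>?Y\<^esub> A) = c \<odot>\<^bsub>endo_algebra scale\<^esub> \<rho> A"
      by (simp add: affine_yangian_ops rho endo_algebra_def free_act_simps fun_eq_iff)
  qed
  moreover have "\<rho> (?cl (free_gen g)) = act g" for g by (simp add: rho free_act_gen fun_eq_iff)
  ultimately show ?thesis by blast
qed

end

lemma yangian_action_class:
  fixes scale :: "complex \<Rightarrow> 'v::ab_group_add \<Rightarrow> 'v"
  assumes "yangian_action h1 h2 h3 scale \<rho>"
  shows "\<rho> (yangian_class h1 h2 h3 (x * y)) v
      = \<rho> (yangian_class h1 h2 h3 x) (\<rho> (yangian_class h1 h2 h3 y) v)"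
    "\<rho> (yangian_class h1 h2 h3 (x + y)) v = \<rho> (yangian_class h1 h2 h3 x) v
        + \<rho> (yangian_class h1 h2 h3 y) v"
    "\<rho> (yangian_class h1 h2 h3 1) v = v"
    "\<rho> (yangian_class h1 h2 h3 (free_const c * x)) v = scale c (\<rho> (yangian_class h1 h2 h3 x) v)"
    "Vector_Spaces.linear scale scale (\<rho> (yangian_class h1 h2 h3 x))"
proof -
  let ?Y = "affine_yangian h1 h2 h3" and ?cl = "yangian_class h1 h2 h3"
  have hom: "\<rho> \<in> ring_hom ?Y (endo_algebra scale)"
    and sm: "\<And>c A. A \<in> carrier ?Y \<Longrightarrow> \<rho> (c \<odot>\<^bsub>?Y\<^esub> A) = c \<odot>\<^bsub>endo_algebra scale\<^esub> \<rho> A"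
    using assms by (auto simp: yangian_action_def)
  have c: "?cl x \<in> carrier ?Y" for x by (simp add: affine_yangian_ops(1))
  show "\<rho> (?cl (x * y)) v = \<rho> (?cl x) (\<rho> (?cl y) v)"
    using ring_hom_mult[OF hom c c, of x y] by (simp add: affine_yangian_ops endo_algebra_def)
  show "\<rho> (?cl (x + y)) v = \<rho> (?cl x) v + \<rho> (?cl y) v"
    using ring_hom_add[OF hom c c, of x y] by (simp add: affine_yangian_ops endo_algebra_def)
  show "\<rho> (?cl 1) v = v"
    using ring_hom_one[OF hom] by (simp add: affine_yangian_ops endo_algebra_def)
  show "\<rho> (?cl (free_const c * x)) v = scale c (\<rho> (?cl x) v)"
    using sm[OF c, of c x] by (simp add: affine_yangian_ops endo_algebra_def)
  show "Vector_Spaces.linear scale scale (\<rho> (?cl x))"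
    using ring_hom_closed[OF hom c, of x] by (simp add: endo_algebra_def)
qed

lemma yangian_action_eqI:
  assumes \<rho>: "yangian_action h1 h2 h3 scale \<rho>" and \<rho>': "yangian_action h1 h2 h3 scale \<rho>'"
    and gen: "\<And>g. \<rho> (yangian_class h1 h2 h3 (free_gen g))
        = \<rho>' (yangian_class h1 h2 h3 (free_gen g))"
  shows "\<rho> = \<rho>'"
proof (rule extensionalityI)
  let ?Y = "affine_yangian h1 h2 h3" and ?cl = "yangian_class h1 h2 h3"
  show "\<rho> \<in> extensional (carrier ?Y)" "\<rho>' \<in> extensional (carrier ?Y)"
    using \<rho> \<rho>' by (simp_all add: yangian_action_def)
  fix A assume "A \<in> carrier ?Y"
  then obtain x where A: "A = ?cl x" by (auto simp: affine_yangian_ops(1))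
  note s = yangian_action_class[OF \<rho>] yangian_action_class[OF \<rho>']
  have word: "\<rho> (?cl (Poly_Mapping.single w 1)) = \<rho>' (?cl (Poly_Mapping.single w 1))" for w
    by (induction w rule: word_gen_induct) (simp_all add: fun_eq_iff s gen)
  have "\<rho> (?cl x) = \<rho>' (?cl x)"
  proof (induction x rule: free_induct)
    case zero
    show ?case using s(2)[of 0 0] s(7)[of 0 0] by (simp add: fun_eq_iff)
  next
    case (add x y)
    then show ?case by (simp add: fun_eq_iff s)
  next
    case (single w c)
    show ?case unfolding single_word_const[of w c] using word[of w] by (simp add: fun_eq_iff s(4,9))
  qed
  then show "\<rho> A = \<rho>' A" by (simp add: A)
qed

section \<open>The Fock module\<close>

locale fock_space = fock_parameters h1 h2 h3 u + V: vector_space scale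
  for h1 h2 h3 u :: complex and scale :: "complex \<Rightarrow> 'v::ab_group_add \<Rightarrow> 'v" +
  fixes ket :: "young \<Rightarrow> 'v"
  assumes basis: "is_basis scale ket"
begin

sublocale VP: vector_space_pair scale scale ..

definition extend :: "(young \<Rightarrow> 'v) \<Rightarrow> 'v \<Rightarrow> 'v" where
  "extend f = (SOME T. Vector_Spaces.linear scale scale T \<and> (\<forall>l. T (ket l) = f l))"

lemma extend: "Vector_Spaces.linear scale scale (extend f)" "extend f (ket l) = f l"
proof -
  have inj: "inj ket" and ind: "V.independent (range ket)"
    using basis by (auto simp: is_basis_def)
  obtain T where T: "Vector_Spaces.linear scale scale T"
      "\<forall>x\<in>range ket. T x = (f \<circ> inv_into UNIV ket) x"
    using VP.linear_independent_extend[OF ind, of "f \<circ> inv_into UNIV ket"] by blast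
  then have "\<exists>T. Vector_Spaces.linear scale scale T \<and> (\<forall>l. T (ket l) = f l)"
    using inj by (intro exI[of _ T]) simp
  then have "Vector_Spaces.linear scale scale (extend f) \<and> (\<forall>l. extend f (ket l) = f l)"
    unfolding extend_def by (rule someI_ex)
  then show "Vector_Spaces.linear scale scale (extend f)" "extend f (ket l) = f l" by auto
qed

lemma linear_eqI:
  assumes "Vector_Spaces.linear scale scale S" "Vector_Spaces.linear scale scale T"
      "\<And>l. S (ket l) = T (ket l)"
  shows "S = T"
proof
  fix v
  have "v \<in> V.span (range ket)" using basis by (simp add: is_basis_def)
  then show "S v = T v" by (rule VP.linear_eq_on[OF assms(1,2)]) (auto simp: assms(3))
qed

text \<open>Integer sequences that are not diagrams stand for the zero vector, so sums over rows need no
  side conditions.\<close>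

definition ket_seq :: "(nat \<Rightarrow> int) \<Rightarrow> 'v" where
  "ket_seq m = (if young_seq m then ket (THE l. rows l = m) else 0)"

lemma ket_seq_rows: "ket_seq (rows l) = ket l"
proof -
  have "(THE l'. rows l' = rows l) = l" using rows_inj by blast
  then show ?thesis by (simp add: ket_seq_def)
qed

lemma ket_seq_zero: "\<not> young_seq m \<Longrightarrow> ket_seq m = 0" by (simp add: ket_seq_def)

definition E_op :: "nat \<Rightarrow> 'v \<Rightarrow> 'v" where
  "E_op j = extend (\<lambda>l. \<Sum>i | addable l i. scale (e_series h1 h2 u l i $$ (int j + 1))
      (ket (add_box l i)))"

definition F_op :: "nat \<Rightarrow> 'v \<Rightarrow> 'v" where
  "F_op j = extend (\<lambda>l. \<Sum>i | removable l i. scale (f_series h1 h2 u l i $$ (int j + 1))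
      (ket (remove_box l i)))"

definition Psi_op :: "nat \<Rightarrow> 'v \<Rightarrow> 'v" where
  "Psi_op j = extend (\<lambda>l. scale (psi_eigenvalue (rows l) j) (ket l))"

lemma op_linear: "Vector_Spaces.linear scale scale (E_op j)"
    "Vector_Spaces.linear scale scale (F_op j)"
    "Vector_Spaces.linear scale scale (Psi_op j)"
  by (simp_all add: E_op_def F_op_def Psi_op_def extend)

lemma addable_rows_rows: "addable_rows (rows l) = {i. addable l i}"
    by (simp add: addable_rows_def addable_iff)

lemma removable_rows_rows: "removable_rows (rows l) = {i. removable l i}"
    by (simp add: removable_rows_def removable_iff)

lemma E_op_ket_seq:
  assumes "vanishes_from N m"
  shows "E_op j (ket_seq m) = (\<Sum>i\<in>{1..N}. scale (E.coef N m i * pos m i ^ j)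
      (ket_seq (shift m i 1)))"
proof -
  have y: "young_seq m" using assms by (simp add: vanishes_from_def)
  obtain l where [simp]: "m = rows l" using ex_rows[OF y] by blast
  have "E_op j (ket_seq m) = (\<Sum>i\<in>addable_rows m. scale (e_series h1 h2 u l i $$ (int j + 1))
      (ket (add_box l i)))"
    by (simp add: ket_seq_rows E_op_def extend addable_rows_rows)
  also have "\<dots> = (\<Sum>i\<in>addable_rows m. scale (E.coef N m i * pos m i ^ j) (ket_seq (shift m i 1)))"
  proof (rule sum.cong[OF refl])
    fix i assume i: "i \<in> addable_rows m"
    then have "addable l i" by (simp add: addable_rows_rows)
    then have "ket_seq (shift m i 1) = ket (add_box l i)"
        using ket_seq_rows[of "add_box l i"] rows_add_box by simp
    moreover have "i \<in> {1..N}" using addable_rows_subset[OF assms] i by blast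
    note e_series_nth[OF this, of l]
    ultimately show "scale (e_series h1 h2 u l i $$ (int j + 1)) (ket (add_box l i))
        = scale (E.coef N m i * pos m i ^ j) (ket_seq (shift m i 1))"
      by simp
  qed
  also have "\<dots> = (\<Sum>i\<in>{1..N}. scale (E.coef N m i * pos m i ^ j) (ket_seq (shift m i 1)))"
    by (intro sum.mono_neutral_left) (use addable_rows_subset[OF assms] in \<open>auto
        simp: addable_rows_def ket_seq_def\<close>)
  finally show ?thesis .
qed

lemma F_op_ket_seq:
  assumes "vanishes_from N m"
  shows "F_op j (ket_seq m) = (\<Sum>i\<in>{1..N}. scale (F.coef N m i * (pos m i - h1) ^ j)
      (ket_seq (shift m i (- 1))))"
proof -
  have y: "young_seq m" using assms by (simp add: vanishes_from_def)
  obtain l where [simp]: "m = rows l" using ex_rows[OF y] by blast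
  have "F_op j (ket_seq m) = (\<Sum>i\<in>removable_rows m. scale (f_series h1 h2 u l i $$ (int j + 1))
      (ket (remove_box l i)))"
    by (simp add: ket_seq_rows F_op_def extend removable_rows_rows)
  also have "\<dots> = (\<Sum>i\<in>removable_rows m. scale (F.coef N m i * (pos m i - h1) ^ j)
      (ket_seq (shift m i (- 1))))"
  proof (rule sum.cong[OF refl])
    fix i assume i: "i \<in> removable_rows m"
    then have "removable l i" by (simp add: removable_rows_rows)
    then have "ket_seq (shift m i (- 1)) = ket (remove_box l i)"
        using ket_seq_rows[of "remove_box l i"] rows_remove_box by simp
    then show "scale (f_series h1 h2 u l i $$ (int j + 1)) (ket (remove_box l i))
        = scale (F.coef N m i * (pos m i - h1) ^ j) (ket_seq (shift m i (- 1)))"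
      using f_series_nth[of N l i] assms i by simp
  qed
  also have "\<dots> = (\<Sum>i\<in>{1..N}. scale (F.coef N m i * (pos m i - h1) ^ j) (ket_seq (shift m i (- 1))))"
    by (intro sum.mono_neutral_left) (use removable_rows_subset[OF assms] in \<open>auto
        simp: removable_rows_def ket_seq_def\<close>)
  finally show ?thesis .
qed

lemma Psi_op_ket_seq: "young_seq m \<Longrightarrow> Psi_op j (ket_seq m) = scale (psi_eigenvalue m j) (ket_seq m)"
proof -
  assume "young_seq m"
  then obtain l where "m = rows l" using ex_rows by blast
  then show ?thesis by (simp add: ket_seq_rows Psi_op_def extend)
qed

sublocale EO: ladder_ops h1 h2 h3 u 1 N "\<lambda>_ _. 1 / h1" scale E_op Psi_op ket_seq
    "\<lambda>m i. pos m i + (if (1::int) = 1 then 0 else - h1)" for N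
proof (intro ladder_ops.intro ladder_ops_axioms.intro E.ladder_axioms V.vector_space_axioms)
  fix j m assume "vanishes_from N m"
  then show "E_op j (ket_seq m) = (\<Sum>i\<in>{1..N}. scale
      (E.coef N m i * (pos m i + (if (1::int) = 1 then 0 else - h1)) ^ j) (ket_seq (shift m i 1)))"
    using E_op_ket_seq by simp
next
  fix m i assume "vanishes_from N m" "i \<in> {1..N}" "\<not> young_seq (shift m i 1)"
  then show "E.coef N m i = 0" using E_coef_zero by (simp add: vanishes_from_def)
qed (simp_all add: op_linear Psi_op_ket_seq ket_seq_zero)

sublocale FO: ladder_ops h1 h2 h3 u "- 1" N "f_own_factor N" scale F_op Psi_op ket_seq
    "\<lambda>m i. pos m i + (if (- 1::int) = 1 then 0 else - h1)" for N
proof (intro ladder_ops.intro ladder_ops_axioms.intro F.ladder_axioms V.vector_space_axioms)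
  fix j m assume "vanishes_from N m"
  then show "F_op j (ket_seq m) = (\<Sum>i\<in>{1..N}. scale
      (F.coef N m i * (pos m i + (if (- 1::int) = 1 then 0 else - h1)) ^ j)
      (ket_seq (shift m i (- 1))))"
    using F_op_ket_seq by simp
next
  fix m i assume "vanishes_from N m" "i \<in> {1..N}" "\<not> young_seq (shift m i (- 1))"
  then show "F.coef N m i = 0" by (rule F_coef_zero)
qed (simp_all add: op_linear Psi_op_ket_seq ket_seq_zero)

text \<open>The double sums for the two products run over the same vectors. Their coefficients agree off
  the diagonal, and the diagonal terms are the residues that make up \<open>psi_eigenvalue\<close>.\<close>

lemma EF_commutator:
  assumes "young_seq m"
  shows "E_op a (F_op c (ket_seq m)) - F_op c (E_op a (ket_seq m)) = Psi_op (a + c) (ket_seq m)"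
proof -
  obtain b where b: "vanishes_from b m" using vanishes_from_ex[OF assms] by blast
  define N where "N = Suc b"
  have N: "vanishes_from N m" using vanishes_from_mono[OF b] by (simp add: N_def)
  have step: "vanishes_from N (shift m i s)" if "young_seq (shift m i s)" for i s
    using vanishes_from_shift[OF b that] by (simp add: N_def)
  let ?v = "\<lambda>i k. ket_seq (shift (shift m i 1) k (- 1))"
  define X where "X = (\<lambda>i k. E.coef N m i * pos m i ^ a *
      (F.coef N (shift m i 1) k * (pos (shift m i 1) k - h1) ^ c))"
  define Y where "Y = (\<lambda>i k. F.coef N m k * (pos m k - h1) ^ c *
      (E.coef N (shift m k (- 1)) i * pos (shift m k (- 1)) i ^ a))"
  have "F_op c (scale (E.coef N m i * pos m i ^ a) (ket_seq (shift m i 1)))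
      = (\<Sum>k\<in>{1..N}. scale (X i k) (?v i k))" if "i \<in> {1..N}" for i
  proof (cases "young_seq (shift m i 1)")
    case True
    then show ?thesis unfolding VP.linear_scale[OF op_linear(2)] F_op_ket_seq[OF step[OF True]]
        V.scale_sum_right X_def by simp
  next
    case False
    then have "E.coef N m i = 0" by (rule E_coef_zero[OF assms that])
    then show ?thesis by (simp add: X_def VP.linear_0[OF op_linear(2)])
  qed
  then have FE: "F_op c (E_op a (ket_seq m)) = (\<Sum>i\<in>{1..N}. \<Sum>k\<in>{1..N}. scale (X i k) (?v i k))"
    unfolding E_op_ket_seq[OF N] VP.linear_sum[OF op_linear(2)] by simp
  have "E_op a (scale (F.coef N m k * (pos m k - h1) ^ c) (ket_seq (shift m k (- 1))))
      = (\<Sum>i\<in>{1..N}. scale (Y i k) (?v i k))" if "k \<in> {1..N}" for k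
  proof (cases "young_seq (shift m k (- 1))")
    case True
    have com: "shift (shift m i 1) k (- 1) = shift (shift m k (- 1)) i 1" for i
        by (rule shift_commute)
    show ?thesis unfolding VP.linear_scale[OF op_linear(1)] E_op_ket_seq[OF step[OF True]]
        V.scale_sum_right Y_def com by simp
  next
    case False
    then have "F.coef N m k = 0" by (rule F_coef_zero[OF N that])
    then show ?thesis by (simp add: Y_def VP.linear_0[OF op_linear(1)])
  qed
  then have "E_op a (F_op c (ket_seq m)) = (\<Sum>k\<in>{1..N}. \<Sum>i\<in>{1..N}. scale (Y i k) (?v i k))"
    unfolding F_op_ket_seq[OF N] VP.linear_sum[OF op_linear(1)] by simp
  also have "\<dots> = (\<Sum>i\<in>{1..N}. \<Sum>k\<in>{1..N}. scale (Y i k) (?v i k))" by (rule sum.swap)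
  finally have "E_op a (F_op c (ket_seq m)) - F_op c (E_op a (ket_seq m))
      = (\<Sum>i\<in>{1..N}. \<Sum>k\<in>{1..N}. scale (Y i k - X i k) (?v i k))"
    unfolding FE by (simp add: sum_subtractf V.scale_left_diff_distrib)
  also have "\<dots> = (\<Sum>i\<in>{1..N}. \<Sum>k\<in>{1..N}. if k = i then scale (Y i i - X i i) (ket_seq m) else 0)"
  proof (intro sum.cong refl)
    fix i k assume ik: "i \<in> {1..N}" "k \<in> {1..N}"
    have "shift (shift m i 1) i (- 1) = m" by (auto simp: shift_apply fun_eq_iff)
    moreover have "Y i k = X i k" if "k \<noteq> i"
      using EF_offdiagonal[OF ik, of m] that unfolding X_def Y_def by (simp add: pos_shift mult_ac)
    ultimately show "scale (Y i k - X i k) (?v i k)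
        = (if k = i then scale (Y i i - X i i) (ket_seq m) else 0)" by auto
  qed
  also have "\<dots> = scale (\<Sum>i\<in>{1..N}. Y i i - X i i) (ket_seq m)" by (simp add: V.scale_sum_left)
  also have "(\<Sum>i\<in>{1..N}. Y i i - X i i) = psi_eigenvalue m (a + c)"
  proof -
    have "(\<Sum>i\<in>{1..N}. X i i) = (\<Sum>i\<in>addable_rows m. X i i)"
      using addable_rows_subset[OF N] E_coef_zero[OF assms] by (intro sum.mono_neutral_right)
          (auto simp: addable_rows_def X_def)
    also have "\<dots> = (\<Sum>i\<in>addable_rows m. add_residue m i * pos m i ^ (a + c) / (h1 * h2))"
    proof (rule sum.cong[OF refl])
      fix i assume i: "i \<in> addable_rows m"
      have "X i i = add_residue m i / (h1 * h2) * (pos m i ^ a * pos m i ^ c)"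
        unfolding EF_diagonal[OF N i, symmetric] X_def by (simp add: pos_shift)
      then show "X i i = add_residue m i * pos m i ^ (a + c) / (h1 * h2)" by (simp add: power_add)
    qed
    finally have X: "(\<Sum>i\<in>{1..N}. X i i) = (\<Sum>i\<in>addable_rows m. add_residue m i * pos m i ^ (a + c)) /
        (h1 * h2)"
      by (simp add: sum_divide_distrib)
    have "(\<Sum>i\<in>{1..N}. Y i i) = (\<Sum>i\<in>removable_rows m. Y i i)"
      using removable_rows_subset[OF N] F_coef_zero[OF N] by (intro sum.mono_neutral_right)
          (auto simp: removable_rows_def Y_def)
    also have "\<dots> = (\<Sum>i\<in>removable_rows m. remove_residue m i * (pos m i - h1) ^ (a + c) / (h1 * h2))"
    proof (rule sum.cong[OF refl])
      fix i assume i: "i \<in> removable_rows m"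
      have "Y i i = remove_residue m i / (h1 * h2) * ((pos m i - h1) ^ c * (pos m i - h1) ^ a)"
        unfolding FE_diagonal[OF N i, symmetric] Y_def by (simp add: pos_shift)
      then show "Y i i = remove_residue m i * (pos m i - h1) ^ (a + c) / (h1 * h2)"
          by (simp add: power_add mult_ac)
    qed
    finally have "(\<Sum>i\<in>{1..N}. Y i i) = (\<Sum>i\<in>removable_rows m. remove_residue m i * (pos m i - h1) ^
        (a + c)) / (h1 * h2)"
      by (simp add: sum_divide_distrib)
    then show ?thesis unfolding sum_subtractf X psi_eigenvalue_def
        by (simp add: diff_divide_distrib)
  qed
  also have "scale (psi_eigenvalue m (a + c)) (ket_seq m) = Psi_op (a + c) (ket_seq m)"
      using Psi_op_ket_seq[OF assms] by simp
  finally show ?thesis .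
qed

primrec gen_act :: "yangian_gen \<Rightarrow> 'v \<Rightarrow> 'v" where
  "gen_act (E j) = E_op j" | "gen_act (F j) = F_op j" | "gen_act (Psi j) = Psi_op j"

sublocale R: free_rep scale gen_act
proof (intro free_rep.intro free_rep_axioms.intro V.vector_space_axioms)
  fix g show "Vector_Spaces.linear scale scale (gen_act g)" by (cases g) (simp_all add: op_linear)
qed

lemma free_act_comm: "R.free_act (comm x y) v = R.free_act x (R.free_act y v)
    - R.free_act y (R.free_act x v)"
  by (simp add: comm_def R.free_act_simps)

lemma free_act_anticomm: "R.free_act (anticomm x y) v = R.free_act x (R.free_act y v)
    + R.free_act y (R.free_act x v)"
  by (simp add: anticomm_def R.free_act_simps)

lemma free_act_numeral: "R.free_act (numeral n) v = scale (numeral n) v"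
  unfolding R.numeral_eq_const R.free_act_const ..

lemmas free_simps = free_act_comm free_act_anticomm free_act_numeral R.free_act_simps gen_act.simps

text \<open>An operator vanishes if it annihilates the basis; on a basis vector each relation is one of
  the identities above, with \<open>N\<close> two more than a row bound to leave room for three steps.\<close>

lemma relations_act:
  assumes r: "r \<in> yangian_relations h1 h2 h3" shows "R.free_act r v = 0"
proof -
  have "R.free_act r = (\<lambda>_. 0)"
  proof (rule linear_eqI)
    show "Vector_Spaces.linear scale scale (R.free_act r)" by (rule R.free_act_linear)
    show "Vector_Spaces.linear scale scale (\<lambda>_. 0)" by (rule VP.linear_zero)
    fix l
    let ?m = "rows l"
    obtain b where b: "vanishes_from b ?m" using vanishes_from_ex[of ?m] by auto
    define N where "N = Suc (Suc b)"
    have N: "vanishes_from N ?m" "Suc b \<le> N" "Suc (Suc b) \<le> N"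
      using vanishes_from_mono[OF b] by (simp_all add: N_def)
    note E = EO.cubic_relation[OF b N(2), unfolded EO.op_comm_def] and F
        = FO.cubic_relation[OF b N(2), unfolded FO.op_comm_def]
    note PE = EO.psi_cubic_relation[OF N(1), unfolded EO.op_comm_def] and PF
        = FO.psi_cubic_relation[OF N(1), unfolded FO.op_comm_def]
    note PE' = EO.psi_low_relations[OF N(1), unfolded EO.op_comm_def] and PF'
        = FO.psi_low_relations[OF N(1), unfolded FO.op_comm_def]
    note SE = EO.serre_relation[OF b N(3), unfolded EO.serre_term_def EO.op_comm_def]
      and SF = FO.serre_relation[OF b N(3), unfolded FO.serre_term_def FO.op_comm_def]
    have PP: "Psi_op i (Psi_op j (ket_seq ?m))
        = scale (psi_eigenvalue ?m i * psi_eigenvalue ?m j) (ket_seq ?m)" for i j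
      by (simp add: Psi_op_ket_seq VP.linear_scale[OF op_linear(3)] mult.commute)
    have "R.free_act r (ket_seq ?m) = 0"
      using r unfolding yangian_relations_def Let_def
    proof (elim UnE CollectE exE conjE)
      fix i j assume "r = comm (free_gen (Psi i)) (free_gen (Psi j))"
      then show ?thesis by (simp add: free_simps PP mult.commute)
    next
      fix i j assume "r = comm (free_gen (E i)) (free_gen (F j)) - free_gen (Psi (i + j))"
      then show ?thesis using EF_commutator[of ?m i j] by (simp add: free_simps)
    next
      fix i j assume "r = cubic (sigma2 h1 h2 h3) (\<lambda>j. free_gen (E j)) (\<lambda>j. free_gen (E j)) i j
        - free_const (sigma3 h1 h2 h3) * anticomm (free_gen (E i)) (free_gen (E j))"
      then show ?thesis using E[of i j] by (simp add: cubic_def sigma2_def sigma3_def free_simps)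
    next
      fix i j assume "r = cubic (sigma2 h1 h2 h3) (\<lambda>j. free_gen (F j)) (\<lambda>j. free_gen (F j)) i j
        + free_const (sigma3 h1 h2 h3) * anticomm (free_gen (F i)) (free_gen (F j))"
      then show ?thesis using F[of i j] by (simp add: cubic_def sigma2_def sigma3_def free_simps)
    next
      fix i j assume "r = cubic (sigma2 h1 h2 h3) (\<lambda>j. free_gen (Psi j)) (\<lambda>j. free_gen (E j)) i j
        - free_const (sigma3 h1 h2 h3) * anticomm (free_gen (Psi i)) (free_gen (E j))"
      then show ?thesis using PE[of i j] by (simp add: cubic_def sigma2_def sigma3_def free_simps)
    next
      fix i j assume "r = cubic (sigma2 h1 h2 h3) (\<lambda>j. free_gen (Psi j)) (\<lambda>j. free_gen (F j)) i j
        + free_const (sigma3 h1 h2 h3) * anticomm (free_gen (Psi i)) (free_gen (F j))"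
      then show ?thesis using PF[of i j] by (simp add: cubic_def sigma2_def sigma3_def free_simps)
    next
      fix j assume "r = comm (free_gen (Psi 0)) (free_gen (E j))"
      then show ?thesis using PE'(1)[of j] by (simp add: free_simps)
    next
      fix j assume "r = comm (free_gen (Psi 1)) (free_gen (E j))"
      then show ?thesis using PE'(2)[of j] by (simp add: free_simps)
    next
      fix j assume "r = comm (free_gen (Psi 2)) (free_gen (E j)) - 2 * free_gen (E j)"
      then show ?thesis using PE'(3)[of j] by (simp add: free_simps)
    next
      fix j assume "r = comm (free_gen (Psi 0)) (free_gen (F j))"
      then show ?thesis using PF'(1)[of j] by (simp add: free_simps)
    next
      fix j assume "r = comm (free_gen (Psi 1)) (free_gen (F j))"
      then show ?thesis using PF'(2)[of j] by (simp add: free_simps)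
    next
      fix j assume "r = comm (free_gen (Psi 2)) (free_gen (F j)) + 2 * free_gen (F j)"
      then show ?thesis using PF'(3)[of j] by (simp add: free_simps)
    next
      fix i j k assume "r = serre (\<lambda>j. free_gen (E j)) i j k"
      then show ?thesis using SE[of i j k] by (simp add: serre_def Let_def free_simps)
    next
      fix i j k assume "r = serre (\<lambda>j. free_gen (F j)) i j k"
      then show ?thesis using SF[of i j k] by (simp add: serre_def Let_def free_simps)
    qed
    then show "R.free_act r (ket l) = 0" by (simp add: ket_seq_rows)
  qed
  then show ?thesis by simp
qed

text \<open>Coefficientwise the formulas for \<open>e\<close> and \<open>f\<close> fix the operators on the basis, whereas the
  formula for \<open>\<psi>\<close> fixes only the multiples by \<open>\<sigma>\<^sub>3\<close>.\<close>

lemma fock_formulas_iff: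
  "fock_formulas h1 h2 h3 u scale ket \<rho> \<longleftrightarrow>
    (\<forall>l j. \<rho> (yangian_e h1 h2 h3 j) (ket l) = E_op j (ket l)) \<and>
    (\<forall>l j. \<rho> (yangian_f h1 h2 h3 j) (ket l) = F_op j (ket l)) \<and>
    (\<forall>l j. scale (sigma3 h1 h2 h3) (\<rho> (yangian_psi h1 h2 h3 j) (ket l))
        = scale (sigma3 h1 h2 h3) (Psi_op j (ket l)))"
proof -
  have e0: "e_series h1 h2 u l i $$ n = 0" if "addable l i" "n < 1" for l i n
    using that e_series_nth[of i i l n] by (simp add: addable_iff)
  have f0: "f_series h1 h2 u l i $$ n = 0" if i: "removable l i" and "n < 1" for l i n
  proof -
    obtain N where "vanishes_from N (rows l)" using vanishes_from_ex[of "rows l"] by auto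
    then show ?thesis using f_series_nth[of N l i n] i \<open>n < 1\<close> by (simp add: removable_rows_rows)
  qed
  have cur: "(\<forall>n. current x n = g n) \<longleftrightarrow> (\<forall>j. x j = g (int j + 1))" if "\<And>n. n < 1 \<Longrightarrow> g n = 0"
    for x :: "nat \<Rightarrow> 'v" and g
  proof
    assume *: "\<forall>n. current x n = g n"
    show "\<forall>j. x j = g (int j + 1)"
    proof
      fix j show "x j = g (int j + 1)" using *[rule_format, of "int j + 1"]
          by (simp add: current_def)
    qed
  next
    assume *: "\<forall>j. x j = g (int j + 1)"
    show "\<forall>n. current x n = g n"
    proof
      fix n show "current x n = g n" using *[rule_format, of "nat (n - 1)"] that[of n]
          by (simp add: current_def)
    qed
  qed
  have E: "(\<forall>n. current x n = (\<Sum>i | addable l i. series_ket scale (e_series h1 h2 u l i)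
      (ket (add_box l i)) n))
     \<longleftrightarrow> (\<forall>j. x j = E_op j (ket l))" for x l
    by (subst cur) (auto simp: series_ket_def e0 E_op_def extend)
  have F: "(\<forall>n. current x n = (\<Sum>i | removable l i. series_ket scale (f_series h1 h2 u l i)
      (ket (remove_box l i)) n))
     \<longleftrightarrow> (\<forall>j. x j = F_op j (ket l))" for x l
    by (subst cur) (auto simp: series_ket_def f0 F_op_def extend)
  have P: "(\<forall>n. series_ket scale 1 (ket l) n + scale (sigma3 h1 h2 h3) (current x n)
      = series_ket scale (psi_series h1 h2 u l) (ket l) n)
    \<longleftrightarrow> (\<forall>j. scale (sigma3 h1 h2 h3) (x j) = scale (sigma3 h1 h2 h3) (Psi_op j (ket l)))" for x l
  proof -
    have "series_ket scale (psi_series h1 h2 u l) (ket l) n = series_ket scale 1 (ket l) n +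
       scale (sigma3 h1 h2 h3) (if n \<ge> 1 then Psi_op (nat (n - 1)) (ket l) else 0)" for n
      using Psi_op_ket_seq[of "rows l"]
      by (simp add: psi_series_eq psi_rational_phi series_ket_def phi_nth sigma3_def
          V.scale_left_distrib ket_seq_rows)
    then have "(\<forall>n. series_ket scale 1 (ket l) n + scale (sigma3 h1 h2 h3) (current x n)
        = series_ket scale (psi_series h1 h2 u l) (ket l) n)
      \<longleftrightarrow> (\<forall>n. current (\<lambda>j. scale (sigma3 h1 h2 h3) (x j)) n
          = (if n \<ge> 1 then scale (sigma3 h1 h2 h3) (Psi_op (nat (n - 1)) (ket l)) else 0))"
      by (auto simp: current_def)
    then show ?thesis by (subst (asm) cur) auto
  qed
  show ?thesis unfolding fock_formulas_def E F P ..
qed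

theorem unique_action:
  "\<exists>!\<rho>. yangian_action h1 h2 h3 scale \<rho> \<and> fock_formulas h1 h2 h3 u scale ket \<rho>"
proof (rule ex_ex1I)
  obtain \<rho> where "yangian_action h1 h2 h3 scale \<rho>"
      "\<And>g. \<rho> (yangian_class h1 h2 h3 (free_gen g)) = gen_act g"
    using R.yangian_action_exists[OF relations_act] by blast
  moreover from this have "fock_formulas h1 h2 h3 u scale ket \<rho>"
    by (simp add: fock_formulas_iff yangian_e_def yangian_f_def yangian_psi_def)
  ultimately show "\<exists>\<rho>. yangian_action h1 h2 h3 scale \<rho> \<and> fock_formulas h1 h2 h3 u scale ket \<rho>"
      by blast
next
  have gen: "\<rho> (yangian_class h1 h2 h3 (free_gen g)) = gen_act g"
    if act: "yangian_action h1 h2 h3 scale \<rho>" and ff: "fock_formulas h1 h2 h3 u scale ket \<rho>" for \<rho> g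
  proof -
    note cl = yangian_action_class[OF act]
    have e: "\<rho> (yangian_class h1 h2 h3 (free_gen (E j))) = E_op j" for j
      by (rule linear_eqI[OF cl(5) op_linear(1)])
          (use ff in \<open>simp add: fock_formulas_iff yangian_e_def\<close>)
    have f: "\<rho> (yangian_class h1 h2 h3 (free_gen (F j))) = F_op j" for j
      by (rule linear_eqI[OF cl(5) op_linear(2)])
          (use ff in \<open>simp add: fock_formulas_iff yangian_f_def\<close>)
    have "\<rho> (yangian_class h1 h2 h3 (free_gen (Psi j))) (ket l) = Psi_op j (ket l)" for j l
    proof -

      \<comment> \<open>The relation \<open>[e\<^sub>j, f\<^sub>0] = \<psi>\<^sub>j\<close> determines \<open>\<psi>\<^sub>j\<close> even when \<open>\<sigma>\<^sub>3 = 0\<close>.\<close>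
      let ?e = "free_gen (E j)" and ?f = "free_gen (F 0)" and ?p = "free_gen (Psi j)"
      have "comm (free_gen (E j)) (free_gen (F 0)) - free_gen (Psi (j + 0)) \<in>
          {comm (free_gen (E i)) (free_gen (F j)) - free_gen (Psi (i + j)) | i j. True}" by blast
      then have "comm (free_gen (E j)) (free_gen (F 0)) - free_gen (Psi (j + 0))
          \<in> yangian_relations h1 h2 h3"
        unfolding yangian_relations_def Let_def by (simp only: Un_iff simp_thms)
      then have "yangian_class h1 h2 h3 (?e * ?f) = yangian_class h1 h2 h3 (?p + ?f * ?e)"
        unfolding yangian_class_eq_iff using relation_in_ideal by (simp add: comm_def algebra_simps)
      then have "\<rho> (yangian_class h1 h2 h3 (?e * ?f)) (ket l)
          = \<rho> (yangian_class h1 h2 h3 (?p + ?f * ?e)) (ket l)" by simp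
      then have "E_op j (F_op 0 (ket l)) = \<rho> (yangian_class h1 h2 h3 ?p) (ket l)
          + F_op 0 (E_op j (ket l))"
        by (simp add: cl(1,2) e f)
      then show ?thesis using EF_commutator[of "rows l" j 0] by (simp add: ket_seq_rows)
    qed
    then have "\<rho> (yangian_class h1 h2 h3 (free_gen (Psi j))) = Psi_op j" for j
      by (intro linear_eqI[OF cl(5) op_linear(3)])
    then show ?thesis using e f by (cases g) simp_all
  qed
  fix \<rho> \<rho>'
  assume "yangian_action h1 h2 h3 scale \<rho> \<and> fock_formulas h1 h2 h3 u scale ket \<rho>"
    "yangian_action h1 h2 h3 scale \<rho>' \<and> fock_formulas h1 h2 h3 u scale ket \<rho>'"
  then show "\<rho> = \<rho>'" using gen by (intro yangian_action_eqI) auto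
qed

end

theorem proposition4p4:
  fixes h1 h2 h3 u :: complex
    and scale :: "complex \<Rightarrow> 'v::ab_group_add \<Rightarrow> 'v"
    and ket :: "young \<Rightarrow> 'v"
  assumes "h1 + h2 + h3 = 0"
    and "denominators_nonzero h1 h2"
    and "vector_space scale"
    and "is_basis scale ket"
  shows "\<exists>!\<rho>. yangian_action h1 h2 h3 scale \<rho> \<and> fock_formulas h1 h2 h3 u scale ket \<rho>"
proof -
  interpret vector_space scale by (rule assms(3))
  interpret fock_space h1 h2 h3 u scale ket
    using assms(1,2,4) by unfold_locales (auto simp: denominators_nonzero_iff)
  show ?thesis by (rule unique_action)
qed

end
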